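(* Let $H\le F$ be a non-trivial subgroup, $X=H\backslash F$ its Schreier graph with origin $o=H$ and core $X_*$, $T$ a geodesic spanning tree of $X$ (with respect to $o$), and $\Omega,\Delta\subset\partial F$ the associated Schreier limit set and Schreier fundamental domain. Let $\Lambda\subset\partial F$ be the (full) limit set of $H$. Then: (i) Under the correspondence between $\partial F$ and the set of infinite paths without backtracking in $X$ starting at $o$, the set $\Lambda$ corresponds to the set of paths which eventually stay inside the core $X_*$. (ii) $\Lambda$ is the closure $\overline\Omega$ of $\Omega$ in $\partial F$. (iii) The complement $\partial F\setminus\Lambda$ is the disjoint union of the $H$-translates $h\Theta$, $h\in H$, of the set $\Theta=\Delta\cap(\partial F\setminus\Lambda)$. The set $\Theta$ is open in $\partial F$, and it corresponds to the set of infinite paths without backtracking from $o$ which do not pass through any of the edges of $X$ not in $T$ and eventually stay inside a hanging branch. (iv) $\Lambda=\Omega$ (equivalently, $\Delta=\Theta$) if and only if $H$ is finitely generated.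
   Context: $F$ is the free group freely generated by a finite set $\mathcal A$ with $|\mathcal A|=m\ge 2$; $\breve{\mathcal A}=\mathcal A\sqcup\mathcal A^{-1}$. Elements of $F$ are identified with finite freely reduced words in $\breve{\mathcal A}$. $\partial F$ is the set of infinite freely reduced words in $\breve{\mathcal A}$ with the product topology; $F$ acts on it by concatenation followed by free reduction. $\widehat F=F\cup\partial F$ is the natural compactification: $g_n\in F$ converges to $\omega\in\partial F$ iff the reduced words of $g_n$ converge pointwise to $\omega$. The (full) limit set $\Lambda$ of $H$ is the set of all points of $\partial F$ that are limit points of $H$ in $\widehat F$. Schreier graph: $X=H\backslash F$ has the cosets $Hg$ as vertices and, for each vertex $x$ and $a\in\breve{\mathcal A}$, an oriented edge from $x$ to $xa$ labelled $a$, whose reversal is the edge from $xa$ to $x$ labelled $a^{-1}$ (loops and multiple edges allowed); $o=H$. Reading edge labels identifies the set of infinite paths in $X$ from $o$ without backtracking (no edge immediately followed by its reversal) with $\partial F$. A spanning tree $T$ is geodesic if $d_T(o,x)=d_X(o,x)$ for all $x$. Schreier generators: for every oriented edge $\mathcal E=[x,y]$ of $X$ not in $T$, let $s=s_{\mathcal E}\in H$ be read along $[o,x]_T[x,y][y,o]_T$ (with $[\cdot,\cdot]_T$ the geodesic in $T$), and let $\sigma_-(s),\sigma_0(s),\sigma_+(s)$ be the words read along the three parts. The set $\breve{\mathcal S}$ of all $s_{\mathcal E}$ equals $\mathcal S\sqcup\mathcal S^{-1}$ with $\mathcal S=\{s:\sigma_0(s)\in\mathcal A\}$ a free generating set of $H$.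 For each infinite freely reduced word $\xi=s_1s_2\dots$ in $\breve{\mathcal S}$ the limit $\sigma^\infty(\xi)=\lim_n s_1\cdots s_n\in\partial F$ exists; $\Omega$ is the set of all these limits. $\Delta$ is the set of infinite words in $\partial F$ not beginning with any $\sigma_-(s)\sigma_0(s)$, $s\in\breve{\mathcal S}$. Hanging branches and core: a branch of the $2m$-regular tree is a subtree with one vertex (the root) of degree $1$ and all other vertices (its interior) of full degree $2m$. A hanging branch of $X$ is a subgraph of $X$ isomorphic (with its labelling) to a branch of the Cayley tree of $F$. The core $X_*$ is the subgraph obtained by removing from $X$ all the edges and all the interior vertices of all hanging branches. *)

theory Defs
  imports
    "HOL-Analysis.Function_Topology"
    "HOL-Library.Disjoint_Sets"
    "HOL-Library.Cardinality"
    "HOL-Algebra.Generated_Groups"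
    "Graph_Theory.Graph_Theory"
begin

section \<open>The free group\<close>

text \<open>
  The free generators are the elements of a type \<open>'a\<close>.  The letter \<open>(a, True)\<close> stands for
  the generator \<open>a\<close> and \<open>(a, False)\<close> for its formal inverse.
\<close>

type_synonym 'a letter = "'a \<times> bool"
type_synonym 'a fword = "'a letter list"
type_synonym 'a ray = "nat \<Rightarrow> 'a letter"

definition linv :: "'a letter \<Rightarrow> 'a letter" where
  "linv a = (fst a, \<not> snd a)"

definition reduced :: "'a fword \<Rightarrow> bool" where
  "reduced w \<longleftrightarrow> successively (\<lambda>a b. b \<noteq> linv a) w"

fun cons_red :: "'a letter \<Rightarrow> 'a fword \<Rightarrow> 'a fword" where
  "cons_red a [] = [a]"
| "cons_red a (b # w) = (if b = linv a then w else a # b # w)"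

text \<open>Free reduction, performed from the right end of the word.\<close>

definition free_reduce :: "'a fword \<Rightarrow> 'a fword" where
  "free_reduce w = foldr cons_red w []"

definition free_group :: "'a fword monoid" where
  "free_group = \<lparr>carrier = {w. reduced w}, monoid.mult = (\<lambda>u v. free_reduce (u @ v)), monoid.one = []\<rparr>"

lemma linv_linv [simp]: "linv (linv a) = a"
  by (simp add: linv_def)

lemma linv_neq [simp]: "linv a \<noteq> a" "a \<noteq> linv a"
  by (auto simp: linv_def prod_eq_iff)

lemma reduced_simps [simp]:
  "reduced []" "reduced [a]" "reduced (a # b # w) \<longleftrightarrow> b \<noteq> linv a \<and> reduced (b # w)"
  by (auto simp: reduced_def)

lemma reduced_ConsD: "reduced (a # w) \<Longrightarrow> reduced w"
  by (cases w) auto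

lemma reduced_cons_red: "reduced w \<Longrightarrow> reduced (cons_red a w)"
  by (cases w) (auto dest: reduced_ConsD)

lemma cons_red_id: "reduced (a # w) \<Longrightarrow> cons_red a w = a # w"
  by (cases w) auto

lemma cons_red_linv: "reduced w \<Longrightarrow> cons_red a (cons_red (linv a) w) = w"
proof (cases w)
  case (Cons b v)
  assume "reduced w"
  then show ?thesis using Cons by (cases v) auto
qed simp

lemma reduced_foldr: "reduced w \<Longrightarrow> reduced (foldr cons_red u w)"
  by (induction u) (auto intro: reduced_cons_red)

lemma reduced_free_reduce: "reduced (free_reduce w)"
  by (simp add: free_reduce_def reduced_foldr)

lemma free_reduce_id: "reduced w \<Longrightarrow> free_reduce w = w"
proof (induction w)
  case (Cons a w)
  then show ?case using cons_red_id[of a w] by (auto simp: free_reduce_def dest: reduced_ConsD)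
qed (simp add: free_reduce_def)

lemma foldr_cons_red:
  assumes "reduced w"
  shows "foldr cons_red (cons_red a u) w = cons_red a (foldr cons_red u w)"
proof (cases u)
  case (Cons b v)
  show ?thesis
    using Cons cons_red_linv[of "foldr cons_red v w" a] reduced_foldr[OF assms, of v] by auto
qed simp

lemma foldr_free_reduce:
  "reduced w \<Longrightarrow> foldr cons_red (free_reduce u) w = foldr cons_red u w"
  by (induction u) (auto simp: free_reduce_def foldr_cons_red)

lemma free_mult: "reduced v \<Longrightarrow> u \<otimes>\<^bsub>free_group\<^esub> v = foldr cons_red u v"
  using free_reduce_id[of v] by (simp add: free_group_def free_reduce_def)

lemma carrier_free_group [simp]: "w \<in> carrier free_group \<longleftrightarrow> reduced w"
  by (simp add: free_group_def)

lemma one_free_group [simp]: "\<one>\<^bsub>free_group\<^esub> = []"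
  by (simp add: free_group_def)

lemma foldr_cons_red_inverse:
  assumes "reduced w" shows "foldr cons_red (rev (map linv u)) (foldr cons_red u w) = w"
  using assms
proof (induction u arbitrary: w)
  case (Cons a u)
  have "reduced (foldr cons_red u w)"
    by (rule reduced_foldr[OF Cons.prems])
  from cons_red_linv[OF this, of "linv a"] show ?case
    using Cons by simp
qed simp

lemma group_free_group: "group (free_group :: 'a fword monoid)"
proof (rule groupI)
  fix u v w :: "'a fword"
  assume uvw: "u \<in> carrier free_group" "v \<in> carrier free_group" "w \<in> carrier free_group"
  then show "u \<otimes>\<^bsub>free_group\<^esub> v \<in> carrier free_group"
    by (simp add: free_mult reduced_foldr)
  have "u \<otimes>\<^bsub>free_group\<^esub> v \<otimes>\<^bsub>free_group\<^esub> w = foldr cons_red (free_reduce (u @ v)) w"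
    using uvw(3) free_mult[of w "u \<otimes>\<^bsub>free_group\<^esub> v"] by (simp add: free_group_def)
  also have "\<dots> = u \<otimes>\<^bsub>free_group\<^esub> (v \<otimes>\<^bsub>free_group\<^esub> w)"
    using uvw by (simp add: free_mult foldr_free_reduce reduced_foldr)
  finally show "u \<otimes>\<^bsub>free_group\<^esub> v \<otimes>\<^bsub>free_group\<^esub> w
      = u \<otimes>\<^bsub>free_group\<^esub> (v \<otimes>\<^bsub>free_group\<^esub> w)" .
next
  show "\<one>\<^bsub>free_group\<^esub> \<in> carrier (free_group :: 'a fword monoid)" by simp
next
  fix u :: "'a fword" assume u: "u \<in> carrier free_group"
  then show "\<one>\<^bsub>free_group\<^esub> \<otimes>\<^bsub>free_group\<^esub> u = u"
    by (simp add: free_mult)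
  have eq: "foldr cons_red u [] = u"
    using free_reduce_id[of u] u by (simp add: free_reduce_def)
  let ?v = "free_reduce (rev (map linv u))"
  have "?v \<otimes>\<^bsub>free_group\<^esub> u = foldr cons_red (rev (map linv u)) (foldr cons_red u [])"
    using u by (simp add: free_mult foldr_free_reduce eq)
  then have "?v \<otimes>\<^bsub>free_group\<^esub> u = \<one>\<^bsub>free_group\<^esub>"
    using foldr_cons_red_inverse[of "[]" u] by simp
  moreover have "?v \<in> carrier free_group"
    by (simp add: reduced_free_reduce)
  ultimately show "\<exists>v\<in>carrier free_group. v \<otimes>\<^bsub>free_group\<^esub> u = \<one>\<^bsub>free_group\<^esub>"
    by blast
qed

section \<open>The boundary and the compactification\<close>

definition boundary :: "'a ray set" where
  "boundary = {\<omega>. \<forall>i. \<omega> (Suc i) \<noteq> linv (\<omega> i)}"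

definition boundary_topology :: "'a ray topology" where
  "boundary_topology =
     subtopology (product_topology (\<lambda>_. discrete_topology UNIV) UNIV) boundary"

text \<open>Concatenation followed by free reduction, one letter at a time.\<close>

definition act_letter :: "'a letter \<Rightarrow> 'a ray \<Rightarrow> 'a ray" where
  "act_letter a \<omega> = (if \<omega> 0 = linv a then (\<lambda>i. \<omega> (Suc i)) else case_nat a \<omega>)"

definition boundary_act :: "'a fword \<Rightarrow> 'a ray \<Rightarrow> 'a ray" where
  "boundary_act g \<omega> = foldr act_letter g \<omega>"

text \<open>
  Finite and infinite words are both encoded as infinite sequences in \<open>'a letter option\<close>, a
  finite word being continued by \<open>None\<close>.  The product topology then makes the finite
  words isolated points; convergence to a boundary point is pointwise convergence of words,
  see lemma \<open>limitin_compactification\<close>.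
\<close>

definition fword_point :: "'a fword \<Rightarrow> nat \<Rightarrow> 'a letter option" where
  "fword_point w = (\<lambda>i. if i < length w then Some (w ! i) else None)"

definition ray_point :: "'a ray \<Rightarrow> nat \<Rightarrow> 'a letter option" where
  "ray_point \<omega> = (\<lambda>i. Some (\<omega> i))"

definition compactification :: "(nat \<Rightarrow> 'a letter option) topology" where
  "compactification =
     subtopology (product_topology (\<lambda>_. discrete_topology UNIV) UNIV)
       (fword_point ` carrier free_group \<union> ray_point ` boundary)"

definition converges_to :: "(nat \<Rightarrow> 'a fword) \<Rightarrow> 'a ray \<Rightarrow> bool" where
  "converges_to g \<omega> \<longleftrightarrow>
     limitin compactification (\<lambda>n. fword_point (g n)) (ray_point \<omega>) sequentially"

lemma limitin_compactification:
  assumes "\<And>n. g n \<in> carrier free_group" and "\<omega> \<in> boundary"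
  shows "converges_to g \<omega> \<longleftrightarrow>
    (\<forall>i. \<forall>\<^sub>F n in sequentially. i < length (g n) \<and> g n ! i = \<omega> i)"
proof -
  have lim: "limitin (discrete_topology UNIV) f l sequentially
      \<longleftrightarrow> (\<forall>\<^sub>F n in sequentially. f n = l)" for f :: "nat \<Rightarrow> 'a letter option" and l
  proof
    assume "limitin (discrete_topology UNIV) f l sequentially"
    from this[unfolded limitin_def] have "\<forall>\<^sub>F n in sequentially. f n \<in> {l}"
      by (metis openin_discrete_topology singletonI subset_UNIV)
    then show "\<forall>\<^sub>F n in sequentially. f n = l" by simp
  next
    assume "\<forall>\<^sub>F n in sequentially. f n = l"
    then show "limitin (discrete_topology UNIV) f l sequentially"
      unfolding limitin_def by (auto elim: eventually_mono)
  qed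
  have *: "fword_point w i = ray_point \<omega> i \<longleftrightarrow> i < length w \<and> w ! i = \<omega> i" for w i
    by (auto simp: fword_point_def ray_point_def)
  show ?thesis
    using assms
    by (simp add: converges_to_def compactification_def limitin_subtopology
        limitin_componentwise lim *)
qed

definition limit_set :: "'a fword set \<Rightarrow> 'a ray set" where
  "limit_set H = {\<omega> \<in> boundary. ray_point \<omega> \<in> compactification derived_set_of (fword_point ` H)}"

section \<open>Labelled graphs\<close>

text \<open>
  An oriented edge of the graphs below is a pair of its initial vertex and its label.  An
  unoriented graph is represented by all its oriented edges, so that subgraphs have to be
  closed under reversal.
\<close>

definition cayley_graph :: "('a fword, 'a fword \<times> 'a letter) pre_digraph" where
  "cayley_graph =
     \<lparr>verts = carrier free_group, arcs = carrier free_group \<times> UNIV,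
      tail = fst, head = (\<lambda>(g, a). g \<otimes>\<^bsub>free_group\<^esub> [a])\<rparr>"

definition schreier_graph ::
  "'a fword set \<Rightarrow> ('a fword set, 'a fword set \<times> 'a letter) pre_digraph" where
  "schreier_graph H =
     \<lparr>verts = rcosets\<^bsub>free_group\<^esub> H, arcs = (rcosets\<^bsub>free_group\<^esub> H) \<times> UNIV,
      tail = fst, head = (\<lambda>(x, a). x #>\<^bsub>free_group\<^esub> [a])\<rparr>"

definition arc_rev :: "('v, 'v \<times> 'a letter) pre_digraph \<Rightarrow> 'v \<times> 'a letter \<Rightarrow> 'v \<times> 'a letter" where
  "arc_rev G e = (head G e, linv (snd e))"

definition sym_subgraph ::
  "('v, 'v \<times> 'a letter) pre_digraph \<Rightarrow> ('v, 'v \<times> 'a letter) pre_digraph \<Rightarrow> bool" where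
  "sym_subgraph Y G \<longleftrightarrow> subgraph Y G \<and> (\<forall>e\<in>arcs Y. arc_rev G e \<in> arcs Y)"

text \<open>
  The library predicates \<open>forest\<close> and \<open>tree\<close> do not apply to these graphs, because an edge
  followed by its reversal is a directed cycle.
\<close>

definition sym_tree :: "('v, 'v \<times> 'a letter) pre_digraph \<Rightarrow> bool" where
  "sym_tree G \<longleftrightarrow> strongly_connected G \<and>
     \<not> (\<exists>p. pre_digraph.cycle G p \<and> successively (\<lambda>e f. f \<noteq> arc_rev G e) p)"

definition graph_dist :: "('v, 'e) pre_digraph \<Rightarrow> 'v \<Rightarrow> 'v \<Rightarrow> nat" where
  "graph_dist G x y = (LEAST n. \<exists>p. pre_digraph.awalk G x p y \<and> length p = n)"

definition geodesic_spanning_tree ::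
  "('v, 'v \<times> 'a letter) pre_digraph \<Rightarrow> ('v, 'v \<times> 'a letter) pre_digraph \<Rightarrow> 'v \<Rightarrow> bool" where
  "geodesic_spanning_tree T G r \<longleftrightarrow>
     sym_subgraph T G \<and> spanning T G \<and> sym_tree T \<and>
     (\<forall>x\<in>verts G. graph_dist T r x = graph_dist G r x)"

definition nb_rays :: "('v, 'v \<times> 'a letter) pre_digraph \<Rightarrow> 'v \<Rightarrow> (nat \<Rightarrow> 'v \<times> 'a letter) set" where
  "nb_rays G r = {p. tail G (p 0) = r \<and>
     (\<forall>n. p n \<in> arcs G \<and> tail G (p (Suc n)) = head G (p n) \<and> p (Suc n) \<noteq> arc_rev G (p n))}"

definition read_ray :: "(nat \<Rightarrow> 'v \<times> 'a letter) \<Rightarrow> 'a ray" where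
  "read_ray p = (\<lambda>n. snd (p n))"

lemma bij_betw_read_ray:
  assumes H: "subgroup H (free_group :: 'a fword monoid)"
  shows "bij_betw read_ray (nb_rays (schreier_graph H) H) (boundary :: 'a ray set)"
proof (rule bij_betw_imageI)
  interpret group "free_group :: 'a fword monoid" by (rule group_free_group)
  interpret S: subgroup H "free_group :: 'a fword monoid" by (rule H)
  have Hsub: "H \<subseteq> carrier free_group" by (rule S.subset)
  let ?X = "schreier_graph H"
  have Hone: "H #>\<^bsub>free_group\<^esub> [] = H"
    using coset_mult_one[OF Hsub] by simp
  have rc: "H #>\<^bsub>free_group\<^esub> g \<in> rcosets\<^bsub>free_group\<^esub> H" if "reduced g" for g :: "'a fword"
    using that by (auto simp: RCOSETS_def)
  have step: "H #>\<^bsub>free_group\<^esub> g #>\<^bsub>free_group\<^esub> [a] = H #>\<^bsub>free_group\<^esub> (g \<otimes>\<^bsub>free_group\<^esub> [a])"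
    if "reduced g" for g :: "'a fword" and a
    using coset_mult_assoc[OF Hsub, of g "[a]"] that by simp
  show "inj_on read_ray (nb_rays ?X H)"
  proof (rule inj_onI)
    fix p q assume p: "p \<in> nb_rays ?X H" and q: "q \<in> nb_rays ?X H"
      and eq: "read_ray p = read_ray q"
    have lab: "snd (p n) = snd (q n)" for n
      using fun_cong[OF eq, of n] by (simp add: read_ray_def)
    have "fst (p n) = fst (q n)" for n
    proof (induction n)
      case 0
      then show ?case using p q by (simp add: nb_rays_def schreier_graph_def)
    next
      case (Suc n)
      then have "p n = q n" using lab by (simp add: prod_eq_iff)
      then show ?case using p q by (simp add: nb_rays_def schreier_graph_def)
    qed
    then show "p = q" using lab by (auto simp: prod_eq_iff)
  qed
  show "read_ray ` nb_rays ?X H = boundary"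
  proof (intro equalityI subsetI)
    fix \<omega> assume "\<omega> \<in> read_ray ` nb_rays ?X H"
    then obtain p where p: "p \<in> nb_rays ?X H" and \<omega>: "\<omega> = read_ray p" by blast
    have "\<omega> (Suc n) \<noteq> linv (\<omega> n)" for n
    proof
      assume "\<omega> (Suc n) = linv (\<omega> n)"
      then have "p (Suc n) = arc_rev ?X (p n)"
        using p by (auto simp: \<omega> read_ray_def arc_rev_def nb_rays_def schreier_graph_def prod_eq_iff)
      then show False using p by (simp add: nb_rays_def)
    qed
    then show "\<omega> \<in> boundary" by (simp add: boundary_def)
  next
    fix \<omega> :: "'a ray" assume \<omega>: "\<omega> \<in> boundary"
    define g where "g = rec_nat [] (\<lambda>n u. u \<otimes>\<^bsub>free_group\<^esub> [\<omega> n])"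
    have g: "g 0 = []" "g (Suc n) = g n \<otimes>\<^bsub>free_group\<^esub> [\<omega> n]" for n
      by (simp_all add: g_def)
    have red: "reduced (g n)" for n
      by (induction n) (simp_all add: g free_mult reduced_foldr)
    define p where "p = (\<lambda>n. (H #>\<^bsub>free_group\<^esub> g n, \<omega> n))"
    have "p \<in> nb_rays ?X H"
      using \<omega> by (auto simp: nb_rays_def p_def schreier_graph_def g step red rc Hone arc_rev_def boundary_def)
    moreover have "\<omega> = read_ray p" by (simp add: read_ray_def p_def)
    ultimately show "\<omega> \<in> read_ray ` nb_rays ?X H" by blast
  qed
qed

section \<open>Hanging branches and the core\<close>

text \<open>Every edge is counted with both orientations, so the degree is the out-degree.\<close>

definition branch :: "('a::finite fword, 'a fword \<times> 'a letter) pre_digraph \<Rightarrow> bool" where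
  "branch B \<longleftrightarrow> sym_subgraph B cayley_graph \<and> sym_tree B \<and>
     (\<exists>r\<in>verts B. out_degree B r = 1 \<and> (\<forall>v\<in>verts B - {r}. out_degree B v = 2 * CARD('a)))"

definition hanging_branch ::
  "'a::finite fword set \<Rightarrow> ('a fword set, 'a fword set \<times> 'a letter) pre_digraph \<Rightarrow> bool" where
  "hanging_branch H Y \<longleftrightarrow> sym_subgraph Y (schreier_graph H) \<and>
     (\<exists>B f. branch B \<and> pre_digraph.digraph_isomorphism B f \<and> Y = app_iso f B \<and>
        (\<forall>e\<in>arcs B. snd (iso_arcs f e) = snd e))"

definition branch_interior ::
  "('a::finite fword set, 'a fword set \<times> 'a letter) pre_digraph \<Rightarrow> 'a fword set set" where
  "branch_interior Y = {v \<in> verts Y. out_degree Y v = 2 * CARD('a)}"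

definition core ::
  "'a::finite fword set \<Rightarrow> ('a fword set, 'a fword set \<times> 'a letter) pre_digraph" where
  "core H =
     \<lparr>verts = verts (schreier_graph H) - (\<Union>Y\<in>Collect (hanging_branch H). branch_interior Y),
      arcs = arcs (schreier_graph H) - (\<Union>Y\<in>Collect (hanging_branch H). arcs Y),
      tail = tail (schreier_graph H), head = head (schreier_graph H)\<rparr>"

section \<open>Schreier generators, limit set and fundamental domain\<close>

definition tree_geodesic :: "('v, 'v \<times> 'a letter) pre_digraph \<Rightarrow> 'v \<Rightarrow> 'v \<Rightarrow> ('v \<times> 'a letter) list" where
  "tree_geodesic T x y = (THE p. pre_digraph.awalk T x p y \<and> length p = graph_dist T x y)"

primrec partial_product :: "(nat \<Rightarrow> 'a fword) \<Rightarrow> nat \<Rightarrow> 'a fword" where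
  "partial_product \<xi> 0 = \<one>\<^bsub>free_group\<^esub>"
| "partial_product \<xi> (Suc n) = partial_product \<xi> n \<otimes>\<^bsub>free_group\<^esub> \<xi> n"

definition begins_with :: "'a ray \<Rightarrow> 'a fword \<Rightarrow> bool" where
  "begins_with \<omega> w \<longleftrightarrow> (\<forall>i<length w. \<omega> i = w ! i)"

text \<open>
  The three parts of a Schreier generator are indexed by the edge \<open>e\<close> outside \<open>T\<close> that
  determines it; the origin of the Schreier graph is the coset \<open>H\<close> itself.
\<close>

definition sigma_zero :: "'a fword set \<times> 'a letter \<Rightarrow> 'a fword" where
  "sigma_zero e = [snd e]"

context
  fixes H :: "'a fword set"
    and T :: "('a fword set, 'a fword set \<times> 'a letter) pre_digraph"
begin

definition sigma_minus :: "'a fword set \<times> 'a letter \<Rightarrow> 'a fword" where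
  "sigma_minus e = map snd (tree_geodesic T H (tail (schreier_graph H) e))"

definition sigma_plus :: "'a fword set \<times> 'a letter \<Rightarrow> 'a fword" where
  "sigma_plus e = map snd (tree_geodesic T (head (schreier_graph H) e) H)"

definition off_tree_arcs :: "('a fword set \<times> 'a letter) set" where
  "off_tree_arcs = arcs (schreier_graph H) - arcs T"

definition schreier_generators :: "'a fword set" where
  "schreier_generators = (\<lambda>e. sigma_minus e @ sigma_zero e @ sigma_plus e) ` off_tree_arcs"

definition schreier_limit_set :: "'a ray set" where
  "schreier_limit_set = {\<omega> \<in> boundary. \<exists>\<xi>.
     (\<forall>i. \<xi> i \<in> schreier_generators \<and> \<xi> (Suc i) \<noteq> inv\<^bsub>free_group\<^esub> (\<xi> i)) \<and>
     converges_to (partial_product \<xi>) \<omega>}"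

definition schreier_domain :: "'a ray set" where
  "schreier_domain =
     {\<omega> \<in> boundary. \<forall>e\<in>off_tree_arcs. \<not> begins_with \<omega> (sigma_minus e @ sigma_zero e)}"

definition Theta :: "'a ray set" where
  "Theta = schreier_domain \<inter> (boundary - limit_set H)"

end

definition finitely_generated :: "('g, 'b) monoid_scheme \<Rightarrow> 'g set \<Rightarrow> bool" where
  "finitely_generated G H \<longleftrightarrow> (\<exists>S. finite S \<and> S \<subseteq> carrier G \<and> H = generate G S)"

end

theory Submission
  imports Defs
begin

text \<open>
  Everything is expressed by words.  Call an arc \<open>(H g, a)\<close> of the Schreier graph hanging if no
  non-trivial element of \<open>K = g\<^sup>-\<^sup>1 H g\<close> begins with \<open>a\<close>; these are the arcs that lead away from the root
  of a hanging branch, and an arc is in the core if neither it nor its reversal is hanging.  Since a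
  non-trivial element of \<open>K\<close> and its square have the same first letter while the square is longer, a ray
  belongs to \<open>\<Lambda>\<close> if and only if none of its arcs is hanging, and being hanging propagates along
  reduced paths.

  A reduced word of a walk in \<open>T\<close> is determined by the two ends of the walk.  Hence \<open>\<Delta>\<close> consists of
  the rays that never leave \<open>T\<close>, and \<open>\<Omega>\<close> of those that leave it infinitely often.  A ray outside
  \<open>\<Omega>\<close> eventually stays in \<open>T\<close>, so an element of \<open>H\<close> moves it into \<open>\<Delta>\<close>; uniqueness of the walks in
  \<open>T\<close> makes the translates disjoint.  Prefixes of the elements of a finitely generated \<open>H\<close> end at
  bounded distance from the origin, whereas a ray in \<open>\<Delta>\<close> is a geodesic of \<open>X\<close>, which gives
  \<open>\<Delta> \<inter> \<Lambda> = {}\<close>; if \<open>H\<close> is not finitely generated, infinitely many arcs are outside \<open>T\<close>, and Koenig's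
  lemma applied to the words \<open>\<sigma>\<^sub>-(s) \<sigma>\<^sub>0(s)\<close> yields a point of \<open>\<Delta> \<inter> \<Lambda>\<close>.
\<close>

section \<open>Words in the free group\<close>

text \<open>The obstacle in (i) is orientation. The core omits an arc also when only its reversal is
  hanging, and a ray of \<Lambda> may start inside a hanging branch and run towards its root.
  Non-triviality of H bounds this phase: as long as it lasts along a prefix w, a fixed h \<noteq> 1
  in H is the word w k w^-1 without cancellation, so w is not longer than h.

  Trees are defined by excluding cycles with distinct vertices, so uniqueness of reduced walks in T
  needs a closed walk to be cut at its repeated vertices first.

  \<Omega> is defined by limits of products, whose factors cancel heavily. What survives are the
  letters of the crossed arcs outside T: two tree segments that meet at o merge into one, and an arc
  outside T cannot cancel against a tree segment. Hence a product of generators is the label of a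
  walk that crosses the given arcs in order, followed by the way home through T.

  In (iv) geodesicity of T turns the position along a ray of \<Delta> into the distance from o in
  X.\<close>

interpretation F: group free_group
  by (rule group_free_group)

abbreviation mul :: "'a fword \<Rightarrow> 'a fword \<Rightarrow> 'a fword" (infixl \<open>\<cdot>\<close> 70) where
  "u \<cdot> v \<equiv> u \<otimes>\<^bsub>free_group\<^esub> v"

abbreviation iv :: "'a fword \<Rightarrow> 'a fword" where
  "iv u \<equiv> inv\<^bsub>free_group\<^esub> u"

lemma mul_def: "u \<cdot> v = free_reduce (u @ v)"
  by (simp add: free_group_def)

lemma reduced_mul [simp]: "reduced (u \<cdot> v)"
  by (simp add: mul_def reduced_free_reduce)

lemma reduced_inv [simp]: "reduced u \<Longrightarrow> reduced (iv u)"
  using F.inv_closed[of u] by simp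

lemma mul_Nil [simp]: "reduced u \<Longrightarrow> u \<cdot> [] = u" "reduced u \<Longrightarrow> [] \<cdot> u = u"
  by (simp_all add: mul_def free_reduce_id)

lemma mul_assoc: "reduced u \<Longrightarrow> reduced v \<Longrightarrow> reduced w \<Longrightarrow> u \<cdot> v \<cdot> w = u \<cdot> (v \<cdot> w)"
  by (simp add: F.m_assoc)

lemma mul_inv [simp]:
  assumes "reduced u"
  shows "u \<cdot> iv u = []" "iv u \<cdot> u = []" "iv (iv u) = u"
  using assms F.r_inv[of u] F.l_inv[of u] F.inv_inv[of u] by simp_all

lemma mul_inv_cancel [simp]:
  assumes "reduced u" "reduced v"
  shows "u \<cdot> (iv u \<cdot> v) = v" "iv u \<cdot> (u \<cdot> v) = v"
  using assms by (simp_all flip: mul_assoc)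

lemma inv_mul: "reduced u \<Longrightarrow> reduced v \<Longrightarrow> iv (u \<cdot> v) = iv v \<cdot> iv u"
  by (simp add: F.inv_mult_group)

lemma inv_Nil [simp]: "iv [] = []"
  using F.inv_one by simp

lemma free_reduce_Nil [simp]: "free_reduce [] = []"
  by (simp add: free_reduce_def)

lemma free_reduce_append: "free_reduce (u @ v) = free_reduce u \<cdot> free_reduce v"
proof -
  have "free_reduce u \<cdot> free_reduce v = foldr cons_red u (free_reduce v)"
    by (simp add: free_mult reduced_free_reduce foldr_free_reduce)
  then show ?thesis by (simp add: free_reduce_def)
qed

lemma free_reduce_Cons: "free_reduce (a # u) = cons_red a (free_reduce u)"
  by (simp add: free_reduce_def)

lemma mul_append: "reduced (u @ v) \<Longrightarrow> u \<cdot> v = u @ v"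
  by (simp add: mul_def free_reduce_id)

lemma reduced_append_iff:
  "reduced (u @ v) \<longleftrightarrow> reduced u \<and> reduced v \<and> (u \<noteq> [] \<longrightarrow> v \<noteq> [] \<longrightarrow> hd v \<noteq> linv (last u))"
  by (auto simp: reduced_def successively_append_iff)

lemma reduced_glue: "reduced (u @ [a]) \<Longrightarrow> reduced (a # v) \<Longrightarrow> reduced (u @ a # v)"
  using reduced_append_iff[of u "[a]"] reduced_append_iff[of u "a # v"] by auto

lemma reduced_take: "reduced w \<Longrightarrow> reduced (take n w)"
  by (metis append_take_drop_id reduced_append_iff)

lemma reduced_drop: "reduced w \<Longrightarrow> reduced (drop n w)"
  by (metis append_take_drop_id reduced_append_iff)

lemma reduced_nth: "reduced w \<longleftrightarrow> (\<forall>i. Suc i < length w \<longrightarrow> w ! Suc i \<noteq> linv (w ! i))"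
  by (auto simp: reduced_def successively_conv_nth)

lemma linv_inject [simp]: "linv a = linv b \<longleftrightarrow> a = b"
  by (metis linv_linv)

lemma reduced_rev_linv: "reduced w \<Longrightarrow> reduced (rev (map linv w))"
proof (induction w)
  case (Cons a w)
  then show ?case
    by (auto simp: reduced_append_iff last_rev hd_map dest: reduced_ConsD)
      (metis hd_Cons_tl linv_linv reduced_simps(3))
qed simp

lemma inv_eq: "reduced u \<Longrightarrow> iv u = rev (map linv u)"
proof -
  assume u: "reduced u"
  have "rev (map linv u) \<cdot> u = []"
    using foldr_cons_red_inverse[of "[]" u] u free_reduce_id[OF u]
    by (simp add: free_mult free_reduce_def)
  then show ?thesis
    using F.inv_equality[of "rev (map linv u)" u] u reduced_rev_linv[OF u] by simp
qed

lemma length_inv [simp]: "reduced u \<Longrightarrow> length (iv u) = length u"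
  by (simp add: inv_eq)

lemma free_reduce_rev_linv: "free_reduce (rev (map linv u)) = iv (free_reduce u)"
proof -
  have "free_reduce (rev (map linv u)) \<cdot> free_reduce u = []"
    using foldr_cons_red_inverse[of "[]" u]
    by (simp add: free_mult reduced_free_reduce foldr_free_reduce) (simp add: free_reduce_def)
  then show ?thesis
    using F.inv_equality[of "free_reduce (rev (map linv u))" "free_reduce u"]
    by (simp add: reduced_free_reduce)
qed

text \<open>Exact bookkeeping of cancellation: c is the part of u that v annihilates, and what
  remains on both sides meets without further cancellation. It is found by stripping the last letter
  of u as long as it is inverse to the first letter of v.\<close>

lemma mul_decomp:
  assumes "reduced u" "reduced v"
  obtains p c q where "u = p @ c" "v = iv c @ q" "u \<cdot> v = p @ q" "reduced (p @ q)" "reduced c"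
proof -
  have "\<exists>p c q. u = p @ c \<and> v = rev (map linv c) @ q \<and> reduced (p @ q)"
    using assms
  proof (induction u arbitrary: v rule: rev_induct)
    case (snoc a u)
    show ?case
    proof (cases "v \<noteq> [] \<and> hd v = linv a")
      case True
      then obtain w where w: "v = linv a # w" by (cases v) auto
      then obtain p c q where "u = p @ c" "w = rev (map linv c) @ q" "reduced (p @ q)"
        using snoc by (metis reduced_ConsD reduced_append_iff)
      then have "u @ [a] = p @ (c @ [a])" "v = rev (map linv (c @ [a])) @ q" "reduced (p @ q)"
        using w by simp_all
      then show ?thesis by blast
    next
      case False
      then have "reduced ((u @ [a]) @ v)"
        using snoc.prems reduced_append_iff[of "u @ [a]" v] by auto
      then have "u @ [a] = (u @ [a]) @ []" "v = rev (map linv []) @ v" "reduced ((u @ [a]) @ v)" by simp_all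
      then show ?thesis by blast
    qed
  qed simp
  then obtain p c q where pcq: "u = p @ c" "v = rev (map linv c) @ q" "reduced (p @ q)" by blast
  then have c: "reduced c" and p: "reduced p" and q: "reduced q"
    using assms by (auto simp: reduced_append_iff)
  then have ic: "iv c = rev (map linv c)" by (simp add: inv_eq)
  have "u \<cdot> v = (p \<cdot> c) \<cdot> (iv c \<cdot> q)"
    using pcq assms ic by (simp add: mul_append)
  also have "\<dots> = p @ q"
    using p q c pcq(3) by (simp add: mul_assoc mul_append)
  finally show ?thesis using that pcq c ic by simp
qed

text \<open>The cancelled part of u is at most as long as v, so the first m letters lie in the part
  that survives.\<close>

lemma take_mul:
  assumes "reduced u" "reduced v" "m + length v \<le> length u"
  shows "take m (u \<cdot> v) = take m u" "m \<le> length (u \<cdot> v)"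
proof -
  obtain p c q where *: "u = p @ c" "v = iv c @ q" "u \<cdot> v = p @ q" "reduced c"
    using mul_decomp[OF assms(1,2)] by metis
  then have "m \<le> length p" using assms(3) by simp
  then show "take m (u \<cdot> v) = take m u" "m \<le> length (u \<cdot> v)" using * by simp_all
qed

lemma hd_mul:
  assumes "reduced u" "reduced v" "length v < length u"
  shows "u \<cdot> v \<noteq> []" "hd (u \<cdot> v) = hd u"
proof -
  note * = take_mul[OF assms(1,2), of 1]
  show "u \<cdot> v \<noteq> []" using * assms(3) by auto
  then show "hd (u \<cdot> v) = hd u" using * assms(3)
    by (metis Suc_leI hd_take plus_1_eq_Suc zero_less_one)
qed

text \<open>Cyclic reduction. If the last letter is not inverse to the first, \<open>k @ k\<close>
  is already reduced. Otherwise k = a j a^-1 with square a j j a^-1; as the square of j has the same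
  end letters as j, putting a and a^-1 around it causes no cancellation, and the claims pass from j
  to k.\<close>

lemma square_longer:
  assumes "reduced k" "k \<noteq> []"
  shows "length k < length (k \<cdot> k)" "hd (k \<cdot> k) = hd k" "last (k \<cdot> k) = last k"
proof -
  have "length k < length (k \<cdot> k) \<and> hd (k \<cdot> k) = hd k \<and> last (k \<cdot> k) = last k"
    using assms
  proof (induction "length k" arbitrary: k rule: less_induct)
    case less
    show ?case
    proof (cases "last k = linv (hd k)")
      case False
      then have "reduced (k @ k)"
        using less.prems by (simp add: reduced_append_iff) (metis linv_linv)
      then show ?thesis using less.prems by (simp add: mul_append)
    next
      case True
      define a where "a = hd k"
      obtain k1 where k1: "k = a # k1" using less.prems a_def by (cases k) auto
      have "k1 \<noteq> []" using True k1 by auto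
      then obtain j where j: "k = a # j @ [linv a]"
        using True k1 a_def by (metis append_butlast_last_id last_ConsR)
      have jn: "j \<noteq> []" using less.prems(1) j by auto
      have jr: "reduced j" using less.prems(1) j
        by (metis reduced_ConsD reduced_append_iff)
      have red: "reduced ([a] @ j)" "reduced (j @ [linv a])" "reduced (([a] @ j) @ [linv a])"
        using less.prems(1) j by (metis append_Cons append_Nil reduced_append_iff)+
      have IH: "length j < length (j \<cdot> j)" "hd (j \<cdot> j) = hd j" "last (j \<cdot> j) = last j"
        using less.hyps[of j] jr jn j by auto
      have ia: "[linv a] = iv [a]" by (simp add: inv_eq)
      have k: "k = [a] \<cdot> j \<cdot> iv [a]"
        using j red ia by (simp add: mul_append)
      have jj: "j \<cdot> j \<noteq> []" using IH(1) by auto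
      have r1: "reduced ([a] @ (j \<cdot> j))"
        using red(1) jn jj IH unfolding reduced_append_iff by auto
      have r2: "reduced (([a] @ (j \<cdot> j)) @ [linv a])"
        using r1 red(2) jn jj IH unfolding reduced_append_iff[of "[a] @ (j \<cdot> j)"] reduced_append_iff[of j]
        by auto
      have "k \<cdot> k = [a] \<cdot> (j \<cdot> j) \<cdot> iv [a]"
        unfolding k using jr by (simp add: mul_assoc)
      also have "\<dots> = [a] @ (j \<cdot> j) @ [linv a]"
        using r1 r2 by (simp add: mul_append flip: ia)
      finally show ?thesis using j IH by simp
    qed
  qed
  then show "length k < length (k \<cdot> k)" "hd (k \<cdot> k) = hd k" "last (k \<cdot> k) = last k" by auto
qed

section \<open>Finite prefixes of infinite words\<close>

definition ray_prefix :: "'a ray \<Rightarrow> nat \<Rightarrow> 'a fword" where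
  "ray_prefix \<omega> n = map \<omega> [0..<n]"

lemma length_ray_prefix [simp]: "length (ray_prefix \<omega> n) = n"
  by (simp add: ray_prefix_def)

lemma ray_prefix_0 [simp]: "ray_prefix \<omega> 0 = []"
  by (simp add: ray_prefix_def)

lemma ray_prefix_nth [simp]: "i < n \<Longrightarrow> ray_prefix \<omega> n ! i = \<omega> i"
  by (simp add: ray_prefix_def)

lemma ray_prefix_Suc: "ray_prefix \<omega> (Suc n) = ray_prefix \<omega> n @ [\<omega> n]"
  by (simp add: ray_prefix_def)

lemma ray_prefix_add: "ray_prefix \<omega> (m + n) = ray_prefix \<omega> m @ ray_prefix (\<lambda>i. \<omega> (m + i)) n"
  by (induction n) (simp_all add: ray_prefix_Suc)

lemma take_ray_prefix [simp]: "take m (ray_prefix \<omega> n) = ray_prefix \<omega> (min m n)"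
  by (simp add: ray_prefix_def take_map min_def)

lemma take_ray_prefix_eq: "take m h = ray_prefix \<omega> m \<Longrightarrow> n \<le> m \<Longrightarrow> take n h = ray_prefix \<omega> n"
  by (metis min.absorb1 take_ray_prefix take_take)

lemma eq_ray_prefixI: "length w = n \<Longrightarrow> (\<And>i. i < n \<Longrightarrow> w ! i = \<omega> i) \<Longrightarrow> w = ray_prefix \<omega> n"
  by (auto intro: nth_equalityI)

lemma begins_with_iff: "begins_with \<omega> w \<longleftrightarrow> ray_prefix \<omega> (length w) = w"
  unfolding begins_with_def by (auto simp: list_eq_iff_nth_eq)

lemma reduced_ray_prefix [simp]: "\<omega> \<in> boundary \<Longrightarrow> reduced (ray_prefix \<omega> n)"
  by (simp add: reduced_nth boundary_def)

lemma boundary_iff: "\<omega> \<in> boundary \<longleftrightarrow> (\<forall>n. reduced (ray_prefix \<omega> n))"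
proof
  assume *: "\<forall>n. reduced (ray_prefix \<omega> n)"
  have "\<omega> (Suc i) \<noteq> linv (\<omega> i)" for i
    using *[rule_format, of "Suc (Suc i)"]
    by (auto simp: reduced_nth dest: spec[of _ i])
  then show "\<omega> \<in> boundary" by (simp add: boundary_def)
qed auto

lemma boundary_shift: "\<omega> \<in> boundary \<Longrightarrow> (\<lambda>i. \<omega> (n + i)) \<in> boundary"
  by (simp add: boundary_def)

text \<open>The words are nested, so letter i can be read off from any of them that is long enough;
  \<open>f (Suc i)\<close> is, having at least i + 1 letters.\<close>

lemma chain_limit:
  fixes f :: "nat \<Rightarrow> 'a fword"
  assumes "\<And>n. \<exists>v. f (Suc n) = f n @ v" "\<And>n. n \<le> length (f n)"
  obtains \<omega> where "\<And>n. ray_prefix \<omega> (length (f n)) = f n"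
proof
  have mono: "\<exists>v. f (m + n) = f m @ v" for m n
  proof (induction n)
    case (Suc n)
    then show ?case using assms(1)[of "m + n"] by auto
  qed simp
  show "ray_prefix (\<lambda>i. f (Suc i) ! i) (length (f n)) = f n" for n
  proof (rule eq_ray_prefixI[symmetric])
    fix i assume i: "i < length (f n)"
    have l: "i < length (f (Suc i))" using assms(2)[of "Suc i"] by simp
    show "f n ! i = f (Suc i) ! i"
    proof (cases "n \<le> Suc i")
      case True
      then obtain v where "f (Suc i) = f n @ v" using mono[of n "Suc i - n"] by auto
      then show ?thesis using i by (simp add: nth_append)
    next
      case False
      then obtain v where "f n = f (Suc i) @ v" using mono[of "Suc i" "n - Suc i"] by auto
      then show ?thesis using l by (simp add: nth_append)
    qed
  qed simp
qed

section \<open>The action on the boundary\<close>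

definition prepend :: "'a fword \<Rightarrow> 'a ray \<Rightarrow> 'a ray" where
  "prepend p \<omega> = (\<lambda>i. if i < length p then p ! i else \<omega> (i - length p))"

lemma prepend_simps [simp]: "prepend [] \<omega> = \<omega>" "prepend (a # p) \<omega> = case_nat a (prepend p \<omega>)"
  by (auto simp: prepend_def fun_eq_iff split: nat.splits)

lemma ray_prefix_prepend: "ray_prefix (prepend p \<omega>) (length p + n) = p @ ray_prefix \<omega> n"
  by (rule eq_ray_prefixI[symmetric]) (auto simp: prepend_def nth_append)

lemma prepend_nth [simp]: "prepend p \<omega> (length p + n) = \<omega> n"
  by (simp add: prepend_def)

lemma prepend_ray_prefix [simp]: "prepend (ray_prefix \<omega> n) (\<lambda>i. \<omega> (n + i)) = \<omega>"
  by (auto simp: prepend_def fun_eq_iff)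

lemma act_letter_boundary: "\<omega> \<in> boundary \<Longrightarrow> act_letter a \<omega> \<in> boundary"
  by (auto simp: act_letter_def boundary_def split: nat.splits)

text \<open>If \<open>linv a\<close> deletes the first letter a of \<omega>, the next letter is not
  \<open>linv a\<close> because \<omega> is reduced, so a is put back. Otherwise the letter just put
  in front is removed again.\<close>

lemma act_letter_cancel:
  assumes "\<omega> \<in> boundary" shows "act_letter a (act_letter (linv a) \<omega>) = \<omega>"
proof (cases "\<omega> 0 = a")
  case True
  then show ?thesis using assms by (auto simp: act_letter_def boundary_def fun_eq_iff split: nat.splits)
next
  case False
  then show ?thesis by (auto simp: act_letter_def fun_eq_iff)
qed

lemma boundary_act_boundary: "\<omega> \<in> boundary \<Longrightarrow> boundary_act g \<omega> \<in> boundary"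
  unfolding boundary_act_def by (induction g) (auto intro: act_letter_boundary)

lemma boundary_act_free_reduce:
  assumes "\<omega> \<in> boundary" shows "boundary_act (free_reduce u) \<omega> = boundary_act u \<omega>"
proof (induction u)
  case (Cons a u)
  have "boundary_act (cons_red a w) \<omega> = act_letter a (boundary_act w \<omega>)" for w
  proof (cases w)
    case (Cons b v)
    then show ?thesis
      using act_letter_cancel[OF boundary_act_boundary[OF assms, of v], of a]
      by (auto simp: boundary_act_def)
  qed (simp add: boundary_act_def)
  then show ?case using Cons by (simp add: free_reduce_Cons) (simp add: boundary_act_def)
qed (simp add: boundary_act_def)

lemma boundary_act_mul: "\<omega> \<in> boundary \<Longrightarrow> boundary_act (u \<cdot> v) \<omega> = boundary_act u (boundary_act v \<omega>)"
  by (simp add: mul_def boundary_act_free_reduce) (simp add: boundary_act_def)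

lemma boundary_act_Nil [simp]: "boundary_act [] \<omega> = \<omega>"
  by (simp add: boundary_act_def)

lemma boundary_act_prepend:
  "reduced (p @ [\<omega> 0]) \<Longrightarrow> boundary_act p \<omega> = prepend p \<omega>"
proof (induction p)
  case (Cons a p)
  have "prepend p \<omega> 0 = hd (p @ [\<omega> 0])" by (cases p) (auto simp: prepend_def)
  moreover have "hd (p @ [\<omega> 0]) \<noteq> linv a" using Cons.prems by (cases p) auto
  ultimately show ?case
    using Cons reduced_ConsD[of a "p @ [\<omega> 0]"] by (simp add: boundary_act_def act_letter_def)
qed simp

lemma boundary_act_inv_ray_prefix:
  assumes "\<omega> \<in> boundary"
  shows "boundary_act (iv (ray_prefix \<omega> n)) \<omega> = (\<lambda>i. \<omega> (n + i))"
proof -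
  have b: "(\<lambda>i. \<omega> (n + i)) \<in> boundary" using assms by (rule boundary_shift)
  have "boundary_act (ray_prefix \<omega> n) (\<lambda>i. \<omega> (n + i)) = \<omega>"
    using boundary_act_prepend[of "ray_prefix \<omega> n" "\<lambda>i. \<omega> (n + i)"] reduced_ray_prefix[OF assms, of "Suc n"]
    by (simp add: ray_prefix_Suc)
  then show ?thesis
    using boundary_act_mul[OF b, of "iv (ray_prefix \<omega> n)" "ray_prefix \<omega> n"] assms by simp
qed

text \<open>Only a finite initial piece of \<omega> can cancel against g, so \<omega> and its
  translate have a common tail; it starts at n in the one and at l in the other.\<close>

lemma boundary_act_prefix:
  assumes "reduced g" "\<omega> \<in> boundary"
  obtains l n where "\<And>m. ray_prefix (boundary_act g \<omega>) (l + m) = g \<cdot> ray_prefix \<omega> (n + m)"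
    "\<And>m. boundary_act g \<omega> (l + m) = \<omega> (n + m)"
proof -
  \<comment> \<open>One letter more than g can cancel, so that q is not empty; its first letter
    shows that p meets the rest of \<omega> without cancellation.\<close>
  obtain p c q where *: "g = p @ c" "ray_prefix \<omega> (Suc (length g)) = iv c @ q" "reduced (p @ q)" "reduced c"
    using mul_decomp[of g "ray_prefix \<omega> (Suc (length g))"] assms by (metis reduced_ray_prefix)
  let ?n = "length c"
  let ?\<omega>' = "\<lambda>i. \<omega> (?n + i)"
  have "iv c = take ?n (iv c @ q)" using *(4) by simp
  also have "\<dots> = ray_prefix \<omega> ?n" using *(1) by (simp flip: *(2))
  finally have ic: "iv c = ray_prefix \<omega> ?n" .
  then have c: "c = iv (ray_prefix \<omega> ?n)" using *(4) by (metis mul_inv(3))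
  have "?n + length q = Suc (length g)"
    using arg_cong[OF *(2), of length] *(4) by simp
  then have qn: "q \<noteq> []" using *(1) by auto
  have "ray_prefix \<omega> (Suc (length g)) ! ?n = q ! 0"
    using *(2,4) by (simp add: nth_append)
  then have "hd q = \<omega> ?n" using qn *(1) by (simp add: hd_conv_nth)
  then have red: "reduced (p @ [\<omega> ?n])" using *(3) qn by (auto simp: reduced_append_iff)
  have p: "reduced p" "g = p \<cdot> c" using assms(1) *(1) by (auto simp: reduced_append_iff mul_append)
  have "boundary_act g \<omega> = boundary_act p (boundary_act c \<omega>)"
    using p(2) boundary_act_mul[OF assms(2)] by simp
  also have "boundary_act c \<omega> = ?\<omega>'"
    by (subst c) (rule boundary_act_inv_ray_prefix[OF assms(2)])
  finally have act: "boundary_act g \<omega> = prepend p ?\<omega>'"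
    using boundary_act_prepend[of p ?\<omega>'] red by simp
  have "g \<cdot> ray_prefix \<omega> (?n + m) = p @ ray_prefix ?\<omega>' m" for m
  proof -
    have sh: "?\<omega>' \<in> boundary" using assms(2) by (rule boundary_shift)
    have "reduced (p @ ray_prefix ?\<omega>' m)"
      using boundary_act_boundary[OF assms(2), of g] ray_prefix_prepend[of p ?\<omega>' m]
      unfolding act by (metis reduced_ray_prefix)
    moreover have "ray_prefix \<omega> (?n + m) = iv c \<cdot> ray_prefix ?\<omega>' m"
      using mul_append[of "ray_prefix \<omega> ?n" "ray_prefix ?\<omega>' m"] reduced_ray_prefix[OF assms(2), of "?n + m"]
      by (simp add: ic ray_prefix_add)
    ultimately show ?thesis
      using p *(4) sh by (simp add: mul_assoc mul_append)
  qed
  then show ?thesis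
    using that[of "length p" ?n] by (simp add: act ray_prefix_prepend)
qed

section \<open>Topology of the boundary\<close>

text \<open>An open box restricts finitely many coordinates, hence contains a cylinder that fixes
  all coordinates below a bound.\<close>

lemma openin_discrete_sequences:
  "openin (product_topology (\<lambda>_::nat. discrete_topology (UNIV :: 'b set)) UNIV) U \<longleftrightarrow>
    (\<forall>x\<in>U. \<exists>n. \<forall>y. (\<forall>i<n. y i = x i) \<longrightarrow> y \<in> U)"
proof
  assume "openin (product_topology (\<lambda>_::nat. discrete_topology (UNIV :: 'b set)) UNIV) U"
  then have *: "\<forall>x\<in>U. \<exists>V. finite {i. V i \<noteq> UNIV} \<and> x \<in> Pi\<^sub>E UNIV V \<and> Pi\<^sub>E UNIV V \<subseteq> U"
    by (simp add: openin_product_topology_alt)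
  show "\<forall>x\<in>U. \<exists>n. \<forall>y. (\<forall>i<n. y i = x i) \<longrightarrow> y \<in> U"
  proof
    fix x assume "x \<in> U"
    then obtain V where V: "finite {i. V i \<noteq> UNIV}" "x \<in> Pi\<^sub>E UNIV V" "Pi\<^sub>E UNIV V \<subseteq> U" using * by blast
    obtain n where n: "\<forall>i\<in>{i. V i \<noteq> UNIV}. i < n" using V(1) finite_nat_set_iff_bounded by auto
    have "y \<in> U" if "\<forall>i<n. y i = x i" for y
    proof -
      have "y i \<in> V i" for i
        using that n V(2) by (cases "V i = UNIV") (auto simp: PiE_iff)
      then show ?thesis using V(3) by (auto simp: PiE_iff)
    qed
    then show "\<exists>n. \<forall>y. (\<forall>i<n. y i = x i) \<longrightarrow> y \<in> U" by blast
  qed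
next
  assume *: "\<forall>x\<in>U. \<exists>n. \<forall>y. (\<forall>i<n. y i = x i) \<longrightarrow> y \<in> U"
  show "openin (product_topology (\<lambda>_::nat. discrete_topology (UNIV :: 'b set)) UNIV) U"
    unfolding openin_product_topology_alt
  proof (intro ballI)
    fix x assume "x \<in> U"
    then obtain n where n: "\<forall>y. (\<forall>i<n. y i = x i) \<longrightarrow> y \<in> U" using * by blast
    let ?V = "\<lambda>i. if i < n then {x i} else UNIV"
    have "{i. ?V i \<noteq> UNIV} \<subseteq> {..<n}" by auto
    then have "finite {i. ?V i \<noteq> UNIV}" using finite_subset by blast
    moreover have "Pi\<^sub>E UNIV ?V \<subseteq> U"
    proof
      fix y assume y: "y \<in> Pi\<^sub>E UNIV ?V"
      have "y i = x i" if "i < n" for i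
        using y that by (auto simp: PiE_iff dest!: spec[of _ i])
      then show "y \<in> U" using n by blast
    qed
    ultimately show "\<exists>V. finite {i \<in> UNIV. V i \<noteq> topspace (discrete_topology (UNIV :: 'b set))} \<and>
        (\<forall>i\<in>UNIV. openin (discrete_topology (UNIV :: 'b set)) (V i)) \<and> x \<in> Pi\<^sub>E UNIV V \<and> Pi\<^sub>E UNIV V \<subseteq> U"
      by (intro exI[of _ ?V]) (auto simp: PiE_iff)
  qed
qed

lemma ray_prefix_eq_iff: "ray_prefix x n = ray_prefix y n \<longleftrightarrow> (\<forall>i<n. x i = y i)"
  by (auto simp: list_eq_iff_nth_eq)

lemma openin_boundary_topology:
  "openin boundary_topology U \<longleftrightarrow> U \<subseteq> boundary \<and>
    (\<forall>x\<in>U. \<exists>n. \<forall>y\<in>boundary. ray_prefix y n = ray_prefix x n \<longrightarrow> y \<in> U)"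
    (is "?L \<longleftrightarrow> ?R")
proof
  assume ?L
  then have "\<exists>V. U = V \<inter> boundary \<and> openin (product_topology (\<lambda>_::nat. discrete_topology UNIV) UNIV) V"
    unfolding boundary_topology_def openin_subtopology by blast
  then obtain V where "U = V \<inter> boundary \<and> openin (product_topology (\<lambda>_::nat. discrete_topology UNIV) UNIV) V" ..
  then have V1: "U = V \<inter> boundary"
    and V2: "openin (product_topology (\<lambda>_::nat. discrete_topology UNIV) UNIV) V" by simp_all
  note V = iffD1[OF openin_discrete_sequences V2]
  have "\<exists>n. \<forall>y\<in>boundary. ray_prefix y n = ray_prefix x n \<longrightarrow> y \<in> U" if "x \<in> U" for x
  proof -
    have "x \<in> V" using V1 that by blast
    from bspec[OF V this] obtain n where n: "\<forall>y. (\<forall>i<n. y i = x i) \<longrightarrow> y \<in> V" ..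
    have "y \<in> U" if "y \<in> boundary" "ray_prefix y n = ray_prefix x n" for y
      using n[rule_format, of y] that V1 by (simp add: ray_prefix_eq_iff)
    then show ?thesis by blast
  qed
  then show ?R using V1 by blast
next
  assume R: ?R
  \<comment> \<open>An open extension of U to all sequences. Sequences that are not reduced may
    belong to it as well; only the trace on the boundary counts.\<close>
  define V where "V = {z. \<exists>n. \<forall>y\<in>boundary. ray_prefix y n = ray_prefix z n \<longrightarrow> y \<in> U}"
  have "\<exists>n. \<forall>y. (\<forall>i<n. y i = x i) \<longrightarrow> y \<in> V" if x: "x \<in> V" for x
  proof -
    obtain n where n: "\<forall>y\<in>boundary. ray_prefix y n = ray_prefix x n \<longrightarrow> y \<in> U"
      using x V_def by blast
    have "y \<in> V" if "\<forall>i<n. y i = x i" for y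
    proof -
      have "ray_prefix y n = ray_prefix x n" using that by (simp add: ray_prefix_eq_iff)
      then show ?thesis using n unfolding V_def by (intro CollectI exI[of _ n]) simp
    qed
    then show ?thesis by blast
  qed
  then have "openin (product_topology (\<lambda>_::nat. discrete_topology UNIV) UNIV) V"
    by (intro iffD2[OF openin_discrete_sequences] ballI)
  moreover have "U = V \<inter> boundary" using R V_def by auto
  ultimately show ?L
    unfolding boundary_topology_def openin_subtopology by blast
qed

lemma topspace_boundary_topology [simp]: "topspace boundary_topology = boundary"
  by (simp add: boundary_topology_def)

lemma in_closure_of_boundary:
  "\<omega> \<in> boundary_topology closure_of S \<longleftrightarrow> \<omega> \<in> boundary \<and>
    (\<forall>n. \<exists>\<omega>'\<in>S \<inter> boundary. ray_prefix \<omega>' n = ray_prefix \<omega> n)" (is "?L \<longleftrightarrow> ?R")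
proof
  assume L: ?L
  then have b: "\<omega> \<in> boundary" by (simp add: in_closure_of)
  moreover have "\<exists>\<omega>'\<in>S \<inter> boundary. ray_prefix \<omega>' n = ray_prefix \<omega> n" for n
  proof -
    let ?U = "{y \<in> boundary. ray_prefix y n = ray_prefix \<omega> n}"
    have "openin boundary_topology ?U"
      unfolding openin_boundary_topology by (auto intro!: exI[of _ n])
    then have "\<exists>y. y \<in> S \<and> y \<in> ?U"
      using L b unfolding in_closure_of by (elim conjE allE[of _ ?U]) simp
    then show ?thesis by blast
  qed
  ultimately show ?R by blast
next
  assume R: ?R
  show ?L unfolding in_closure_of
  proof (intro conjI allI impI)
    fix U assume U: "\<omega> \<in> U \<and> openin boundary_topology U"
    then have "\<exists>n. \<forall>y\<in>boundary. ray_prefix y n = ray_prefix \<omega> n \<longrightarrow> y \<in> U"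
      by (simp only: openin_boundary_topology)
    then obtain n where n: "\<forall>y\<in>boundary. ray_prefix y n = ray_prefix \<omega> n \<longrightarrow> y \<in> U" ..
    then show "\<exists>y. y \<in> S \<and> y \<in> U" using R by blast
  qed (use R in simp)
qed

text \<open>Cylinders are a neighbourhood base at a ray. Derived set and closure agree there,
  because a finite word is never equal to a ray.\<close>

lemma in_limit_set_iff:
  assumes "H \<subseteq> carrier free_group"
  shows "\<omega> \<in> limit_set H \<longleftrightarrow> \<omega> \<in> boundary \<and>
    (\<forall>n. \<exists>h\<in>H. n \<le> length h \<and> take n h = ray_prefix \<omega> n)" (is "?L \<longleftrightarrow> ?R")
proof -
  let ?P = "product_topology (\<lambda>_::nat. discrete_topology (UNIV :: 'a letter option set)) UNIV"
  let ?C = "fword_point ` carrier free_group \<union> ray_point ` boundary :: (nat \<Rightarrow> 'a letter option) set"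
  have pt: "(\<forall>i<n. fword_point h i = ray_point \<omega> i) \<longleftrightarrow> n \<le> length h \<and> take n h = ray_prefix \<omega> n" for n h
  proof
    assume *: "\<forall>i<n. fword_point h i = ray_point \<omega> i"
    then have "n \<le> length h"
      by (cases "length h < n") (auto simp: fword_point_def ray_point_def dest: spec[of _ "length h"])
    with * show "n \<le> length h \<and> take n h = ray_prefix \<omega> n"
      by (auto simp: list_eq_iff_nth_eq fword_point_def ray_point_def)
  next
    assume *: "n \<le> length h \<and> take n h = ray_prefix \<omega> n"
    have "h ! i = \<omega> i" if "i < n" for i
      using that * by (metis nth_take ray_prefix_nth)
    then show "\<forall>i<n. fword_point h i = ray_point \<omega> i"
      using * by (auto simp: fword_point_def ray_point_def)
  qed
  have ne: "fword_point h \<noteq> ray_point \<omega>" for h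
    by (auto simp: fword_point_def ray_point_def fun_eq_iff intro: exI[of _ "length h"])
  show ?thesis
  proof
    assume L: ?L
    then have b: "\<omega> \<in> boundary" and
      d: "\<And>T. ray_point \<omega> \<in> T \<Longrightarrow> openin compactification T \<Longrightarrow> \<exists>y. y \<in> fword_point ` H \<and> y \<in> T"
      by (auto simp: limit_set_def in_derived_set_of)
    have "\<exists>h\<in>H. n \<le> length h \<and> take n h = ray_prefix \<omega> n" for n
    proof -
      let ?V = "{y. \<forall>i<n. y i = ray_point \<omega> i}"
      have "openin ?P ?V" unfolding openin_discrete_sequences by (auto intro!: exI[of _ n])
      then have "openin compactification (?V \<inter> ?C)"
        unfolding compactification_def openin_subtopology by blast
      then have "\<exists>y. y \<in> fword_point ` H \<and> y \<in> ?V \<inter> ?C"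
        using b by (intro d) auto
      then show ?thesis using pt by auto
    qed
    with b show ?R by blast
  next
    assume R: ?R
    have "\<exists>y\<in>fword_point ` H. y \<noteq> ray_point \<omega> \<and> y \<in> T"
      if T: "ray_point \<omega> \<in> T" "openin compactification T" for T
    proof -
      obtain V where V: "openin ?P V" "T = V \<inter> ?C"
        using T(2) unfolding compactification_def openin_subtopology by blast
      moreover have "ray_point \<omega> \<in> V" using T(1) V(2) by simp
      ultimately have "\<exists>n. \<forall>y. (\<forall>i<n. y i = ray_point \<omega> i) \<longrightarrow> y \<in> V"
        by (simp only: openin_discrete_sequences)
      then obtain n where n: "\<forall>y. (\<forall>i<n. y i = ray_point \<omega> i) \<longrightarrow> y \<in> V" ..
      obtain h where h: "h \<in> H" "n \<le> length h \<and> take n h = ray_prefix \<omega> n" using R by blast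
      then have "fword_point h \<in> T" using n pt V(2) assms by blast
      then show ?thesis using h(1) ne by blast
    qed
    moreover have "ray_point \<omega> \<in> topspace compactification"
      using R by (auto simp: compactification_def)
    ultimately show ?L using R unfolding limit_set_def in_derived_set_of by blast
  qed
qed

section \<open>Hanging arcs and the limit set\<close>

fun walk :: "'a fword set \<Rightarrow> 'a fword \<Rightarrow> ('a fword set \<times> 'a letter) list" where
  "walk x [] = []"
| "walk x (a # w) = (x, a) # walk (x #>\<^bsub>free_group\<^esub> [a]) w"

definition walk_end :: "'a fword set \<Rightarrow> 'a fword \<Rightarrow> 'a fword set" where
  "walk_end x w = foldl (\<lambda>y a. y #>\<^bsub>free_group\<^esub> [a]) x w"

lemma walk_end_simps [simp]:
  "walk_end x [] = x" "walk_end x (a # w) = walk_end (x #>\<^bsub>free_group\<^esub> [a]) w"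
  "walk_end x (u @ v) = walk_end (walk_end x u) v"
  by (simp_all add: walk_end_def)

lemma walk_append [simp]: "walk x (u @ v) = walk x u @ walk (walk_end x u) v"
  by (induction u arbitrary: x) simp_all

lemma length_walk [simp]: "length (walk x w) = length w"
  by (induction w arbitrary: x) simp_all

lemma map_snd_walk [simp]: "map snd (walk x w) = w"
  by (induction w arbitrary: x) simp_all

text \<open>
  The arc labelled \<open>a\<close> at the vertex \<open>x\<close> is the first arc of a hanging branch.  For a coset \<open>x\<close> of \<open>H\<close>,
  any single \<open>g\<close> in \<open>x\<close> can be used to test this.
\<close>

definition hanging :: "'a fword set \<Rightarrow> 'a fword set \<Rightarrow> 'a letter \<Rightarrow> bool" where
  "hanging H x a \<longleftrightarrow>
     (\<forall>g\<in>x. \<forall>k. reduced k \<longrightarrow> k \<noteq> [] \<longrightarrow> hd k = a \<longrightarrow> g \<cdot> k \<cdot> iv g \<notin> H)"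

locale free_subgroup =
  fixes H :: "'a::finite fword set"
  assumes subgroup_H: "subgroup H free_group"
begin

abbreviation vx :: "'a fword \<Rightarrow> 'a fword set" where
  "vx g \<equiv> H #>\<^bsub>free_group\<^esub> g"

lemma H_subset: "H \<subseteq> carrier free_group"
  using subgroup_H by (simp add: subgroup.subset)

lemma H_reduced [simp]: "h \<in> H \<Longrightarrow> reduced h"
  using H_subset by auto

lemma H_Nil [simp]: "[] \<in> H"
  using subgroup.one_closed[OF subgroup_H] by simp

lemma H_mul: "h \<in> H \<Longrightarrow> k \<in> H \<Longrightarrow> h \<cdot> k \<in> H"
  by (rule subgroup.m_closed[OF subgroup_H])

lemma H_inv: "h \<in> H \<Longrightarrow> iv h \<in> H"
  by (rule subgroup.m_inv_closed[OF subgroup_H])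

lemma vx_Nil [simp]: "vx [] = H"
  using F.coset_mult_one[OF H_subset] by simp

lemma vx_mul: "reduced g \<Longrightarrow> reduced u \<Longrightarrow> vx g #>\<^bsub>free_group\<^esub> u = vx (g \<cdot> u)"
  using F.coset_mult_assoc[OF H_subset] by simp

lemma in_vx: "g' \<in> vx g \<longleftrightarrow> (\<exists>h\<in>H. g' = h \<cdot> g)"
  by (auto simp: r_coset_def)

lemma vx_eq_iff:
  assumes "reduced g" "reduced g'"
  shows "vx g = vx g' \<longleftrightarrow> g \<cdot> iv g' \<in> H"
proof
  assume "vx g = vx g'"
  moreover have "g \<in> vx g" using assms by (auto simp: in_vx intro!: bexI[of _ "[]"])
  ultimately obtain h where "h \<in> H" "g = h \<cdot> g'" by (auto simp: in_vx)
  then show "g \<cdot> iv g' \<in> H" using assms by (simp add: mul_assoc)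
next
  assume *: "g \<cdot> iv g' \<in> H"
  have "vx (g \<cdot> iv g') = H"
    using F.coset_join2[OF _ subgroup_H *] by simp
  then have "vx (g \<cdot> iv g') #>\<^bsub>free_group\<^esub> g' = vx g'" by simp
  then show "vx g = vx g'" using assms by (simp add: vx_mul mul_assoc)
qed

lemma vx_eq_H_iff: "reduced g \<Longrightarrow> vx g = H \<longleftrightarrow> g \<in> H"
  using vx_eq_iff[of g "[]"] by simp

lemma verts_iff: "x \<in> rcosets\<^bsub>free_group\<^esub> H \<longleftrightarrow> (\<exists>g. reduced g \<and> x = vx g)"
  by (auto simp: RCOSETS_def)

lemma walk_end_vx: "reduced g \<Longrightarrow> walk_end (vx g) w = vx (g \<cdot> free_reduce w)"
proof (induction w arbitrary: g)
  case (Cons a w)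
  have "free_reduce (a # w) = [a] \<cdot> free_reduce w"
    using free_reduce_append[of "[a]" w] by (simp add: free_reduce_id)
  then show ?case
    using Cons by (simp add: vx_mul mul_assoc reduced_free_reduce)
qed simp

lemma walk_end_H: "walk_end H w = vx (free_reduce w)"
  using walk_end_vx[of "[]" w] by (simp add: reduced_free_reduce)

lemma walk_end_free_reduce:
  "x \<in> rcosets\<^bsub>free_group\<^esub> H \<Longrightarrow> walk_end x (free_reduce w) = walk_end x w"
  by (auto simp: verts_iff walk_end_vx free_reduce_id reduced_free_reduce)

lemma walk_end_verts: "x \<in> rcosets\<^bsub>free_group\<^esub> H \<Longrightarrow> walk_end x w \<in> rcosets\<^bsub>free_group\<^esub> H"
  unfolding verts_iff by (metis reduced_mul walk_end_vx)

lemma H_vert [simp]: "H \<in> rcosets\<^bsub>free_group\<^esub> H"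
  unfolding verts_iff by (intro exI[of _ "[]"]) simp

text \<open>Replacing g by h g with h in H conjugates the tested element by h, which does not affect
  its membership in H.\<close>

lemma hanging_vx:
  assumes g: "reduced g"
  shows "hanging H (vx g) a \<longleftrightarrow>
    (\<forall>k. reduced k \<longrightarrow> k \<noteq> [] \<longrightarrow> hd k = a \<longrightarrow> g \<cdot> k \<cdot> iv g \<notin> H)"
proof -
  have "(h \<cdot> g) \<cdot> k \<cdot> iv (h \<cdot> g) \<in> H \<longleftrightarrow> g \<cdot> k \<cdot> iv g \<in> H" if h: "h \<in> H" and k: "reduced k" for h k
  proof -
    have eq: "(h \<cdot> g) \<cdot> k \<cdot> iv (h \<cdot> g) = h \<cdot> (g \<cdot> k \<cdot> iv g) \<cdot> iv h"
      using g h k by (simp add: mul_assoc inv_mul)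
    have "g \<cdot> k \<cdot> iv g = iv h \<cdot> (h \<cdot> (g \<cdot> k \<cdot> iv g) \<cdot> iv h) \<cdot> h"
      using g h k by (simp add: mul_assoc)
    then show ?thesis unfolding eq using h by (metis H_mul H_inv)
  qed
  moreover have "g \<in> vx g" using g by (auto simp: in_vx intro!: bexI[of _ "[]"])
  ultimately show ?thesis unfolding hanging_def by (metis in_vx)
qed

text \<open>Squaring k squares g k g^-1, so the result stays in H while k grows and keeps its first
  letter. Long elements are needed so that multiplication by a fixed word on the right does not
  reach this letter.\<close>

lemma long_conjugate:
  assumes "reduced g" "reduced k" "k \<noteq> []" "g \<cdot> k \<cdot> iv g \<in> H"
  obtains k' where "reduced k'" "hd k' = hd k" "n < length k'" "g \<cdot> k' \<cdot> iv g \<in> H"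
proof -
  have "\<exists>k'. reduced k' \<and> hd k' = hd k \<and> n < length k' \<and> g \<cdot> k' \<cdot> iv g \<in> H"
  proof (induction n)
    case 0
    then show ?case using assms by blast
  next
    case (Suc n)
    then obtain k' where k': "reduced k'" "hd k' = hd k" "n < length k'" "g \<cdot> k' \<cdot> iv g \<in> H" by blast
    have "g \<cdot> (k' \<cdot> k') \<cdot> iv g = (g \<cdot> k' \<cdot> iv g) \<cdot> (g \<cdot> k' \<cdot> iv g)"
      using assms(1) k'(1) by (simp add: mul_assoc)
    then have "g \<cdot> (k' \<cdot> k') \<cdot> iv g \<in> H" using H_mul k'(4) by simp
    moreover have "hd (k' \<cdot> k') = hd k" "Suc n < length (k' \<cdot> k')"
      using square_longer[of k'] k' by fastforce+
    ultimately show ?case by (meson reduced_mul)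
  qed
  then show ?thesis using that by blast
qed

text \<open>A closed word at the next vertex that begins with b becomes, conjugated by a, a closed
  word at the present vertex. The final a^-1 cancels at most one letter, so this word still begins
  with a.\<close>

lemma hanging_step:
  assumes "reduced g" "b \<noteq> linv a" "hanging H (vx g) a"
  shows "hanging H (vx (g \<cdot> [a])) b"
proof (rule ccontr)
  assume "\<not> hanging H (vx (g \<cdot> [a])) b"
  then obtain k where "reduced k" "k \<noteq> []" "hd k = b" "(g \<cdot> [a]) \<cdot> k \<cdot> iv (g \<cdot> [a]) \<in> H"
    using assms(1) by (auto simp: hanging_vx)
  then obtain k' where k': "reduced k'" "hd k' = b" "1 < length k'" "(g \<cdot> [a]) \<cdot> k' \<cdot> iv (g \<cdot> [a]) \<in> H"
    using long_conjugate[of "g \<cdot> [a]" k 1] assms(1) by (metis reduced_mul)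
  let ?m = "[a] \<cdot> k' \<cdot> iv [a]"
  have ak: "reduced ([a] @ k')" using k'(1-3) assms(2) by (cases k') auto
  have "length (iv [a]) < length ([a] @ k')" using k'(3) by (cases k') auto
  then have "?m \<noteq> []" "hd ?m = a"
    using hd_mul[of "[a] @ k'" "iv [a]"] ak by (simp_all add: mul_append)
  moreover have "g \<cdot> ?m \<cdot> iv g \<in> H" using k'(1,4) assms(1) by (simp add: mul_assoc inv_mul)
  ultimately show False using assms(1,3) by (auto simp: hanging_vx)
qed

text \<open>Inverse of \<open>read_ray\<close> on the paths from o without backtracking; it turns
  statements about paths into statements about boundary points.\<close>

definition path :: "'a ray \<Rightarrow> nat \<Rightarrow> 'a fword set \<times> 'a letter" where
  "path \<omega> n = (vx (ray_prefix \<omega> n), \<omega> n)"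

lemma ray_prefix_mul: "\<omega> \<in> boundary \<Longrightarrow> ray_prefix \<omega> n \<cdot> [\<omega> n] = ray_prefix \<omega> (Suc n)"
  using reduced_ray_prefix[of \<omega> "Suc n"] by (simp add: ray_prefix_Suc mul_append)

lemma limit_set_iff:
  "\<omega> \<in> limit_set H \<longleftrightarrow> \<omega> \<in> boundary \<and>
    (\<forall>n. \<exists>h\<in>H. n \<le> length h \<and> take n h = ray_prefix \<omega> n)"
  by (rule in_limit_set_iff[OF H_subset])

text \<open>If h = w u is in H, with w the prefix of length n, then w^-1 h w = u w, and this begins
  with the next letter of the ray once u is longer than w. Conversely, a long k with this first
  letter that is closed at the end of w gives an element w k w^-1 of H which keeps the prefix
  w.\<close>

lemma limit_set_hanging:
  assumes \<omega>: "\<omega> \<in> boundary"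
  shows "\<omega> \<in> limit_set H \<longleftrightarrow> (\<forall>n. \<not> hanging H (vx (ray_prefix \<omega> n)) (\<omega> n))"
proof
  assume L: "\<omega> \<in> limit_set H"
  show "\<forall>n. \<not> hanging H (vx (ray_prefix \<omega> n)) (\<omega> n)"
  proof
    fix n
    let ?w = "ray_prefix \<omega> n"
    \<comment> \<open>With 2 n + 1 letters, more than n remain after the prefix, so that
      \<open>?w\<close> on the right cannot cancel the letter \<open>\<omega> n\<close>.\<close>
    obtain h where h: "h \<in> H" "Suc n + n \<le> length h" "take (Suc n + n) h = ray_prefix \<omega> (Suc n + n)"
      using L by (auto simp: limit_set_iff)
    then have "take (Suc n) (take (Suc n + n) h) = ray_prefix \<omega> (Suc n)" by simp
    then have "take (Suc n) h = ?w @ [\<omega> n]" by (simp add: ray_prefix_Suc)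
    then have hz: "h = ?w @ \<omega> n # drop (Suc n) h"
      by (metis append.assoc append_Cons append_Nil append_take_drop_id)
    let ?u = "\<omega> n # drop (Suc n) h"
    have u: "reduced ?u" using H_reduced[OF h(1)] hz by (metis reduced_append_iff)
    have "h = ?w \<cdot> ?u" using H_reduced[OF h(1)] hz mul_append by metis
    then have "?w \<cdot> (?u \<cdot> ?w) \<cdot> iv ?w = h"
      using \<omega> u by (simp add: mul_assoc)
    moreover have "length ?w < length ?u" using h(2) by simp
    then have "?u \<cdot> ?w \<noteq> []" "hd (?u \<cdot> ?w) = \<omega> n"
      using hd_mul[of ?u ?w] u \<omega> by simp_all
    ultimately show "\<not> hanging H (vx ?w) (\<omega> n)"
      using h(1) \<omega> by (metis hanging_vx reduced_mul reduced_ray_prefix)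
  qed
next
  assume R: "\<forall>n. \<not> hanging H (vx (ray_prefix \<omega> n)) (\<omega> n)"
  have "\<exists>h\<in>H. n \<le> length h \<and> take n h = ray_prefix \<omega> n" for n
  proof -
    let ?w = "ray_prefix \<omega> n"
    obtain k where "reduced k" "k \<noteq> []" "hd k = \<omega> n" "?w \<cdot> k \<cdot> iv ?w \<in> H"
      using R[rule_format, of n] \<omega> by (auto simp: hanging_vx)
    \<comment> \<open>Longer than n, so that the inverse of \<open>?w\<close> on the right cannot
      cancel all of it and reach the prefix.\<close>
    then obtain k' where k': "reduced k'" "hd k' = \<omega> n" "n < length k'" "?w \<cdot> k' \<cdot> iv ?w \<in> H"
      using long_conjugate[of ?w k n] \<omega> by (metis reduced_ray_prefix)
    have "reduced (?w @ [\<omega> n])" using \<omega> by (simp flip: ray_prefix_Suc)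
    then have red: "reduced (?w @ k')" using k' by (auto simp: reduced_append_iff)
    have "n + length (iv ?w) \<le> length (?w @ k')" using k'(3) \<omega> by simp
    then have "take n ((?w @ k') \<cdot> iv ?w) = take n (?w @ k')" "n \<le> length ((?w @ k') \<cdot> iv ?w)"
      using take_mul[of "?w @ k'" "iv ?w" n] red \<omega> by simp_all
    then show ?thesis using k'(4) red by (intro bexI[of _ "?w \<cdot> k' \<cdot> iv ?w"]) (simp_all add: mul_append)
  qed
  then show "\<omega> \<in> limit_set H" using \<omega> by (simp add: limit_set_iff)
qed

lemma hanging_ray_mono:
  assumes "\<omega> \<in> boundary" "hanging H (vx (ray_prefix \<omega> n)) (\<omega> n)" "n \<le> m"
  shows "hanging H (vx (ray_prefix \<omega> m)) (\<omega> m)"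
  using assms(3)
proof (induction m rule: dec_induct)
  case (step m)
  then show ?case
    using hanging_step[of "ray_prefix \<omega> m" "\<omega> (Suc m)" "\<omega> m"] assms(1)
    by (simp add: ray_prefix_mul boundary_def)
qed (rule assms(2))

text \<open>While the reversed arcs are hanging, k = w^-1 h w neither begins with the inverse of the
  last letter of w nor ends with that letter. Then w k w^-1 is reduced as it stands and equals h, so
  w cannot be longer than h.\<close>

lemma eventually_not_hanging_back:
  assumes \<omega>: "\<omega> \<in> boundary" and "H \<noteq> {[]}"
  shows "\<forall>\<^sub>F n in sequentially. \<not> hanging H (vx (ray_prefix \<omega> (Suc n))) (linv (\<omega> n))"
proof -
  obtain h where h: "h \<in> H" "h \<noteq> []" using assms(2) H_Nil by blast
  have "\<not> hanging H (vx (ray_prefix \<omega> (Suc n))) (linv (\<omega> n))" if n: "length h \<le> n" for n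
  proof
    assume hang: "hanging H (vx (ray_prefix \<omega> (Suc n))) (linv (\<omega> n))"
    let ?w = "ray_prefix \<omega> (Suc n)"
    have w: "reduced ?w" "last ?w = \<omega> n" "?w \<noteq> []"
      using \<omega> by simp (simp_all add: ray_prefix_Suc)
    define k where "k = iv ?w \<cdot> h \<cdot> ?w"
    have k: "reduced k" "?w \<cdot> k \<cdot> iv ?w = h" "?w \<cdot> iv k \<cdot> iv ?w = iv h"
      using w(1) H_reduced[OF h(1)] by (simp_all add: k_def mul_assoc inv_mul)
    have kn: "k \<noteq> []" using k(2) h(2) w(1) by auto
    \<comment> \<open>The inverse of k is tested too: its first letter decides whether k cancels
      against \<open>iv ?w\<close>.\<close>
    have "iv k \<noteq> []" using kn k(1) by (metis inv_Nil mul_inv(3))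
    moreover have "?w \<cdot> iv k \<cdot> iv ?w \<in> H" using k(3) H_inv[OF h(1)] by simp
    ultimately have "hd (iv k) \<noteq> linv (\<omega> n)"
      using hang k(1) w(1) hanging_vx reduced_inv by blast
    then have "last k \<noteq> \<omega> n" using kn k(1) by (auto simp: inv_eq hd_rev last_map)
    moreover have "hd k \<noteq> linv (\<omega> n)"
      using hang k(1,2) h(1) kn w(1) hanging_vx by metis
    moreover have "hd (iv ?w) = linv (\<omega> n)" using w by (simp add: inv_eq hd_rev last_map)
    ultimately have red: "reduced ((?w @ k) @ iv ?w)"
      using w kn k(1) unfolding reduced_append_iff[of "?w @ k"] reduced_append_iff[of ?w] by simp
    then have "reduced (?w @ k)" unfolding reduced_append_iff[of "?w @ k"] by blast
    then have "h = (?w @ k) @ iv ?w"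
      using k(2) mul_append[OF red] mul_append[of ?w k] by simp
    then have "length h \<ge> Suc n"
      by (simp only: length_append length_ray_prefix)
    then show False using n by simp
  qed
  then show ?thesis by (auto simp: eventually_sequentially)
qed

end

section \<open>Hanging branches and the core\<close>

lemma schreier_graph_simps [simp]:
  "verts (schreier_graph H) = rcosets\<^bsub>free_group\<^esub> H"
  "arcs (schreier_graph H) = (rcosets\<^bsub>free_group\<^esub> H) \<times> UNIV"
  "tail (schreier_graph H) = fst"
  "head (schreier_graph H) = (\<lambda>(x, a). x #>\<^bsub>free_group\<^esub> [a])"
  by (simp_all add: schreier_graph_def)

lemma mul_letter:
  assumes "reduced v"
  shows "v \<cdot> [c] = (if v \<noteq> [] \<and> last v = linv c then butlast v else v @ [c])"
proof (cases "v \<noteq> [] \<and> last v = linv c")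
  case True
  then obtain u where u: "v = u @ [linv c]" by (metis append_butlast_last_id)
  then have "reduced u" using assms by (simp add: reduced_append_iff)
  moreover have "v = u \<cdot> iv [c]" using u assms by (simp add: inv_eq mul_append)
  ultimately have "v \<cdot> [c] = u" by (simp add: mul_assoc)
  then show ?thesis using u True by simp
next
  case False
  then have "reduced (v @ [c])"
    using assms by (simp add: reduced_append_iff) (metis linv_linv)
  then show ?thesis using False by (auto simp: mul_append)
qed

lemma awalk_labels_reduced:
  assumes "tail G = fst" "pre_digraph.cas G u p v" "successively (\<lambda>e f. f \<noteq> arc_rev G e) p"
  shows "reduced (map snd p)"
  using assms(2,3)
proof (induction p arbitrary: u)
  case (Cons e p)
  then show ?case
    by (cases p) (auto simp: pre_digraph.cas.simps assms(1) arc_rev_def prod_eq_iff)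
qed simp

lemma cayley_walk_end:
  assumes "head G = (\<lambda>(g, a). g \<cdot> [a])" "tail G = fst" "reduced u" "pre_digraph.cas G u p v"
  shows "v = u \<cdot> free_reduce (map snd p)"
  using assms(3,4)
proof (induction p arbitrary: u)
  case Nil
  then show ?case by (simp add: pre_digraph.cas.simps)
next
  case (Cons e p)
  have "v = u \<cdot> [snd e] \<cdot> free_reduce (map snd p)"
    using Cons.prems Cons.IH[of "u \<cdot> [snd e]"]
    by (auto simp: pre_digraph.cas.simps assms(1,2) split: prod.splits)
  moreover have "free_reduce (map snd (e # p)) = [snd e] \<cdot> free_reduce (map snd p)"
    using free_reduce_append[of "[snd e]" "map snd p"] by (simp add: free_reduce_id)
  ultimately show ?case using Cons.prems(1) by (simp add: mul_assoc reduced_free_reduce)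
qed

section \<open>The model branch in the Cayley tree\<close>

definition words_from :: "'a letter \<Rightarrow> 'a fword set" where
  "words_from a = {w. reduced w \<and> (w = [] \<or> hd w = a)}"

text \<open>The branch rooted at the empty word. The vertex set of any branch is a left translate of
  such a set, as the proof of \<open>hanging_branch_arcs\<close> shows.\<close>

definition word_branch :: "'a letter \<Rightarrow> ('a fword, 'a fword \<times> 'a letter) pre_digraph" where
  "word_branch a = \<lparr>verts = words_from a,
     arcs = {(v, c). v \<in> words_from a \<and> v \<cdot> [c] \<in> words_from a},
     tail = fst, head = (\<lambda>(g, a). g \<cdot> [a])\<rparr>"

lemma word_branch_simps [simp]:
  "verts (word_branch a) = words_from a"
  "arcs (word_branch a) = {(v, c). v \<in> words_from a \<and> v \<cdot> [c] \<in> words_from a}"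
  "tail (word_branch a) = fst"
  "head (word_branch a) = (\<lambda>(g, a). g \<cdot> [a])"
  by (simp_all add: word_branch_def)

text \<open>A letter extends a non-empty word or deletes its last letter, so the first letter is
  lost only by arriving at the root. Only the root restricts the next letter.\<close>

lemma words_from_letter:
  assumes "v \<in> words_from a"
  shows "v \<cdot> [c] \<in> words_from a \<longleftrightarrow> v \<noteq> [] \<or> c = a"
proof (cases v)
  case Nil
  then show ?thesis by (auto simp: words_from_def)
next
  case (Cons b w)
  have r: "reduced v" using assms by (simp add: words_from_def)
  show ?thesis
    using assms Cons reduced_mul[of v "[c]"] unfolding mul_letter[OF r]
    by (auto simp: words_from_def)
qed

lemma wf_word_branch: "wf_digraph (word_branch a)"
  by unfold_locales auto

lemma word_branch_arc_rev:
  assumes "e \<in> arcs (word_branch a)"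
  shows "arc_rev (word_branch a) e \<in> arcs (word_branch a)"
proof -
  obtain v c where e: "e = (v, c)" by (cases e)
  have "v \<cdot> [c] \<cdot> [linv c] = v \<cdot> ([c] \<cdot> iv [c])"
    using assms e by (subst mul_assoc) (simp_all add: words_from_def inv_eq)
  also have "\<dots> = v" using assms e by (simp add: words_from_def)
  finally show ?thesis using assms e by (simp add: arc_rev_def)
qed

lemma strongly_connected_word_branch: "strongly_connected (word_branch a)"
proof (rule strongly_connectedI)
  interpret wf_digraph "word_branch a" by (rule wf_word_branch)
  show "verts (word_branch a) \<noteq> {}" using reduced_simps(1) by (force simp: words_from_def)
  have from_Nil: "[] \<rightarrow>\<^sup>*\<^bsub>word_branch a\<^esub> v" if "v \<in> words_from a" for v
    using that
  proof (induction v rule: rev_induct)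
    case Nil
    then show ?case by (intro reachable_refl) simp
  next
    case (snoc c v)
    have v: "v \<in> words_from a" "reduced (v @ [c])"
      using snoc.prems reduced_append_iff[of v "[c]"] by (cases v; simp add: words_from_def)+
    have "(v, c) \<in> arcs (word_branch a)" using v snoc.prems by (simp add: mul_append)
    then have "v \<rightarrow>\<^bsub>word_branch a\<^esub> (v @ [c])"
      using v(2) by (intro dominatesI[of "(v, c)"]) (simp_all add: arc_to_ends_def mul_append)
    then show ?case using snoc.IH[OF v(1)] reachable_adj_trans by blast
  qed
  have "symmetric (word_branch a)"
    unfolding symmetric_conv
  proof
    fix e assume "e \<in> arcs (word_branch a)"
    then show "\<exists>e2\<in>arcs (word_branch a). tail (word_branch a) e = head (word_branch a) e2 \<and>
        head (word_branch a) e = tail (word_branch a) e2"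
    proof (intro bexI[of _ "arc_rev (word_branch a) e"] conjI)
      obtain v c where e: "e = (v, c)" by (cases e)
      assume "e \<in> arcs (word_branch a)"
      then have "v \<cdot> [c] \<cdot> iv [c] = v" using e by (simp add: words_from_def mul_assoc)
      then show "tail (word_branch a) e = head (word_branch a) (arc_rev (word_branch a) e)"
        using e by (simp add: arc_rev_def inv_eq)
      show "head (word_branch a) e = tail (word_branch a) (arc_rev (word_branch a) e)"
        by (simp add: arc_rev_def)
    qed (rule word_branch_arc_rev)
  qed
  then show "u \<rightarrow>\<^sup>*\<^bsub>word_branch a\<^esub> v"
    if "u \<in> verts (word_branch a)" "v \<in> verts (word_branch a)" for u v
    using from_Nil that symmetric_reachable reachable_trans by (metis word_branch_simps(1))
qed

text \<open>There are no cycles because a closed walk without backtracking has a reduced label that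
  fixes its base point under right multiplication, hence an empty label.\<close>

lemma branch_word_branch: "branch (word_branch (a :: 'a::finite letter))"
proof -
  have sub: "sym_subgraph (word_branch a) cayley_graph"
    unfolding sym_subgraph_def subgraph_def compatible_def
  proof (intro conjI ballI)
    show "wf_digraph (cayley_graph :: ('a fword, 'a fword \<times> 'a letter) pre_digraph)"
      by unfold_locales (auto simp: cayley_graph_def)
    fix e assume "e \<in> arcs (word_branch a)"
    then show "arc_rev cayley_graph e \<in> arcs (word_branch a)"
      using word_branch_arc_rev[of e a] by (simp add: arc_rev_def cayley_graph_def)
  qed (auto simp: cayley_graph_def words_from_def wf_word_branch)
  have "\<not> (pre_digraph.cycle (word_branch a) p \<and> successively (\<lambda>e f. f \<noteq> arc_rev (word_branch a) e) p)" for p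
  proof
    assume p: "pre_digraph.cycle (word_branch a) p \<and> successively (\<lambda>e f. f \<noteq> arc_rev (word_branch a) e) p"
    then obtain u where u: "pre_digraph.awalk (word_branch a) u p u" "p \<noteq> []"
      by (auto simp: pre_digraph.cycle_def)
    then have c: "pre_digraph.cas (word_branch a) u p u" "reduced u"
      by (auto simp: pre_digraph.awalk_def words_from_def)
    have "reduced (map snd p)"
      using awalk_labels_reduced[OF _ c(1)] p by simp
    then have "u = u \<cdot> map snd p"
      using cayley_walk_end[OF _ _ c(2,1)] by (simp add: free_reduce_id)
    then have "map snd p = []"
      using c(2) \<open>reduced (map snd p)\<close> by (metis mul_inv(2) mul_inv_cancel(2))
    then show False using u(2) by simp
  qed
  then have tree: "sym_tree (word_branch a)"
    unfolding sym_tree_def using strongly_connected_word_branch by blast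
  have "out_arcs (word_branch a) [] = {([], a)}"
    by (auto simp: words_from_def)
  then have root: "out_degree (word_branch a) [] = 1" by (simp add: out_degree_def)
  have other: "out_degree (word_branch a) v = 2 * CARD('a)" if v: "v \<in> words_from a" "v \<noteq> []" for v
  proof -
    have "out_arcs (word_branch a) v = {v} \<times> UNIV"
      using v by (auto simp: words_from_letter)
    then show ?thesis by (simp add: out_degree_def card_cartesian_product)
  qed
  show ?thesis unfolding branch_def
    using sub tree root other by (intro conjI bexI[of _ "[]"]) (auto simp: words_from_def)
qed

section \<open>Hanging arcs and hanging branches of the Schreier graph\<close>

context free_subgroup
begin

lemma wf_schreier_graph: "wf_digraph (schreier_graph H)"
proof
  fix e assume e: "e \<in> arcs (schreier_graph H)"
  then show "tail (schreier_graph H) e \<in> verts (schreier_graph H)" by auto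
  show "head (schreier_graph H) e \<in> verts (schreier_graph H)"
    using e walk_end_verts[of "fst e" "[snd e]"] by auto
qed

text \<open>Two words u \<noteq> v with the same end vertex give a non-trivial k = u v^-1 in g^-1 H
  g. After removal of the common suffix, the remainder of u or that of v is not empty and begins
  with a, so k or its inverse begins with a.\<close>

lemma hanging_inj:
  assumes g: "reduced g" and hang: "hanging H (vx g) a"
  shows "inj_on (\<lambda>w. vx (g \<cdot> w)) (words_from a)"
proof (rule inj_onI, rule ccontr)
  fix u v assume u: "u \<in> words_from a" and v: "v \<in> words_from a" and eq: "vx (g \<cdot> u) = vx (g \<cdot> v)"
    and ne: "u \<noteq> v"
  have r: "reduced u" "reduced v" using u v by (simp_all add: words_from_def)
  let ?k = "u \<cdot> iv v"
  have "g \<cdot> u \<cdot> iv (g \<cdot> v) \<in> H" using eq g r by (simp add: vx_eq_iff)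
  then have kH: "g \<cdot> ?k \<cdot> iv g \<in> H" using g r by (simp add: mul_assoc inv_mul)
  have kH': "g \<cdot> iv ?k \<cdot> iv g \<in> H"
    using H_inv[OF kH] g r by (simp add: mul_assoc inv_mul)
  obtain p c q where pcq: "u = p @ c" "iv v = iv c @ q" "?k = p @ q" "reduced (p @ q)" "reduced c"
    using mul_decomp[of u "iv v"] r by (metis reduced_inv)
  show False
  proof (cases "p = []")
    case False
    then have "hd ?k = a" using pcq u by (auto simp: words_from_def)
    moreover have "?k \<noteq> []" using False pcq(3) by simp
    ultimately show False using hang kH g unfolding hanging_vx[OF g] by simp
  next
    \<comment> \<open>Now u is a suffix of v, and it is the inverse of k that begins with a.\<close>
    case True
    have "v = iv (iv c @ q)" using pcq(2) r by (metis mul_inv(3))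
    also have "\<dots> = rev (map linv q) @ rev (map linv (iv c))"
      using inv_eq[of "iv c @ q"] pcq(2) reduced_inv[OF r(2)] by simp
    also have "\<dots> = iv q @ c"
      using pcq(4,5) True by (simp add: inv_eq rev_map comp_def)
    finally have vq: "v = iv q @ c" .
    have k: "?k = q" "reduced q" using True pcq(3,4) by simp_all
    then have qn: "q \<noteq> []" using vq ne pcq(1) True by auto
    then have "iv q \<noteq> []" using k(2) by (metis inv_Nil mul_inv(3))
    then have "hd (iv q) = a" using vq v by (auto simp: words_from_def)
    then show False using hang kH' \<open>iv q \<noteq> []\<close> k g unfolding hanging_vx[OF g] by simp
  qed
qed

text \<open>The branch is the image of \<open>word_branch a\<close> under w \<mapsto> H g w, which
  is injective as the arc is hanging. Its arcs are described by words because rays will be followed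
  into it letter by letter.\<close>

lemma hanging_branch_exists:
  assumes g: "reduced g" and hang: "hanging H (vx g) a"
  obtains Y where "hanging_branch H Y"
    "\<And>w c. reduced w \<Longrightarrow> (w = [] \<and> c = a) \<or> (w \<noteq> [] \<and> hd w = a) \<Longrightarrow> (vx (g \<cdot> w), c) \<in> arcs Y"
proof -
  define f where "f = \<lparr>iso_verts = (\<lambda>w. vx (g \<cdot> w)), iso_arcs = (\<lambda>(w, c). (vx (g \<cdot> w), c :: 'a letter)),
      iso_head = (\<lambda>(x, a). x #>\<^bsub>free_group\<^esub> [a]), iso_tail = fst\<rparr>"
  let ?B = "word_branch a"
  let ?Y = "app_iso f ?B"
  have inj: "inj_on (\<lambda>w. vx (g \<cdot> w)) (words_from a)" using g hang by (rule hanging_inj)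
  have step: "vx (g \<cdot> w) #>\<^bsub>free_group\<^esub> [c] = vx (g \<cdot> (w \<cdot> [c]))" if "w \<in> words_from a" for w c
    using that g by (simp add: vx_mul mul_assoc words_from_def)
  have iso: "pre_digraph.digraph_isomorphism ?B f"
    unfolding pre_digraph.digraph_isomorphism_def
    using inj step by (auto simp: wf_word_branch f_def inj_on_def)
  have arcsY: "arcs ?Y = (\<lambda>(w, c). (vx (g \<cdot> w), c)) ` arcs ?B" by (simp add: f_def)
  have "sym_subgraph ?Y (schreier_graph H)"
    unfolding sym_subgraph_def subgraph_def compatible_def
  proof (intro conjI ballI)
    show "wf_digraph ?Y" using wf_digraph.wf_digraphI_app_iso[OF wf_word_branch iso] .
    have vert: "vx (g \<cdot> w) \<in> rcosets\<^bsub>free_group\<^esub> H" for w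
      using verts_iff reduced_mul by blast
    show "verts ?Y \<subseteq> verts (schreier_graph H)" using vert by (auto simp: f_def)
    show "arcs ?Y \<subseteq> arcs (schreier_graph H)" using vert unfolding arcsY by auto
    fix e assume "e \<in> arcs ?Y"
    then obtain w c where wc: "(w, c) \<in> arcs ?B" "e = (vx (g \<cdot> w), c)" unfolding arcsY by auto
    have "arc_rev (schreier_graph H) e = (\<lambda>(w, c). (vx (g \<cdot> w), c)) (arc_rev ?B (w, c))"
      using wc step by (simp add: arc_rev_def)
    then show "arc_rev (schreier_graph H) e \<in> arcs ?Y"
      unfolding arcsY using word_branch_arc_rev[OF wc(1)] by blast
  qed (simp_all add: wf_schreier_graph f_def)
  moreover have "\<forall>e\<in>arcs ?B. snd (iso_arcs f e) = snd e" by (auto simp: f_def)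
  ultimately have "hanging_branch H ?Y"
    unfolding hanging_branch_def using branch_word_branch iso by blast
  moreover have "(vx (g \<cdot> w), c) \<in> arcs ?Y"
    if "reduced w" "(w = [] \<and> c = a) \<or> (w \<noteq> [] \<and> hd w = a)" for w c
  proof -
    have "w \<in> words_from a" "w \<cdot> [c] \<in> words_from a"
      using that words_from_letter[of w a c] by (auto simp: words_from_def)
    then show ?thesis unfolding arcsY by force
  qed
  ultimately show ?thesis using that by blast
qed

lemma hanging_word:
  assumes "reduced g" "hanging H (vx g) a" "reduced (a # w @ [c])"
  shows "hanging H (vx (g \<cdot> (a # w))) c"
  using assms(3)
proof (induction w arbitrary: c rule: rev_induct)
  case Nil
  then show ?case using hanging_step[OF assms(1) _ assms(2), of c] by simp
next
  case (snoc b w)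
  have r: "reduced (a # w @ [b])" "c \<noteq> linv b"
    using snoc.prems reduced_append_iff[of "a # w @ [b]" "[c]"] by auto
  have r': "reduced (a # w)" using r(1) reduced_append_iff[of "a # w" "[b]"] by simp
  have "hanging H (vx (g \<cdot> (a # w) \<cdot> [b])) c"
    using hanging_step[of "g \<cdot> (a # w)" c b] snoc.IH[OF r(1)] r(2) by simp
  moreover have "g \<cdot> (a # w) \<cdot> [b] = g \<cdot> (a # w @ [b])"
    using assms(1) r r' mul_append[of "a # w" "[b]"] by (simp add: mul_assoc)
  ultimately show ?case by simp
qed

text \<open>As labels are preserved, the isomorphism is determined by the image H g of the root r
  and sends r u to H g u. A non-trivial element k of g^-1 H g beginning with the root letter b would
  give r k and r the same image, so the first arc is hanging. Arcs further out inherit this, and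
  arcs towards the root are their reversals.\<close>

lemma hanging_branch_arcs:
  assumes Y: "hanging_branch H Y" and e: "e \<in> arcs Y"
  shows "\<exists>g a. reduced g \<and> e = (vx g, a) \<and> (hanging H (vx g) a \<or> hanging H (vx (g \<cdot> [a])) (linv a))"
proof -
  obtain B :: "('a fword, 'a fword \<times> 'a letter) pre_digraph" and f where
    subX: "sym_subgraph Y (schreier_graph H)" and B: "branch B" and
    iso: "pre_digraph.digraph_isomorphism B f" and Yf: "Y = app_iso f B" and
    lab: "\<And>e. e \<in> arcs B \<Longrightarrow> snd (iso_arcs f e) = snd e"
    using Y unfolding hanging_branch_def by blast
  have subC: "sym_subgraph B cayley_graph" and conn: "strongly_connected B" and
    "\<exists>r\<in>verts B. out_degree B r = 1 \<and> (\<forall>v\<in>verts B - {r}. out_degree B v = 2 * CARD('a))"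
    using B by (auto simp: branch_def sym_tree_def)
  then obtain r where r: "r \<in> verts B" "out_degree B r = 1"
    "\<And>v. v \<in> verts B \<Longrightarrow> v \<noteq> r \<Longrightarrow> out_degree B v = 2 * CARD('a)" by blast
  have tB: "tail B = fst" "head B = (\<lambda>(g, a). g \<cdot> [a])" and wfB: "wf_digraph B"
    and vB: "\<And>v. v \<in> verts B \<Longrightarrow> reduced v" and aB: "arcs B \<subseteq> verts B \<times> UNIV"
    using subC wf_digraph.tail_in_verts[of B]
    by (fastforce simp: sym_subgraph_def subgraph_def compatible_def cayley_graph_def)+
  have tY: "iso_tail f = fst" "iso_head f = (\<lambda>(x, a). x #>\<^bsub>free_group\<^esub> [a])"
    using subX Yf by (simp_all add: sym_subgraph_def subgraph_def compatible_def)
  have vY: "iso_verts f v \<in> rcosets\<^bsub>free_group\<^esub> H" if "v \<in> verts B" for v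
    using subX Yf that by (auto simp: sym_subgraph_def subgraph_def)
  have isoarc: "iso_arcs f (v, c) = (iso_verts f v, c)"
    "iso_verts f (v \<cdot> [c]) = iso_verts f v #>\<^bsub>free_group\<^esub> [c]"
    if vc: "(v, c) \<in> arcs B" for v c
  proof -
    have "iso_verts f v = fst (iso_arcs f (v, c))"
      "iso_verts f (v \<cdot> [c]) = (\<lambda>(x, a). x #>\<^bsub>free_group\<^esub> [a]) (iso_arcs f (v, c))"
      using pre_digraph.iso_verts_tail[OF iso vc] pre_digraph.iso_verts_head[OF iso vc]
      by (simp_all add: tB tY)
    then show "iso_arcs f (v, c) = (iso_verts f v, c)"
      "iso_verts f (v \<cdot> [c]) = iso_verts f v #>\<^bsub>free_group\<^esub> [c]"
      using lab[OF vc] by (auto simp: prod_eq_iff case_prod_beta)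
  qed
  \<comment> \<open>There are exactly \<open>2 * CARD('a)\<close> letters, so full degree means that
    every letter leaves v.\<close>
  have full: "(v, c) \<in> arcs B" if "v \<in> verts B" "v \<noteq> r" for v c
  proof -
    have "out_arcs B v \<subseteq> {v} \<times> UNIV" by (auto simp: tB)
    moreover have "card (out_arcs B v) = card ({v} \<times> (UNIV :: 'a letter set))"
      using r(3)[OF that] by (simp add: out_degree_def card_cartesian_product)
    ultimately have "out_arcs B v = {v} \<times> UNIV"
      by (intro card_subset_eq) (auto intro: finite_cartesian_product)
    then show ?thesis by (metis UNIV_I in_out_arcs_conv mem_Sigma_iff singletonI)
  qed
  obtain b where b: "\<And>c. (r, c) \<in> arcs B \<longleftrightarrow> c = b"
  proof -
    obtain e where "out_arcs B r = {e}" using r(2) by (auto simp: out_degree_def card_1_singleton_iff)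
    moreover from this have "fst e = r" using tB by (metis in_out_arcs_conv singletonI)
    ultimately have "(r, c) \<in> arcs B \<longleftrightarrow> c = snd e" for c
      using in_out_arcs_conv[of "(r, c)" B r] tB by (auto simp: prod_eq_iff)
    then show ?thesis using that by blast
  qed
  have rr: "reduced r" using vB r(1) by blast
  obtain g where g: "reduced g" "iso_verts f r = vx g" using vY[OF r(1)] verts_iff by blast
  have words: "r \<cdot> u \<in> verts B \<and> iso_verts f (r \<cdot> u) = vx (g \<cdot> u)" if "u \<in> words_from b" for u
    using that
  proof (induction u rule: rev_induct)
    case Nil
    then show ?case using r(1) rr g by simp
  next
    case (snoc c u)
    have u: "u \<in> words_from b" "reduced (u @ [c])" "reduced u" "u = [] \<Longrightarrow> c = b"
      using snoc.prems reduced_append_iff[of u "[c]"] by (cases u; simp add: words_from_def)+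
    have "(r \<cdot> u, c) \<in> arcs B"
    proof (cases "u = []")
      case True
      then show ?thesis using u(4) b rr by simp
    next
      case False
      then have "r \<cdot> u \<noteq> r" using rr u(3) by (metis mul_inv(2) mul_inv_cancel(2))
      then show ?thesis using full snoc.IH[OF u(1)] by blast
    qed
    note arc = this
    have uc: "r \<cdot> u \<cdot> [c] = r \<cdot> (u @ [c])" "g \<cdot> u \<cdot> [c] = g \<cdot> (u @ [c])"
      using rr g u by (simp_all add: mul_assoc mul_append)
    have "head B (r \<cdot> u, c) \<in> verts B" using wfB arc wf_digraph.head_in_verts by metis
    moreover have "iso_verts f (r \<cdot> u \<cdot> [c]) = vx (g \<cdot> u \<cdot> [c])"
      using isoarc(2)[OF arc] snoc.IH[OF u(1)] g(1) u(3) by (simp add: vx_mul)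
    ultimately show ?case by (simp add: tB uc)
  qed
  have hang: "hanging H (vx g) b"
    unfolding hanging_vx[OF g(1)]
  proof (intro allI impI notI)
    fix k assume k: "reduced k" "k \<noteq> []" "hd k = b" "g \<cdot> k \<cdot> iv g \<in> H"
    have "k \<in> words_from b" using k by (simp add: words_from_def)
    then have "r \<cdot> k \<in> verts B" "iso_verts f (r \<cdot> k) = iso_verts f r"
      using words g k by (auto simp: vx_eq_iff)
    then have "r \<cdot> k = r" using pre_digraph.iso_verts_eq_iff[OF iso _ r(1)] by blast
    then show False using rr k(1,2) by (metis mul_inv(2) mul_inv_cancel(2))
  qed
  \<comment> \<open>The root is left by the letter b only, so no walk in B escapes from the words
    beginning with b, and B is connected.\<close>
  have all: "\<exists>u\<in>words_from b. v = r \<cdot> u" if "v \<in> verts B" for v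
  proof -
    have "r \<rightarrow>\<^sup>*\<^bsub>B\<^esub> v" using conn r(1) that by (auto simp: strongly_connected_def)
    then show ?thesis
    proof (induction rule: wf_digraph.reachable_induct[OF wfB, consumes 1, case_names base step])
      case base
      then show ?case using rr by (intro bexI[of _ "[]"]) (simp_all add: words_from_def)
    next
      case (step x y)
      then obtain u c where u: "u \<in> words_from b" "x = r \<cdot> u" "(x, c) \<in> arcs B" "y = x \<cdot> [c]"
        by (auto simp: tB elim!: reachableE)
      have ru: "reduced u" using u(1) by (simp add: words_from_def)
      have "u \<noteq> [] \<or> c = b" using u(2,3) b rr by (metis mul_Nil(1))
      then have "u \<cdot> [c] \<in> words_from b" using words_from_letter[OF u(1)] by blast
      moreover have "y = r \<cdot> (u \<cdot> [c])" using u rr ru by (simp add: mul_assoc)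
      ultimately show ?case by blast
    qed
  qed
  obtain v c where vc: "(v, c) \<in> arcs B" "e = (iso_verts f v, c)"
    using e Yf isoarc(1) by auto
  obtain u where u: "u \<in> words_from b" "v = r \<cdot> u" using all vc(1) aB by blast
  have ru: "reduced u" using u(1) by (simp add: words_from_def)
  have e': "e = (vx (g \<cdot> u), c)" using vc(2) words u by simp
  show ?thesis
  proof (cases "u = []")
    case True
    then have "c = b" using vc(1) u(2) b rr by simp
    then show ?thesis using e' hang True g(1) by auto
  next
    case False
    then obtain u' where u': "u = b # u'" using u(1) by (cases u) (auto simp: words_from_def)
    show ?thesis
    proof (cases "last u = linv c")
      case c: False
      then have "reduced (u @ [c])" using ru by (simp add: reduced_append_iff) (metis linv_linv)
      then have "hanging H (vx (g \<cdot> u)) c" using hanging_word[OF g(1) hang] u' by simp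
      then show ?thesis using e' by (metis reduced_mul)
    next
      case True
      \<comment> \<open>The arc points towards the root; its reversal starts at
        \<open>butlast u\<close> and leads outwards.\<close>
      have red: "reduced (butlast u @ [linv c])" using ru True False by (metis append_butlast_last_id)
      have "u \<cdot> [c] = butlast u" using mul_letter[OF ru, of c] True False by simp
      then have guc: "g \<cdot> u \<cdot> [c] = g \<cdot> butlast u" using g(1) ru by (simp add: mul_assoc)
      have "hanging H (vx (g \<cdot> butlast u)) (linv c)"
      proof (cases u')
        case Nil
        then show ?thesis using hang True u' g(1) by simp
      next
        case (Cons d t)
        then have "butlast u = b # butlast u'" using u' by simp
        then show ?thesis using hanging_word[OF g(1) hang, of "butlast u'" "linv c"] red by simp
      qed
      then show ?thesis using e' guc by (metis reduced_mul)
    qed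
  qed
qed

text \<open>A hanging branch contains the reversal of each of its arcs, hence one condition for
  either direction.\<close>

lemma core_arcs_iff:
  assumes g: "reduced g"
  shows "(vx g, a) \<in> arcs (core H) \<longleftrightarrow>
    \<not> hanging H (vx g) a \<and> \<not> hanging H (vx (g \<cdot> [a])) (linv a)"
proof -
  have vert: "vx g \<in> rcosets\<^bsub>free_group\<^esub> H" using g verts_iff by blast
  have "(\<exists>Y. hanging_branch H Y \<and> (vx g, a) \<in> arcs Y) \<longleftrightarrow>
    hanging H (vx g) a \<or> hanging H (vx (g \<cdot> [a])) (linv a)" (is "?L \<longleftrightarrow> ?R")
  proof
    assume ?L
    then obtain g' where g': "reduced g'" "vx g = vx g'"
      "hanging H (vx g') a \<or> hanging H (vx (g' \<cdot> [a])) (linv a)"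
      using hanging_branch_arcs by blast
    then have "vx (g \<cdot> [a]) = vx (g' \<cdot> [a])" using g vx_mul[of _ "[a]"] by (metis reduced_simps(2))
    then show ?R using g' by simp
  next
    assume ?R
    then show ?L
    proof
      assume "hanging H (vx g) a"
      then obtain Y where "hanging_branch H Y" "(vx (g \<cdot> []), a) \<in> arcs Y"
        using hanging_branch_exists[OF g] by (metis reduced_simps(1))
      then show ?L using g by auto
    next
      assume "hanging H (vx (g \<cdot> [a])) (linv a)"
      then obtain Y where Y: "hanging_branch H Y" "(vx (g \<cdot> [a] \<cdot> []), linv a) \<in> arcs Y"
        using hanging_branch_exists[of "g \<cdot> [a]" "linv a"] by (metis reduced_simps(1) reduced_mul)
      then have "arc_rev (schreier_graph H) (vx (g \<cdot> [a]), linv a) \<in> arcs Y"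
        by (auto simp: hanging_branch_def sym_subgraph_def)
      moreover have "g \<cdot> [a] \<cdot> iv [a] = g" using g by (simp add: mul_assoc)
      then have "arc_rev (schreier_graph H) (vx (g \<cdot> [a]), linv a) = (vx g, a)"
        using g vx_mul[of "g \<cdot> [a]" "[linv a]"] by (simp add: arc_rev_def inv_eq)
      ultimately show ?L using Y(1) by auto
    qed
  qed
  then show ?thesis using vert by (auto simp: core_def)
qed

text \<open>\<Lambda> constrains the arcs in the direction of the ray, the core also their
  reversals; from some point on non-triviality of H settles the latter. Conversely a tail in the
  core suffices, since a hanging arc anywhere makes all later arcs hanging.\<close>

lemma limit_set_core:
  assumes \<omega>: "\<omega> \<in> boundary" and nontriv: "H \<noteq> {[]}"
  shows "\<omega> \<in> limit_set H \<longleftrightarrow> (\<forall>\<^sub>F n in sequentially. path \<omega> n \<in> arcs (core H))"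
proof -
  have core: "path \<omega> n \<in> arcs (core H) \<longleftrightarrow> \<not> hanging H (vx (ray_prefix \<omega> n)) (\<omega> n) \<and>
      \<not> hanging H (vx (ray_prefix \<omega> (Suc n))) (linv (\<omega> n))" for n
    using core_arcs_iff[of "ray_prefix \<omega> n" "\<omega> n"] \<omega> by (simp add: path_def ray_prefix_mul)
  show ?thesis
  proof
    assume "\<omega> \<in> limit_set H"
    then show "\<forall>\<^sub>F n in sequentially. path \<omega> n \<in> arcs (core H)"
      using limit_set_hanging[OF \<omega>] eventually_not_hanging_back[OF \<omega> nontriv] by (simp add: core)
  next
    assume "\<forall>\<^sub>F n in sequentially. path \<omega> n \<in> arcs (core H)"
    then obtain N where N: "\<And>n. n \<ge> N \<Longrightarrow> \<not> hanging H (vx (ray_prefix \<omega> n)) (\<omega> n)"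
      by (auto simp: core eventually_sequentially)
    have "\<not> hanging H (vx (ray_prefix \<omega> n)) (\<omega> n)" for n
      using N[of "max n N"] hanging_ray_mono[OF \<omega>, of n "max n N"] by auto
    then show "\<omega> \<in> limit_set H" using limit_set_hanging[OF \<omega>] by blast
  qed
qed

text \<open>Being reduced, the ray cannot turn back in the branch that a hanging arc opens.\<close>

lemma path_hanging_branch:
  assumes \<omega>: "\<omega> \<in> boundary" and "\<omega> \<notin> limit_set H"
  shows "\<exists>Y. hanging_branch H Y \<and> (\<forall>\<^sub>F n in sequentially. path \<omega> n \<in> arcs Y)"
proof -
  obtain n where "hanging H (vx (ray_prefix \<omega> n)) (\<omega> n)"
    using assms limit_set_hanging by blast
  then obtain Y where Y: "hanging_branch H Y"
    "\<And>w c. reduced w \<Longrightarrow> (w = [] \<and> c = \<omega> n) \<or> (w \<noteq> [] \<and> hd w = \<omega> n)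
       \<Longrightarrow> (vx (ray_prefix \<omega> n \<cdot> w), c) \<in> arcs Y"
    using hanging_branch_exists[of "ray_prefix \<omega> n"] \<omega> by (metis reduced_ray_prefix)
  have "path \<omega> (n + m) \<in> arcs Y" for m
  proof -
    let ?w = "ray_prefix (\<lambda>i. \<omega> (n + i)) m"
    have "?w = [] \<and> \<omega> (n + m) = \<omega> n \<or> ?w \<noteq> [] \<and> hd ?w = \<omega> n"
      by (cases m) (auto simp: ray_prefix_def upt_rec[of 0] simp del: upt_Suc)
    moreover have "ray_prefix \<omega> (n + m) = ray_prefix \<omega> n \<cdot> ?w"
      using mul_append[of "ray_prefix \<omega> n" ?w] reduced_ray_prefix[OF \<omega>, of "n + m"]
      by (simp add: ray_prefix_add)
    ultimately show ?thesis
      using Y(2)[of ?w "\<omega> (n + m)"] boundary_shift[OF \<omega>, of n] by (simp add: path_def)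
  qed
  then have "\<forall>\<^sub>F k in sequentially. path \<omega> k \<in> arcs Y"
    unfolding eventually_sequentially by (metis le_Suc_ex)
  with Y(1) show ?thesis by blast
qed

lemma hanging_branch_path:
  assumes \<omega>: "\<omega> \<in> boundary" and nontriv: "H \<noteq> {[]}"
    and Y: "hanging_branch H Y" "\<forall>\<^sub>F n in sequentially. path \<omega> n \<in> arcs Y"
  shows "\<omega> \<notin> limit_set H"
proof
  assume "\<omega> \<in> limit_set H"
  then have "\<forall>\<^sub>F n in sequentially. path \<omega> n \<in> arcs (core H)"
    using limit_set_core[OF \<omega> nontriv] by blast
  then have "\<forall>\<^sub>F n in sequentially. False"
    using Y(2) by eventually_elim (use Y(1) in \<open>auto simp: core_def\<close>)
  then show False by simp
qed

section \<open>Boundary points and paths from the origin\<close>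

lemma walk_end_ray_prefix: "\<omega> \<in> boundary \<Longrightarrow> walk_end H (ray_prefix \<omega> n) = vx (ray_prefix \<omega> n)"
  by (simp add: walk_end_H free_reduce_id)

lemma path_nb_rays:
  assumes "\<omega> \<in> boundary" shows "path \<omega> \<in> nb_rays (schreier_graph H) H"
proof -
  have "vx (ray_prefix \<omega> n) \<in> rcosets\<^bsub>free_group\<^esub> H" for n
    using assms verts_iff reduced_ray_prefix by blast
  moreover have "vx (ray_prefix \<omega> n) #>\<^bsub>free_group\<^esub> [\<omega> n] = vx (ray_prefix \<omega> (Suc n))" for n
    using assms by (simp add: vx_mul ray_prefix_mul)
  ultimately show ?thesis
    using assms by (auto simp: nb_rays_def path_def arc_rev_def boundary_def)
qed

lemma read_ray_path [simp]: "read_ray (path \<omega>) = \<omega>"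
  by (simp add: read_ray_def path_def)

lemma read_ray_image:
  "read_ray ` {p \<in> nb_rays (schreier_graph H) H. P p} = {\<omega> \<in> boundary. P (path \<omega>)}"
proof -
  note bij = bij_betw_read_ray[OF subgroup_H]
  have eq: "path (read_ray p) = p" if p: "p \<in> nb_rays (schreier_graph H) H" for p
  proof -
    have "read_ray p \<in> boundary" using bij p by (auto simp: bij_betw_def)
    then have "path (read_ray p) \<in> nb_rays (schreier_graph H) H" by (rule path_nb_rays)
    then show ?thesis using bij p by (metis bij_betw_imp_inj_on inj_onD read_ray_path)
  qed
  show ?thesis
  proof (intro equalityI subsetI)
    fix \<omega> assume "\<omega> \<in> read_ray ` {p \<in> nb_rays (schreier_graph H) H. P p}"
    then show "\<omega> \<in> {\<omega> \<in> boundary. P (path \<omega>)}" using bij eq by (auto simp: bij_betw_def)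
  next
    fix \<omega> assume "\<omega> \<in> {\<omega> \<in> boundary. P (path \<omega>)}"
    then show "\<omega> \<in> read_ray ` {p \<in> nb_rays (schreier_graph H) H. P p}"
      by (intro image_eqI[of _ _ "path \<omega>"]) (auto simp: path_nb_rays)
  qed
qed

end

section \<open>Walks in the spanning tree\<close>

lemma free_reduce_idem [simp]: "free_reduce (free_reduce u) = free_reduce u"
  by (simp add: free_reduce_id reduced_free_reduce)

lemma free_reduce_append_cong [simp]:
  "free_reduce (free_reduce u @ v) = free_reduce (u @ v)"
  "free_reduce (u @ free_reduce v) = free_reduce (u @ v)"
  by (simp_all add: free_reduce_append)

lemma free_reduce_middle: "free_reduce (u @ free_reduce v @ w) = free_reduce (u @ v @ w)"
  by (simp only: free_reduce_append free_reduce_idem)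

text \<open>A letter put in front is added or removes another one, so any cancellation makes the
  word strictly shorter. This forces the labels of shortest walks to be reduced.\<close>

lemma length_free_reduce: "free_reduce w = w \<or> length (free_reduce w) < length w"
proof (induction w)
  case (Cons a w)
  have "cons_red a v = a # v \<or> length (cons_red a v) < length v" for v
    by (cases v) auto
  from this[of "free_reduce w"] Cons show ?case
    unfolding free_reduce_Cons by (elim disjE) simp_all
qed simp

lemma reduced_overlap: "reduced (u @ v) \<Longrightarrow> reduced (v @ w) \<Longrightarrow> v \<noteq> [] \<Longrightarrow> reduced (u @ v @ w)"
  by (auto simp: reduced_append_iff)

text \<open>An arc is determined by its tail and its label, so a walk amounts to its first vertex
  and a word; walks are handled as words from here on.\<close>

lemma cas_iff_walk:
  assumes "tail G = fst" "head G = (\<lambda>(x, a). x #>\<^bsub>free_group\<^esub> [a])"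
  shows "pre_digraph.cas G x p y \<longleftrightarrow> p = walk x (map snd p) \<and> y = walk_end x (map snd p)"
proof (induction p arbitrary: x)
  case (Cons e p)
  then show ?case by (cases e) (auto simp: pre_digraph.cas.simps assms)
qed (auto simp: pre_digraph.cas.simps)

lemma awalk_verts_walk:
  assumes "tail G = fst" "head G = (\<lambda>(x, a). x #>\<^bsub>free_group\<^esub> [a])"
  shows "pre_digraph.awalk_verts G x (walk x w) = map (\<lambda>i. walk_end x (take i w)) [0..<Suc (length w)]"
proof (induction w arbitrary: x)
  case (Cons a w)
  have "[0..<Suc (length (a # w))] = 0 # map Suc [0..<Suc (length w)]"
    unfolding map_Suc_upt by (subst upt_conv_Cons) simp_all
  then show ?case using Cons by (simp add: pre_digraph.awalk_verts.simps assms comp_def del: upt_Suc)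
qed (simp add: pre_digraph.awalk_verts.simps)

locale schreier_tree = free_subgroup H for H :: "'a::finite fword set" +
  fixes T :: "('a fword set, 'a fword set \<times> 'a letter) pre_digraph"
  assumes tree: "geodesic_spanning_tree T (schreier_graph H) H"
begin

abbreviation V :: "'a fword set set" where
  "V \<equiv> rcosets\<^bsub>free_group\<^esub> H"

lemma T_simps [simp]:
  "tail T = fst" "head T = (\<lambda>(x, a). x #>\<^bsub>free_group\<^esub> [a])" "verts T = V"
  using tree by (simp_all add: geodesic_spanning_tree_def sym_subgraph_def subgraph_def
      spanning_def compatible_def)

lemma wf_T: "wf_digraph T"
  using tree by (simp add: geodesic_spanning_tree_def sym_subgraph_def subgraph_def)

lemma T_rev: "(x, a) \<in> arcs T \<Longrightarrow> (x #>\<^bsub>free_group\<^esub> [a], linv a) \<in> arcs T"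
  using tree by (auto simp: geodesic_spanning_tree_def sym_subgraph_def arc_rev_def)

lemma sym_tree_T: "sym_tree T"
  using tree by (simp add: geodesic_spanning_tree_def)

lemma step_back:
  assumes "x \<in> V" shows "x #>\<^bsub>free_group\<^esub> [a] #>\<^bsub>free_group\<^esub> [linv a] = x"
proof -
  have "[linv a] = iv [a]" by (simp add: inv_eq)
  with assms show ?thesis by (auto simp: verts_iff vx_mul mul_assoc)
qed

lemma step_vert: "x \<in> V \<Longrightarrow> x #>\<^bsub>free_group\<^esub> [a] \<in> V"
  using walk_end_verts[of x "[a]"] by simp

definition twalk :: "'a fword set \<Rightarrow> 'a fword \<Rightarrow> bool" where
  "twalk x w \<longleftrightarrow> set (walk x w) \<subseteq> arcs T"

lemma twalk_simps [simp]:
  "twalk x []" "twalk x (a # w) \<longleftrightarrow> (x, a) \<in> arcs T \<and> twalk (x #>\<^bsub>free_group\<^esub> [a]) w"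
  "twalk x (u @ v) \<longleftrightarrow> twalk x u \<and> twalk (walk_end x u) v"
  by (auto simp: twalk_def)

lemma awalk_T_iff:
  "pre_digraph.awalk T x p y \<longleftrightarrow> x \<in> V \<and> p = walk x (map snd p) \<and> twalk x (map snd p) \<and>
     y = walk_end x (map snd p)"
  unfolding pre_digraph.awalk_def cas_iff_walk[OF T_simps(1,2)] twalk_def by auto

text \<open>Strong induction on the length. A repeated vertex would cut out a shorter reduced closed
  walk, which is empty by induction. So the vertices are distinct, and a non-empty walk would be a
  cycle without backtracking.\<close>

lemma twalk_closed_Nil:
  "x \<in> V \<Longrightarrow> twalk x w \<Longrightarrow> reduced w \<Longrightarrow> walk_end x w = x \<Longrightarrow> w = []"
proof (induction "length w" arbitrary: x w rule: less_induct)
  case less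
  show ?case
  proof (rule ccontr)
    assume "w \<noteq> []"
    let ?f = "\<lambda>i. walk_end x (take i w)"
    have awalk: "pre_digraph.awalk T x (walk x w) x"
      unfolding awalk_T_iff using less.prems by simp
    have succ: "successively (\<lambda>e f. f \<noteq> arc_rev T e) (walk x w)"
    proof -
      have "successively (\<lambda>a b. b \<noteq> linv a) (map snd (walk x w))"
        using less.prems(3) by (simp add: reduced_def)
      then have "successively (\<lambda>e f. snd f \<noteq> linv (snd e)) (walk x w)"
        unfolding successively_map .
      then show ?thesis by (rule successively_mono) (auto simp: arc_rev_def)
    qed
    \<comment> \<open>The first vertex is left out because it is also the last; the notion of a
      cycle ignores it likewise.\<close>
    have "inj_on ?f {Suc 0..<Suc (length w)}"
    proof (rule ccontr)
      assume "\<not> inj_on ?f {Suc 0..<Suc (length w)}"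
      then obtain i j where ij: "0 < i" "i < j" "j \<le> length w" "?f i = ?f j"
        unfolding inj_on_def by (metis Suc_le_eq atLeastLessThan_iff less_Suc_eq_le linorder_neqE_nat)
      let ?u = "take (j - i) (drop i w)"
      have tj: "take j w = take i w @ ?u"
        using ij by (metis le_add_diff_inverse less_imp_le_nat take_add)
      have "twalk x (take j w @ drop j w)" using less.prems(2) by simp
      then have "twalk (?f i) ?u" unfolding tj by simp
      moreover have "walk_end (?f i) ?u = ?f i" using ij(4) tj by (metis walk_end_simps(3))
      moreover have "reduced ?u" using less.prems(3) by (intro reduced_take reduced_drop)
      moreover have "length ?u < length w" using ij by simp
      ultimately have "?u = []"
        using less.hyps[of ?u "?f i"] walk_end_verts[OF less.prems(1)] by blast
      then show False using ij by simp
    qed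
    then have "distinct (tl (pre_digraph.awalk_verts T x (walk x w)))"
      unfolding awalk_verts_walk[OF T_simps(1,2)]
      by (simp add: map_tl[symmetric] distinct_map del: upt_Suc)
    then have "pre_digraph.cycle T (walk x w)"
      unfolding pre_digraph.cycle_def using awalk \<open>w \<noteq> []\<close>
      by (metis length_0_conv length_walk)
    then show False using sym_tree_T succ unfolding sym_tree_def by blast
  qed
qed

lemma twalk_rev:
  assumes "x \<in> V" "twalk x u"
  shows "twalk (walk_end x u) (rev (map linv u)) \<and> walk_end (walk_end x u) (rev (map linv u)) = x"
  using assms
proof (induction u arbitrary: x)
  case (Cons a u)
  then show ?case
    using Cons.IH[of "x #>\<^bsub>free_group\<^esub> [a]"] step_vert T_rev step_back by auto
qed simp

text \<open>A cancellation removes a step together with its reversal, after which the walk is back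
  where it was.\<close>

lemma twalk_free_reduce: "x \<in> V \<Longrightarrow> twalk x u \<Longrightarrow> twalk x (free_reduce u)"
proof (induction u arbitrary: x)
  case (Cons a u)
  then have *: "(x, a) \<in> arcs T" "twalk (x #>\<^bsub>free_group\<^esub> [a]) (free_reduce u)"
    using step_vert by auto
  then show ?case
    using step_back[OF Cons.prems(1), of a] by (cases "free_reduce u") (auto simp: free_reduce_Cons)
qed simp

text \<open>Going back along u and then forth along v is a closed walk in T, so its label reduces to
  the empty word.\<close>

lemma twalk_unique:
  assumes "x \<in> V" "twalk x u" "twalk x v" "walk_end x u = walk_end x v"
  shows "free_reduce u = free_reduce v"
proof -
  let ?y = "walk_end x u" and ?w = "rev (map linv u) @ v"
  have y: "?y \<in> V" using assms(1) by (rule walk_end_verts)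
  have rev: "twalk ?y (rev (map linv u))" "walk_end ?y (rev (map linv u)) = x"
    using twalk_rev[OF assms(1,2)] by auto
  then have "twalk ?y ?w" "walk_end ?y ?w = ?y" using assms(3,4) by simp_all
  then have "free_reduce ?w = []"
    using twalk_closed_Nil[OF y, of "free_reduce ?w"] twalk_free_reduce[OF y]
      walk_end_free_reduce[OF y, of ?w] reduced_free_reduce by metis
  then have "iv (free_reduce u) \<cdot> free_reduce v = []"
    by (simp add: free_reduce_append free_reduce_rev_linv)
  then show ?thesis
    by (metis mul_Nil(1) mul_inv_cancel(1) reduced_free_reduce)
qed

lemma twalk_exists:
  assumes "x \<in> V" "y \<in> V" obtains w where "twalk x w" "walk_end x w = y"
proof -
  have "x \<rightarrow>\<^sup>*\<^bsub>T\<^esub> y"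
    using sym_tree_T assms by (auto simp: sym_tree_def strongly_connected_def)
  then obtain p where "pre_digraph.awalk T x p y"
    using wf_digraph.reachable_awalk[OF wf_T] by blast
  then show ?thesis using that unfolding awalk_T_iff by blast
qed

section \<open>Geodesics of the tree\<close>

definition seg :: "'a fword set \<Rightarrow> 'a fword set \<Rightarrow> 'a fword" where
  "seg x y = map snd (tree_geodesic T x y)"

text \<open>\<open>tree_geodesic\<close> is a definite description, so shortest walks must be shown
  unique. Their labels are reduced, for otherwise free reduction would yield a shorter walk in T,
  and reduced labels of walks in T with the same ends agree.\<close>

lemma seg:
  assumes x: "x \<in> V" and y: "y \<in> V"
  shows "reduced (seg x y)" "twalk x (seg x y)" "walk_end x (seg x y) = y"
    "length (seg x y) = graph_dist T x y"
proof -
  let ?P = "\<lambda>n. \<exists>p. pre_digraph.awalk T x p y \<and> length p = n"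
  have awalk: "pre_digraph.awalk T x (walk x w) y" if "twalk x w" "walk_end x w = y" for w
    using that x unfolding awalk_T_iff by simp
  obtain w0 where "twalk x w0" "walk_end x w0 = y" using twalk_exists[OF x y] by blast
  then have "?P (length w0)" using awalk length_walk by blast
  then have ex: "?P (graph_dist T x y)" unfolding graph_dist_def by (rule LeastI)
  have red: "reduced (map snd p)"
    if p: "pre_digraph.awalk T x p y" "length p = graph_dist T x y" for p
  proof -
    let ?w = "map snd p"
    have "twalk x ?w" "walk_end x ?w = y" using p(1) unfolding awalk_T_iff by auto
    then have "pre_digraph.awalk T x (walk x (free_reduce ?w)) y"
      using awalk twalk_free_reduce[OF x] walk_end_free_reduce[OF x] by metis
    then have "?P (length (free_reduce ?w))" using length_walk by blast
    then have "graph_dist T x y \<le> length (free_reduce ?w)"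
      unfolding graph_dist_def by (rule Least_le)
    then have "free_reduce ?w = ?w" using length_free_reduce[of ?w] p(2) by auto
    then show ?thesis using reduced_free_reduce by metis
  qed
  have uniq: "p = q" if p: "pre_digraph.awalk T x p y" "length p = graph_dist T x y"
    and q: "pre_digraph.awalk T x q y" "length q = graph_dist T x y" for p q
  proof -
    have "map snd p = map snd q"
      using twalk_unique[OF x, of "map snd p" "map snd q"] p q red[OF p] red[OF q]
      unfolding awalk_T_iff by (simp add: free_reduce_id)
    then show ?thesis using p(1) q(1) unfolding awalk_T_iff by metis
  qed
  obtain p where p: "pre_digraph.awalk T x p y" "length p = graph_dist T x y" using ex by blast
  have "tree_geodesic T x y = p"
    unfolding tree_geodesic_def
  proof (rule the_equality)
    fix q assume "pre_digraph.awalk T x q y \<and> length q = graph_dist T x y"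
    then show "q = p" using uniq[OF _ _ p, of q] by simp
  qed (simp add: p)
  with p have "pre_digraph.awalk T x (tree_geodesic T x y) y \<and> length (tree_geodesic T x y) = graph_dist T x y"
    by simp
  then show "reduced (seg x y)" "twalk x (seg x y)" "walk_end x (seg x y) = y"
    "length (seg x y) = graph_dist T x y"
    using red unfolding awalk_T_iff seg_def by auto
qed

lemma twalk_seg:
  assumes "x \<in> V" "twalk x w"
  shows "free_reduce w = seg x (walk_end x w)"
proof -
  have "walk_end x w \<in> V" using assms(1) by (rule walk_end_verts)
  note s = seg[OF assms(1) this]
  show ?thesis using twalk_unique[OF assms s(2)] s by (simp add: free_reduce_id)
qed

lemma reduced_twalk_seg: "x \<in> V \<Longrightarrow> twalk x w \<Longrightarrow> reduced w \<Longrightarrow> w = seg x (walk_end x w)"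
  using twalk_seg free_reduce_id by metis

lemma seg_self [simp]: "x \<in> V \<Longrightarrow> seg x x = []"
  using reduced_twalk_seg[of x "[]"] by simp

lemma seg_trans:
  assumes "x \<in> V" "y \<in> V" "z \<in> V"
  shows "free_reduce (seg x y @ seg y z) = seg x z"
  using assms twalk_seg[of x "seg x y @ seg y z"] by (simp add: seg)

text \<open>T contains the reversals of its arcs, so an arc outside T never reverses the last arc of
  a walk in T.\<close>

lemma reduced_snoc_off:
  assumes "x \<in> V" "reduced u" "twalk x u" "(walk_end x u, a) \<notin> arcs T"
  shows "reduced (u @ [a])"
proof (rule ccontr)
  assume "\<not> reduced (u @ [a])"
  then have "u \<noteq> []" "a = linv (last u)" using assms(2) by (auto simp: reduced_append_iff)
  then obtain v b where u: "u = v @ [b]" "a = linv b" by (metis append_butlast_last_id)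
  then have "(walk_end x v, b) \<in> arcs T" using assms(3) by simp
  then show False using T_rev assms(4) u by fastforce
qed

lemma reduced_Cons_off:
  assumes "x \<in> V" "(x, a) \<notin> arcs T" "reduced v" "twalk (x #>\<^bsub>free_group\<^esub> [a]) v"
  shows "reduced (a # v)"
proof (cases v)
  case (Cons b w)
  have "b \<noteq> linv a"
  proof
    assume b: "b = linv a"
    then have "(x #>\<^bsub>free_group\<^esub> [a], linv a) \<in> arcs T" using assms(4) Cons by simp
    from T_rev[OF this] show False using assms(2) step_back[OF assms(1)] by simp
  qed
  then show ?thesis using Cons assms(3) by simp
qed simp

section \<open>Schreier generators and the Schreier limit set\<close>

abbreviation off :: "('a fword set \<times> 'a letter) set" where
  "off \<equiv> off_tree_arcs H T"

abbreviation hd_arc :: "'a fword set \<times> 'a letter \<Rightarrow> 'a fword set" where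
  "hd_arc e \<equiv> fst e #>\<^bsub>free_group\<^esub> [snd e]"

lemma in_off_iff: "e \<in> off \<longleftrightarrow> fst e \<in> V \<and> e \<notin> arcs T"
  by (cases e) (auto simp: off_tree_arcs_def)

lemma off_verts [simp]: "e \<in> off \<Longrightarrow> fst e \<in> V" "e \<in> off \<Longrightarrow> hd_arc e \<in> V"
  by (auto simp: in_off_iff step_vert)

definition gen :: "'a fword set \<times> 'a letter \<Rightarrow> 'a fword" where
  "gen e = seg H (fst e) @ snd e # seg (hd_arc e) H"

lemma sigma_minus_seg: "sigma_minus H T e = seg H (fst e)"
  by (simp add: sigma_minus_def seg_def)

lemma schreier_generators_gen: "schreier_generators H T = gen ` off"
  unfolding schreier_generators_def
  by (rule image_cong) (auto simp: gen_def sigma_minus_def sigma_zero_def sigma_plus_def seg_def)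

lemma reduced_seg_off: "x \<in> V \<Longrightarrow> e \<in> off \<Longrightarrow> reduced (seg x (fst e) @ [snd e])"
  by (rule reduced_snoc_off[of x]) (auto simp: seg in_off_iff)

lemma reduced_off_seg: "e \<in> off \<Longrightarrow> x \<in> V \<Longrightarrow> reduced (snd e # seg (hd_arc e) x)"
  by (rule reduced_Cons_off[of "fst e"]) (auto simp: seg in_off_iff step_vert)

lemma reduced_gen: "e \<in> off \<Longrightarrow> reduced (gen e)"
  unfolding gen_def by (rule reduced_glue) (simp_all add: reduced_seg_off reduced_off_seg)

text \<open>Label of the walk from o that crosses the arcs \<open>e 0\<close>, \<open>e 1\<close>,
  ... in order, moves inside T between them, and stops right after crossing number n. It is the part
  of a product of generators that later factors do not cancel.\<close>

primrec crossing_word :: "(nat \<Rightarrow> 'a fword set \<times> 'a letter) \<Rightarrow> nat \<Rightarrow> 'a fword" where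
  "crossing_word e 0 = []"
| "crossing_word e (Suc n) =
    crossing_word e n @ seg (walk_end H (crossing_word e n)) (fst (e n)) @ [snd (e n)]"

abbreviation crossing_end :: "(nat \<Rightarrow> 'a fword set \<times> 'a letter) \<Rightarrow> nat \<Rightarrow> 'a fword set" where
  "crossing_end e n \<equiv> walk_end H (crossing_word e n)"

lemma crossing_end_vert [simp]: "crossing_end e n \<in> V"
  by (rule walk_end_verts) simp

lemma crossing_end_Suc: "e n \<in> off \<Longrightarrow> crossing_end e (Suc n) = hd_arc (e n)"
  by (simp add: seg)

text \<open>Each generator ends with the way home through T and the next one sets out from o through
  T; these two pieces merge into the direct tree segment between consecutive crossings.\<close>

lemma partial_product_gen:
  assumes "\<And>i. e i \<in> off"
  shows "partial_product (\<lambda>i. gen (e i)) n = free_reduce (crossing_word e n @ seg (crossing_end e n) H)"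
proof (induction n)
  case (Suc n)
  let ?x = "crossing_end e n" and ?u = "crossing_word e n"
  have "partial_product (\<lambda>i. gen (e i)) (Suc n) =
      free_reduce (?u @ (seg ?x H @ seg H (fst (e n))) @ snd (e n) # seg (hd_arc (e n)) H)"
    by (simp add: Suc mul_def) (simp add: gen_def)
  also have "\<dots> = free_reduce (?u @ free_reduce (seg ?x H @ seg H (fst (e n))) @ snd (e n) # seg (hd_arc (e n)) H)"
    by (simp only: free_reduce_middle)
  also have "\<dots> = free_reduce (?u @ seg ?x (fst (e n)) @ snd (e n) # seg (hd_arc (e n)) H)"
    using assms by (simp add: seg_trans)
  finally show ?case using crossing_end_Suc[of e n] assms by simp
qed simp

text \<open>A non-empty tree segment between two crossings cancels against neither of them. The end
  z is arbitrary because the induction step needs the tail of the next arc in this place.\<close>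

lemma crossing_word_reduced:
  assumes off: "\<And>i. e i \<in> off" and nb: "\<And>i. e (Suc i) \<noteq> arc_rev (schreier_graph H) (e i)" and "z \<in> V"
  shows "reduced (crossing_word e n @ seg (crossing_end e n) z)"
  using assms(3)
proof (induction n arbitrary: z)
  case 0
  then show ?case by (simp add: seg)
next
  case (Suc n)
  let ?x = "crossing_end e n" and ?u = "crossing_word e n"
  have IH: "reduced (?u @ seg ?x (fst (e n)))" using Suc.IH off by simp
  have "reduced (?u @ seg ?x (fst (e n)) @ [snd (e n)])"
  proof (cases "seg ?x (fst (e n)) = []")
    case False
    then show ?thesis using IH reduced_seg_off[of ?x "e n"] off by - (rule reduced_overlap, simp_all)
  next
    case True
    \<comment> \<open>No tree segment separates this crossing from the preceding one, so the
      assumption on reversals has to exclude cancellation.\<close>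
    then have x: "?x = fst (e n)" using seg(3)[of ?x "fst (e n)"] off by simp
    show ?thesis
    proof (cases n)
      case 0
      then show ?thesis using reduced_seg_off[of H "e 0"] off by simp
    next
      case (Suc m)
      then have "fst (e n) = hd_arc (e m)" using x crossing_end_Suc[of e m] off by simp
      then have "snd (e n) \<noteq> linv (snd (e m))"
        using nb[of m] Suc by (auto simp: arc_rev_def prod_eq_iff case_prod_beta)
      moreover have "last ?u = snd (e m)" using Suc by simp
      ultimately show ?thesis using IH True by (simp add: reduced_append_iff)
    qed
  qed
  then have "reduced ((?u @ seg ?x (fst (e n))) @ snd (e n) # seg (hd_arc (e n)) z)"
    using reduced_off_seg[OF off Suc.prems] by - (rule reduced_glue, simp_all)
  then show ?case using crossing_end_Suc[of e n] off by simp
qed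

lemma crossing_word_mono: "\<exists>v. crossing_word e (n + m) = crossing_word e n @ v"
  by (induction m) auto

lemma length_crossing_word: "n \<le> length (crossing_word e n)"
  by (induction n) auto

lemma partial_product_crossing:
  assumes "\<And>i. e i \<in> off" and "\<And>i. e (Suc i) \<noteq> arc_rev (schreier_graph H) (e i)"
  shows "partial_product (\<lambda>i. gen (e i)) n = crossing_word e n @ seg (crossing_end e n) H"
  using partial_product_gen[of e n] crossing_word_reduced[of e H n] assms by (simp add: free_reduce_id)

text \<open>In the product of the two, the way home and out again vanishes, then the letter meets
  its inverse, and at last the outer tree segments cancel.\<close>

lemma gen_arc_rev:
  assumes e: "e \<in> off"
  shows "arc_rev (schreier_graph H) e \<in> off" "gen (arc_rev (schreier_graph H) e) = iv (gen e)"
proof -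
  let ?x = "fst e" and ?y = "hd_arc e" and ?a = "snd e"
  have r: "arc_rev (schreier_graph H) e = (?y, linv ?a)" by (simp add: arc_rev_def case_prod_beta)
  show off: "arc_rev (schreier_graph H) e \<in> off"
    using e T_rev[of ?y "linv ?a"] step_back[of ?x ?a] by (auto simp: in_off_iff r)
  have "free_reduce (gen e @ gen (?y, linv ?a)) =
      free_reduce (seg H ?x @ [?a] @ (seg ?y H @ seg H ?y) @ [linv ?a] @ seg ?x H)"
    using step_back[of ?x ?a] e by (simp add: gen_def)
  also have "\<dots> = seg H ?x \<cdot> ([?a] \<cdot> (free_reduce (seg ?y H @ seg H ?y) \<cdot> ([linv ?a] \<cdot> seg ?x H)))"
    using e by (simp only: free_reduce_append free_reduce_idem) (simp add: free_reduce_id seg)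
  also have "\<dots> = seg H ?x \<cdot> ([?a] \<cdot> (iv [?a] \<cdot> seg ?x H))"
    using e by (simp add: seg_trans inv_eq)
  also have "\<dots> = seg H ?x \<cdot> seg ?x H" using e by (simp add: seg)
  also have "\<dots> = []" using e seg_trans[of H ?x H] by (simp add: mul_def)
  finally have "gen e \<cdot> gen (?y, linv ?a) = []" by (simp add: mul_def)
  then show "gen (arc_rev (schreier_graph H) e) = iv (gen e)"
    using reduced_gen[OF e] reduced_gen[OF off] r by (metis mul_Nil(1) mul_inv_cancel(2) reduced_inv)
qed

text \<open>The product of the two generators keeps both crossing letters and is not empty. With
  \<open>gen_arc_rev\<close>, reduced sequences of generators thus correspond to sequences of arcs
  in which no arc is followed by its reversal.\<close>

lemma gen_consecutive:
  assumes "e \<in> off" "e' \<in> off" "e' \<noteq> arc_rev (schreier_graph H) e"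
  shows "gen e' \<noteq> iv (gen e)"
proof
  assume eq: "gen e' = iv (gen e)"
  \<comment> \<open>Only the first two terms of this auxiliary sequence are used.\<close>
  have "reduced (crossing_word (\<lambda>i. if i = 0 then e else e') 2)" (is "reduced (crossing_word ?e 2)")
  proof -
    have x: "crossing_end ?e 1 = hd_arc e" using crossing_end_Suc[of ?e 0] assms(1) by simp
    have u: "crossing_word ?e 1 = seg H (fst e) @ [snd e]" by simp
    have two: "crossing_word ?e 2 = seg H (fst e) @ snd e # seg (hd_arc e) (fst e') @ [snd e']"
      using x u by (simp add: numeral_2_eq_2)
    have "reduced (snd e # seg (hd_arc e) (fst e') @ [snd e'])"
    proof (cases "seg (hd_arc e) (fst e') = []")
      case True
      then have "hd_arc e = fst e'" using seg(3)[of "hd_arc e" "fst e'"] assms by simp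
      then have "snd e' \<noteq> linv (snd e)"
        using assms(3) by (auto simp: arc_rev_def prod_eq_iff case_prod_beta)
      then show ?thesis using True by simp
    next
      case False
      then show ?thesis
        using reduced_overlap[of "[snd e]" "seg (hd_arc e) (fst e')" "[snd e']"]
          reduced_off_seg[of e "fst e'"] reduced_seg_off[of "hd_arc e" e'] assms by simp
    qed
    then show ?thesis unfolding two using reduced_seg_off[of H e] assms by - (rule reduced_glue, simp_all)
  qed
  note red2 = this
  have off: "?e i \<in> off" for i using assms by simp
  have x2: "crossing_end ?e 2 = hd_arc e'"
    using crossing_end_Suc[of ?e 1] assms by (simp add: numeral_2_eq_2)
  have "last (crossing_word ?e 2) = snd e'" "crossing_word ?e 2 \<noteq> []" by (simp_all add: numeral_2_eq_2)
  then have "reduced (butlast (crossing_word ?e 2) @ snd e' # seg (hd_arc e') H)"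
    using red2 reduced_off_seg[of e' H] assms(2) by - (rule reduced_glue, (metis append_butlast_last_id H_vert)+)
  then have "reduced (crossing_word ?e 2 @ seg (hd_arc e') H)"
    using \<open>last (crossing_word ?e 2) = snd e'\<close> \<open>crossing_word ?e 2 \<noteq> []\<close>
    by (metis append.assoc append_Cons append_Nil append_butlast_last_id)
  then have "partial_product (\<lambda>i. gen (?e i)) 2 = crossing_word ?e 2 @ seg (hd_arc e') H"
    using partial_product_gen[of ?e 2, OF off] x2 by (simp add: free_reduce_id)
  moreover have "partial_product (\<lambda>i. gen (?e i)) 2 = gen e \<cdot> gen e'"
    using reduced_gen[OF assms(1)] by (simp add: numeral_2_eq_2)
  ultimately show False using eq reduced_gen[OF assms(1)] \<open>crossing_word ?e 2 \<noteq> []\<close> by simp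
qed

section \<open>Rays that leave the tree infinitely often\<close>

lemma path_eq: "\<omega> \<in> boundary \<Longrightarrow> path \<omega> n = (walk_end H (ray_prefix \<omega> n), \<omega> n)"
  by (simp add: path_def walk_end_ray_prefix)

lemma path_vert: "\<omega> \<in> boundary \<Longrightarrow> walk_end H (ray_prefix \<omega> n) \<in> V"
  by (rule walk_end_verts) simp

lemma twalk_path:
  assumes "\<omega> \<in> boundary"
  shows "twalk (walk_end H (ray_prefix \<omega> n)) (ray_prefix (\<lambda>i. \<omega> (n + i)) m) \<longleftrightarrow>
    (\<forall>i<m. path \<omega> (n + i) \<in> arcs T)"
proof (induction m)
  case (Suc m)
  have "walk_end (walk_end H (ray_prefix \<omega> n)) (ray_prefix (\<lambda>i. \<omega> (n + i)) m) = walk_end H (ray_prefix \<omega> (n + m))"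
    by (simp add: ray_prefix_add)
  then show ?case
    using Suc by (auto simp: ray_prefix_Suc path_eq[OF assms] less_Suc_eq)
qed simp

text \<open>A crossing word is a prefix of every later partial product and hence of the limit, which
  therefore crosses all arcs of the sequence one after the other.\<close>

lemma schreier_limit_set_crosses:
  assumes "\<omega> \<in> schreier_limit_set H T"
  shows "\<exists>n\<ge>N. path \<omega> n \<notin> arcs T"
proof -
  obtain \<xi> where \<omega>: "\<omega> \<in> boundary" and \<xi>: "\<And>i. \<xi> i \<in> gen ` off" "\<And>i. \<xi> (Suc i) \<noteq> iv (\<xi> i)"
    and conv: "converges_to (partial_product \<xi>) \<omega>"
    using assms by (auto simp: schreier_limit_set_def schreier_generators_gen)
  have "\<forall>i. \<exists>e. e \<in> off \<and> \<xi> i = gen e" using \<xi>(1) by blast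
  from choice[OF this] obtain e where "\<forall>i. e i \<in> off \<and> \<xi> i = gen (e i)" ..
  then have e: "\<And>i. e i \<in> off" "\<And>i. \<xi> i = gen (e i)" by simp_all
  then have \<xi>e: "\<xi> = (\<lambda>i. gen (e i))" by auto
  have nb: "e (Suc i) \<noteq> arc_rev (schreier_graph H) (e i)" for i
    using \<xi>(2)[of i] gen_arc_rev(2)[OF e(1)] e(2) by metis
  have pp: "partial_product \<xi> n = crossing_word e n @ seg (crossing_end e n) H" for n
    unfolding \<xi>e using partial_product_crossing[of e n] e(1) nb by blast
  have "reduced (partial_product \<xi> n)" for n
    by (cases n) simp_all
  then have lim: "\<forall>\<^sub>F n in sequentially. i < length (partial_product \<xi> n) \<and> partial_product \<xi> n ! i = \<omega> i" for i
    using conv limitin_compactification[of "partial_product \<xi>" \<omega>] \<omega> by simp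
  have pre: "crossing_word e n = ray_prefix \<omega> (length (crossing_word e n))" for n
  proof (rule eq_ray_prefixI)
    fix i assume i: "i < length (crossing_word e n)"
    obtain M where M: "\<And>m. m \<ge> M \<Longrightarrow> partial_product \<xi> m ! i = \<omega> i"
      using lim[of i] by (auto simp: eventually_sequentially)
    obtain v where "crossing_word e (n + M) = crossing_word e n @ v" using crossing_word_mono by blast
    then show "crossing_word e n ! i = \<omega> i" using M[of "n + M"] i by (simp add: pp nth_append)
  qed simp
  \<comment> \<open>The prefix just before \<open>e N\<close> is crossed; its length is at least N,
    since each earlier crossing contributes a letter.\<close>
  let ?u = "crossing_word e N @ seg (crossing_end e N) (fst (e N))"
  have "ray_prefix \<omega> (Suc (length ?u)) = ?u @ [snd (e N)]"
    using pre[of "Suc N"] by simp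
  then have "ray_prefix \<omega> (length ?u) = ?u" "\<omega> (length ?u) = snd (e N)"
    unfolding ray_prefix_Suc by simp_all
  moreover have "walk_end H ?u = fst (e N)" using seg(3)[of "crossing_end e N" "fst (e N)"] e(1) by simp
  ultimately have "path \<omega> (length ?u) = e N" by (simp add: path_eq[OF \<omega>])
  moreover have "N \<le> length ?u" using length_crossing_word[of N e] by simp
  ultimately show ?thesis using e(1)[of N] by (metis in_off_iff)
qed

text \<open>The ray is cut at its crossing times. Between them it is a reduced walk in T, that is a
  \<open>seg\<close>, so its prefixes are the crossing words of the arcs that it crosses.\<close>

lemma crosses_schreier_limit_set:
  assumes \<omega>: "\<omega> \<in> boundary" and cross: "\<And>N. \<exists>n\<ge>N. path \<omega> n \<notin> arcs T"
  shows "\<omega> \<in> schreier_limit_set H T"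
proof -
  let ?S = "{n. path \<omega> n \<notin> arcs T}"
  have inf: "infinite ?S" using cross by (simp add: infinite_nat_iff_unbounded_le)
  define t where "t = enumerate ?S"
  have tS: "path \<omega> (t n) \<notin> arcs T" for n using enumerate_in_set[OF inf, of n] by (simp add: t_def)
  have tmono: "t n < t (Suc n)" for n using enumerate_step[OF inf] by (simp add: t_def)
  \<comment> \<open>\<open>t n\<close> is the time of crossing number n, counted from 0, and
    \<open>s n\<close> the time just after the preceding crossing; the first stretch starts at
    0.\<close>
  define s where "s n = (case n of 0 \<Rightarrow> 0 | Suc m \<Rightarrow> Suc (t m))" for n
  have st: "s n \<le> t n" for n using tmono by (cases n) (auto simp: s_def Suc_le_eq)
  have between: "path \<omega> k \<in> arcs T" if "s n \<le> k" "k < t n" for n k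
  proof (cases n)
    case 0
    then show ?thesis using that not_less_Least[of k "\<lambda>k. k \<in> ?S"] by (auto simp: t_def enumerate_0)
  next
    case (Suc m)
    have "t n = (LEAST k. k \<in> ?S \<and> t m < k)" unfolding t_def Suc by (rule enumerate_Suc''[OF inf])
    then show ?thesis using that not_less_Least[of k "\<lambda>k. k \<in> ?S \<and> t m < k"] Suc by (auto simp: s_def)
  qed
  define e where "e n = path \<omega> (t n)" for n
  have e_off: "e n \<in> off" for n
    using tS path_vert[OF \<omega>] by (simp add: e_def in_off_iff path_eq[OF \<omega>])
  have seg_e: "seg (walk_end H (ray_prefix \<omega> (s n))) (fst (e n)) = ray_prefix (\<lambda>i. \<omega> (s n + i)) (t n - s n)" for n
  proof -
    let ?w = "ray_prefix (\<lambda>i. \<omega> (s n + i)) (t n - s n)" and ?x = "walk_end H (ray_prefix \<omega> (s n))"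
    have "twalk ?x ?w" unfolding twalk_path[OF \<omega>] by (intro allI impI between[of n]) auto
    moreover have "reduced ?w" using boundary_shift[OF \<omega>] by simp
    moreover have "walk_end ?x ?w = fst (e n)"
      using st[of n] ray_prefix_add[of \<omega> "s n" "t n - s n"] by (simp add: e_def path_eq[OF \<omega>])
    ultimately show ?thesis using reduced_twalk_seg path_vert[OF \<omega>] by metis
  qed
  have cw: "crossing_word e n = ray_prefix \<omega> (s n)" for n
  proof (induction n)
    case (Suc n)
    have "ray_prefix \<omega> (t n) = ray_prefix \<omega> (s n) @ ray_prefix (\<lambda>i. \<omega> (s n + i)) (t n - s n)"
      using st[of n] ray_prefix_add[of \<omega> "s n" "t n - s n"] by simp
    then show ?case using Suc seg_e[of n] by (simp add: s_def ray_prefix_Suc) (simp add: e_def path_def)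
  qed (simp add: s_def)
  \<comment> \<open>If an arc were followed by its reversal, the reduced tree walk between them
    would be closed, hence empty, and the ray itself would backtrack.\<close>
  have nb: "e (Suc n) \<noteq> arc_rev (schreier_graph H) (e n)" for n
  proof
    assume rev: "e (Suc n) = arc_rev (schreier_graph H) (e n)"
    then have "fst (e (Suc n)) = hd_arc (e n)" "snd (e (Suc n)) = linv (snd (e n))"
      by (simp_all add: arc_rev_def case_prod_beta)
    moreover have "hd_arc (e n) = walk_end H (ray_prefix \<omega> (s (Suc n)))"
      by (simp add: e_def path_eq[OF \<omega>] s_def ray_prefix_Suc)
    ultimately have "ray_prefix (\<lambda>i. \<omega> (s (Suc n) + i)) (t (Suc n) - s (Suc n)) = []"
      using seg_e[of "Suc n"] path_vert[OF \<omega>] by simp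
    then have "t (Suc n) - s (Suc n) = 0" by (metis length_0_conv length_ray_prefix)
    then have "t (Suc n) = Suc (t n)" using st[of "Suc n"] by (simp add: s_def)
    then have "\<omega> (Suc (t n)) = linv (\<omega> (t n))"
      using \<open>snd (e (Suc n)) = linv (snd (e n))\<close> by (simp add: e_def path_def)
    then show False using \<omega> by (simp add: boundary_def)
  qed
  let ?\<xi> = "\<lambda>i. gen (e i)"
  have pp: "partial_product ?\<xi> n = ray_prefix \<omega> (s n) @ seg (crossing_end e n) H" for n
    using partial_product_crossing[of e n] e_off nb cw by simp
  have "reduced (partial_product ?\<xi> n)" for n by (cases n) simp_all
  moreover have "\<forall>\<^sub>F n in sequentially. i < length (partial_product ?\<xi> n) \<and> partial_product ?\<xi> n ! i = \<omega> i" for i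
  proof -
    have "i < s n" if "n > i" for n
      using length_crossing_word[of n e] that by (simp add: cw)
    then have "i < length (partial_product ?\<xi> n) \<and> partial_product ?\<xi> n ! i = \<omega> i" if "n > i" for n
      unfolding pp using that by (simp add: nth_append trans_less_add1)
    then show ?thesis unfolding eventually_sequentially by (intro exI[of _ "Suc i"]) (simp add: Suc_le_eq)
  qed
  ultimately have "converges_to (partial_product ?\<xi>) \<omega>"
    using limitin_compactification[of "partial_product ?\<xi>" \<omega>] \<omega> by simp
  moreover have "?\<xi> i \<in> schreier_generators H T \<and> ?\<xi> (Suc i) \<noteq> iv (?\<xi> i)" for i
    using gen_consecutive e_off nb by (auto simp: schreier_generators_gen)
  ultimately show ?thesis
    using \<omega> unfolding schreier_limit_set_def by (intro CollectI conjI exI[of _ ?\<xi>]) simp_all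
qed

lemma in_schreier_limit_set_iff:
  "\<omega> \<in> schreier_limit_set H T \<longleftrightarrow> \<omega> \<in> boundary \<and> (\<forall>N. \<exists>n\<ge>N. path \<omega> n \<notin> arcs T)"
  using schreier_limit_set_crosses crosses_schreier_limit_set
  by (auto simp: schreier_limit_set_def)

end

section \<open>The Schreier fundamental domain\<close>

context schreier_tree
begin

lemma in_H_iff: "reduced w \<Longrightarrow> w \<in> H \<longleftrightarrow> walk_end H w = H"
  using vx_eq_H_iff[of w] by (simp add: walk_end_H free_reduce_id)

text \<open>Going home through T after crossing an arc outside T causes no cancellation, so the word
  read so far is a prefix of an element of H.\<close>

lemma off_extension:
  assumes "reduced (u @ [a])" "(walk_end H u, a) \<in> off"
  shows "u @ a # seg (walk_end H (u @ [a])) H \<in> H"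
proof -
  have "reduced (a # seg (walk_end H (u @ [a])) H)"
    using reduced_off_seg[OF assms(2), of H] by simp
  then have "reduced (u @ a # seg (walk_end H (u @ [a])) H)"
    using assms(1) by - (rule reduced_glue)
  moreover have "walk_end H (u @ [a]) \<in> V" by (rule walk_end_verts) simp
  ultimately show ?thesis
    using seg(3)[of "walk_end H (u @ [a])" H] by (simp add: in_H_iff)
qed

lemma crossing_extension:
  assumes \<omega>: "\<omega> \<in> boundary" and "path \<omega> m \<notin> arcs T"
  shows "\<exists>h\<in>H. Suc m \<le> length h \<and> take (Suc m) h = ray_prefix \<omega> (Suc m)"
proof -
  let ?u = "ray_prefix \<omega> m"
  let ?h = "?u @ \<omega> m # seg (walk_end H (?u @ [\<omega> m])) H"
  have "?h \<in> H"
    using off_extension[of ?u "\<omega> m"] reduced_ray_prefix[OF \<omega>, of "Suc m"] assms(2) path_vert[OF \<omega>]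
    by (simp add: ray_prefix_Suc in_off_iff path_eq[OF \<omega>])
  then show ?thesis by (intro bexI[of _ ?h]) (simp_all add: ray_prefix_Suc)
qed

lemma limit_set_extension:
  assumes "\<omega> \<in> boundary" "\<And>n. \<exists>m\<ge>n. \<exists>h\<in>H. m \<le> length h \<and> take m h = ray_prefix \<omega> m"
  shows "\<omega> \<in> limit_set H"
  unfolding limit_set_iff
proof (intro conjI allI)
  fix n
  obtain m h where "n \<le> m" "h \<in> H" "m \<le> length h" "take m h = ray_prefix \<omega> m" using assms(2) by blast
  then have "take n h = ray_prefix \<omega> n" using take_ray_prefix_eq by blast
  then show "\<exists>h\<in>H. n \<le> length h \<and> take n h = ray_prefix \<omega> n"
    using \<open>n \<le> m\<close> \<open>h \<in> H\<close> \<open>m \<le> length h\<close> by (intro bexI[of _ h]) simp_all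
qed (rule assms(1))

lemma schreier_limit_set_subset: "schreier_limit_set H T \<subseteq> limit_set H"
proof
  fix \<omega> assume "\<omega> \<in> schreier_limit_set H T"
  then have \<omega>: "\<omega> \<in> boundary" and cross: "\<And>N. \<exists>n\<ge>N. path \<omega> n \<notin> arcs T"
    unfolding in_schreier_limit_set_iff by simp_all
  show "\<omega> \<in> limit_set H"
  proof (rule limit_set_extension[OF \<omega>])
    fix n
    obtain m where m: "m \<ge> n" "path \<omega> m \<notin> arcs T" using cross by blast
    then show "\<exists>m\<ge>n. \<exists>h\<in>H. m \<le> length h \<and> take m h = ray_prefix \<omega> m"
      using crossing_extension[OF \<omega> m(2)] by (intro exI[of _ "Suc m"]) simp
  qed
qed

text \<open>Up to its first crossing the ray is a reduced walk in T, so the word read until then is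
  \<open>sigma_minus\<close> of the crossed arc.\<close>

lemma in_schreier_domain_iff:
  "\<omega> \<in> schreier_domain H T \<longleftrightarrow> \<omega> \<in> boundary \<and> (\<forall>n. path \<omega> n \<in> arcs T)"
proof (cases "\<omega> \<in> boundary")
  case \<omega>: True
  have "(\<exists>e\<in>off. begins_with \<omega> (seg H (fst e) @ [snd e])) \<longleftrightarrow> (\<exists>n. path \<omega> n \<notin> arcs T)"
  proof
    assume "\<exists>e\<in>off. begins_with \<omega> (seg H (fst e) @ [snd e])"
    then obtain e where e: "e \<in> off" "begins_with \<omega> (seg H (fst e) @ [snd e])" by blast
    let ?l = "length (seg H (fst e))"
    have "ray_prefix \<omega> (Suc ?l) = seg H (fst e) @ [snd e]" using e(2) by (simp add: begins_with_iff)
    then have "path \<omega> ?l = e"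
      using seg(3)[of H "fst e"] e(1) by (simp add: ray_prefix_Suc path_eq[OF \<omega>])
    then show "\<exists>n. path \<omega> n \<notin> arcs T" using e(1) in_off_iff by metis
  next
    assume "\<exists>n. path \<omega> n \<notin> arcs T"
    then obtain n where n: "path \<omega> n \<notin> arcs T" "\<And>i. i < n \<Longrightarrow> path \<omega> i \<in> arcs T"
      using exists_least_iff[of "\<lambda>n. path \<omega> n \<notin> arcs T"] by blast
    have "twalk H (ray_prefix \<omega> n)" using twalk_path[OF \<omega>, of 0 n] n(2) by simp
    then have "seg H (fst (path \<omega> n)) = ray_prefix \<omega> n"
      using reduced_twalk_seg[of H "ray_prefix \<omega> n"] \<omega> by (simp add: path_eq)
    then have "begins_with \<omega> (seg H (fst (path \<omega> n)) @ [snd (path \<omega> n)])"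
      by (simp add: begins_with_iff ray_prefix_Suc path_def)
    moreover have "path \<omega> n \<in> off" using n(1) path_vert[OF \<omega>] by (simp add: in_off_iff path_eq[OF \<omega>])
    ultimately show "\<exists>e\<in>off. begins_with \<omega> (seg H (fst e) @ [snd e])" by blast
  qed
  then show ?thesis using \<omega> by (auto simp: schreier_domain_def sigma_minus_seg sigma_zero_def)
qed (simp add: schreier_domain_def)

lemma in_Theta_iff:
  "\<omega> \<in> Theta H T \<longleftrightarrow> \<omega> \<in> boundary \<and> (\<forall>n. path \<omega> n \<in> arcs T) \<and> \<omega> \<notin> limit_set H"
  by (auto simp: Theta_def in_schreier_domain_iff)

lemma Theta_paths:
  assumes "H \<noteq> {[]}"
  shows "Theta H T = read_ray ` {p \<in> nb_rays (schreier_graph H) H. (\<forall>n. p n \<in> arcs T) \<and>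
    (\<exists>Y. hanging_branch H Y \<and> (\<forall>\<^sub>F n in sequentially. p n \<in> arcs Y))}"
  unfolding read_ray_image
  using path_hanging_branch hanging_branch_path[OF _ assms] in_Theta_iff by blast

text \<open>H h w = H w for h in H, so a ray and its translate have the same path in X up to finite
  initial pieces.\<close>

lemma path_act:
  assumes "h \<in> H" and \<omega>: "\<omega> \<in> boundary"
  obtains l n where "\<And>m. path (boundary_act h \<omega>) (l + m) = path \<omega> (n + m)"
proof -
  have h: "reduced h" using assms(1) by simp
  obtain l n where ln: "\<And>m. ray_prefix (boundary_act h \<omega>) (l + m) = h \<cdot> ray_prefix \<omega> (n + m)"
    "\<And>m. boundary_act h \<omega> (l + m) = \<omega> (n + m)"
    by (rule boundary_act_prefix[OF h \<omega>]) (rule that)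
  have "vx (h \<cdot> w) = vx w" if "reduced w" for w
    using that h assms(1) by (simp add: vx_eq_iff mul_assoc)
  then have "path (boundary_act h \<omega>) (l + m) = path \<omega> (n + m)" for m
    using \<omega> by (simp add: path_def ln)
  then show ?thesis by (rule that)
qed

text \<open>Hanging arcs are followed by hanging arcs, so any tail decides membership in \<Lambda>;
  by \<open>path_act\<close> this makes \<Lambda> invariant under H.\<close>

lemma limit_set_tail:
  assumes "\<omega> \<in> boundary"
  shows "\<omega> \<in> limit_set H \<longleftrightarrow> (\<forall>m. \<not> hanging H (fst (path \<omega> (N + m))) (snd (path \<omega> (N + m))))"
  unfolding limit_set_hanging[OF assms] path_def fst_conv snd_conv
  using hanging_ray_mono[OF assms] le_add2 by metis

lemma limit_set_act:
  assumes "h \<in> H" and \<omega>: "\<omega> \<in> boundary"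
  shows "boundary_act h \<omega> \<in> limit_set H \<longleftrightarrow> \<omega> \<in> limit_set H"
proof -
  obtain l n where ln: "\<And>m. path (boundary_act h \<omega>) (l + m) = path \<omega> (n + m)"
    by (rule path_act[OF assms]) (rule that)
  show ?thesis
    unfolding limit_set_tail[OF \<omega>, of n] limit_set_tail[OF boundary_act_boundary[OF \<omega>], of h l] ln ..
qed

text \<open>Let u be a prefix after which the ray stays in T, and s the tree word to the vertex
  where u ends. Then h = s u^-1 lies in H and replaces u by s, so the prefixes of the translate are
  free reductions of walks in T.\<close>

lemma translate_into_domain:
  assumes \<omega>: "\<omega> \<in> boundary" and "\<omega> \<notin> schreier_limit_set H T"
  obtains h where "h \<in> H" "boundary_act h \<omega> \<in> schreier_domain H T"
proof -
  obtain N where N: "\<And>n. n \<ge> N \<Longrightarrow> path \<omega> n \<in> arcs T"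
    using assms unfolding in_schreier_limit_set_iff by blast
  let ?u = "ray_prefix \<omega> N"
  let ?x = "walk_end H ?u"
  let ?s = "seg H ?x"
  have x: "?x \<in> V" using path_vert[OF \<omega>] .
  have s: "reduced ?s" "twalk H ?s" "walk_end H ?s = ?x" using seg[OF H_vert x] by auto
  define h where "h = ?s \<cdot> iv ?u"
  have hr: "reduced h" by (simp add: h_def)
  have "vx ?s = vx ?u" using s \<omega> walk_end_H[of ?s] by (simp add: free_reduce_id walk_end_ray_prefix)
  then have hH: "h \<in> H" using s(1) \<omega> by (simp add: h_def vx_eq_iff)
  have long: "twalk H (h \<cdot> ray_prefix \<omega> (N + m))" for m
  proof -
    let ?w = "ray_prefix (\<lambda>i. \<omega> (N + i)) m"
    have "twalk ?x ?w" unfolding twalk_path[OF \<omega>] using N by simp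
    then have "twalk H (free_reduce (?s @ ?w))" using s by (intro twalk_free_reduce) simp_all
    moreover have "ray_prefix \<omega> (N + m) = ?u \<cdot> ?w"
      using mul_append[of ?u ?w] reduced_ray_prefix[OF \<omega>, of "N + m"] by (simp add: ray_prefix_add)
    then have "h \<cdot> ray_prefix \<omega> (N + m) = ?s \<cdot> ?w"
      using s(1) \<omega> boundary_shift[OF \<omega>, of N] by (simp add: h_def mul_assoc)
    ultimately show ?thesis by (simp add: mul_def)
  qed
  let ?\<omega>' = "boundary_act h \<omega>"
  have \<omega>': "?\<omega>' \<in> boundary" using \<omega> by (rule boundary_act_boundary)
  obtain l n where ln: "\<And>m. ray_prefix ?\<omega>' (l + m) = h \<cdot> ray_prefix \<omega> (n + m)"
    and "\<And>m. ?\<omega>' (l + m) = \<omega> (n + m)"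
    by (rule boundary_act_prefix[OF hr \<omega>]) (rule that)
  have "path ?\<omega>' k \<in> arcs T" for k
  proof -
    \<comment> \<open>The prefixes of the translate are known from length l on; this one is long
      enough to contain step k.\<close>
    have "ray_prefix ?\<omega>' (l + (N + Suc k)) = h \<cdot> ray_prefix \<omega> (N + (n + Suc k))"
      using ln[of "N + Suc k"] by (simp add: ac_simps)
    then have "twalk H (ray_prefix ?\<omega>' (0 + (l + (N + Suc k))))" using long[of "n + Suc k"] by simp
    then show ?thesis using twalk_path[OF \<omega>', of 0 "l + (N + Suc k)"] by simp
  qed
  then have "?\<omega>' \<in> schreier_domain H T" using \<omega>' in_schreier_domain_iff by blast
  then show ?thesis using that hH by blast
qed

text \<open>For a suitable prefix w of \<omega>, both w and h w are reduced tree words from o, and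
  they end at the same vertex. Uniqueness gives h w = w.\<close>

lemma domain_translates_disjoint:
  assumes "\<omega> \<in> schreier_domain H T" "boundary_act h \<omega> \<in> schreier_domain H T" "h \<in> H"
  shows "h = []"
proof -
  let ?\<omega>' = "boundary_act h \<omega>"
  have \<omega>: "\<omega> \<in> boundary" "?\<omega>' \<in> boundary" and arcs: "\<And>n. path \<omega> n \<in> arcs T" "\<And>n. path ?\<omega>' n \<in> arcs T"
    using assms in_schreier_domain_iff by auto
  have h: "reduced h" using assms(3) by simp
  obtain l n where ln: "\<And>m. ray_prefix ?\<omega>' (l + m) = h \<cdot> ray_prefix \<omega> (n + m)"
    and "\<And>m. ?\<omega>' (l + m) = \<omega> (n + m)"
    by (rule boundary_act_prefix[OF h \<omega>(1)]) (rule that)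
  have eq: "ray_prefix ?\<omega>' l = h \<cdot> ray_prefix \<omega> n" using ln[of 0] by simp
  have "twalk H (ray_prefix \<omega> n)" "twalk H (ray_prefix ?\<omega>' l)"
    using twalk_path[OF \<omega>(1), of 0 n] twalk_path[OF \<omega>(2), of 0 l] arcs by simp_all
  moreover have "vx (h \<cdot> ray_prefix \<omega> n) = vx (ray_prefix \<omega> n)"
    using h assms(3) \<omega> by (simp add: vx_eq_iff mul_assoc)
  then have "walk_end H (ray_prefix ?\<omega>' l) = walk_end H (ray_prefix \<omega> n)"
    using walk_end_ray_prefix[OF \<omega>(1), of n] walk_end_ray_prefix[OF \<omega>(2), of l] eq by simp
  ultimately have "ray_prefix ?\<omega>' l = ray_prefix \<omega> n"
    using twalk_unique[OF H_vert, of "ray_prefix ?\<omega>' l" "ray_prefix \<omega> n"] \<omega> by (simp add: free_reduce_id)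
  then have "h \<cdot> ray_prefix \<omega> n \<cdot> iv (ray_prefix \<omega> n) = []" using eq \<omega> by simp
  then show ?thesis using h \<omega> by (simp add: mul_assoc)
qed

lemma boundary_act_inv:
  assumes "\<omega> \<in> boundary" "reduced h"
  shows "boundary_act h (boundary_act (iv h) \<omega>) = \<omega>" "boundary_act (iv h) (boundary_act h \<omega>) = \<omega>"
  using assms by (simp_all flip: boundary_act_mul)

text \<open>A ray outside \<Lambda> is outside \<Omega>, so some element of H takes it into
  \<Delta>; invariance of \<Lambda> puts the translate into \<Theta>, and the inverse element brings
  it back.\<close>

lemma complement_limit_set:
  "boundary - limit_set H = (\<Union>h\<in>H. boundary_act h ` Theta H T)"
proof (intro equalityI subsetI)
  fix \<omega> assume \<omega>: "\<omega> \<in> boundary - limit_set H"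
  then obtain h where h: "h \<in> H" "boundary_act h \<omega> \<in> schreier_domain H T"
    using translate_into_domain schreier_limit_set_subset by blast
  then have "boundary_act h \<omega> \<in> Theta H T"
    using \<omega> limit_set_act[OF h(1)] boundary_act_boundary by (auto simp: Theta_def)
  moreover have "boundary_act (iv h) (boundary_act h \<omega>) = \<omega>" using boundary_act_inv(2)[of \<omega> h] \<omega> h(1) by simp
  ultimately show "\<omega> \<in> (\<Union>h\<in>H. boundary_act h ` Theta H T)"
    using H_inv[OF h(1)] by (metis UN_I image_eqI)
next
  fix \<omega> assume "\<omega> \<in> (\<Union>h\<in>H. boundary_act h ` Theta H T)"
  then obtain h \<omega>' where "h \<in> H" "\<omega>' \<in> Theta H T" "\<omega> = boundary_act h \<omega>'" by blast
  then show "\<omega> \<in> boundary - limit_set H"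
    using limit_set_act boundary_act_boundary by (auto simp: in_Theta_iff)
qed

lemma disjoint_translates: "disjoint_family_on (\<lambda>h. boundary_act h ` Theta H T) H"
  unfolding disjoint_family_on_def
proof (intro ballI impI, rule ccontr)
  fix g h assume gh: "g \<in> H" "h \<in> H" "g \<noteq> h"
    and "boundary_act g ` Theta H T \<inter> boundary_act h ` Theta H T \<noteq> {}"
  then obtain \<omega> \<omega>' where \<omega>: "\<omega> \<in> Theta H T" "\<omega>' \<in> Theta H T" "boundary_act g \<omega> = boundary_act h \<omega>'" by blast
  then have b: "\<omega> \<in> boundary" "\<omega>' \<in> boundary" by (simp_all add: in_Theta_iff)
  have "boundary_act (iv h \<cdot> g) \<omega> = boundary_act (iv h) (boundary_act h \<omega>')"
    using boundary_act_mul[OF b(1)] \<omega>(3) by simp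
  also have "\<dots> = \<omega>'" using boundary_act_inv(2)[of \<omega>' h] b(2) gh(2) by simp
  finally have "boundary_act (iv h \<cdot> g) \<omega> \<in> schreier_domain H T" using \<omega>(2) by (simp add: Theta_def)
  moreover have "iv h \<cdot> g \<in> H" using gh H_mul H_inv by blast
  moreover have "\<omega> \<in> schreier_domain H T" using \<omega>(1) by (simp add: Theta_def)
  ultimately have "iv h \<cdot> g = []" using domain_translates_disjoint by blast
  then have "h \<cdot> (iv h \<cdot> g) = h" using gh(2) by simp
  then show False using gh by simp
qed

text \<open>Suppose that rays y outside \<Theta> share arbitrarily long prefixes with \<omega>. Each
  y lies in \<Lambda> or leaves T, and either way the common prefix extends to an element of H. Then
  \<omega> would lie in \<Lambda>.\<close>

lemma open_Theta: "openin boundary_topology (Theta H T)"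
  unfolding openin_boundary_topology
proof (intro conjI ballI)
  fix \<omega> assume \<omega>: "\<omega> \<in> Theta H T"
  show "\<exists>n. \<forall>y\<in>boundary. ray_prefix y n = ray_prefix \<omega> n \<longrightarrow> y \<in> Theta H T"
  proof (rule ccontr)
    assume no: "\<not> ?thesis"
    have "\<exists>h\<in>H. n \<le> length h \<and> take n h = ray_prefix \<omega> n" for n
    proof -
      have "\<not> (\<forall>y\<in>boundary. ray_prefix y n = ray_prefix \<omega> n \<longrightarrow> y \<in> Theta H T)" using no by simp
      then obtain y where y: "y \<in> boundary" "ray_prefix y n = ray_prefix \<omega> n" "y \<notin> Theta H T" by auto
      show ?thesis
      proof (cases "y \<in> limit_set H")
        case True
        then have "\<exists>h\<in>H. n \<le> length h \<and> take n h = ray_prefix y n" unfolding limit_set_iff by simp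
        then show ?thesis unfolding y(2) .
      next
        case False
        then obtain m where m: "path y m \<notin> arcs T" using y in_Theta_iff by blast
        \<comment> \<open>Up to n letters y follows \<omega>, which stays in T.\<close>
        have "n \<le> m"
        proof (rule ccontr)
          assume "\<not> n \<le> m"
          then have mn: "m < n" by simp
          then have "ray_prefix y m = ray_prefix \<omega> m" "y m = \<omega> m"
            using y(2) unfolding ray_prefix_eq_iff by auto
          then have "path y m = path \<omega> m" by (simp add: path_def)
          then show False using m \<omega> by (simp add: in_Theta_iff)
        qed
        obtain h where h: "h \<in> H" "Suc m \<le> length h" "take (Suc m) h = ray_prefix y (Suc m)"
          using crossing_extension[OF y(1) m] by blast
        have "take n h = ray_prefix y n" using take_ray_prefix_eq[OF h(3), of n] \<open>n \<le> m\<close> by simp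
        then have "take n h = ray_prefix \<omega> n" using y(2) by simp
        then show ?thesis using h \<open>n \<le> m\<close> by (intro bexI[of _ h]) simp_all
      qed
    qed
    then have "\<omega> \<in> limit_set H" using \<omega> by (simp add: limit_set_iff in_Theta_iff)
    then show False using \<omega> by (simp add: in_Theta_iff)
  qed
qed (auto simp: in_Theta_iff)

section \<open>Density of the Schreier limit set\<close>

lemma not_twalkE:
  assumes "\<not> twalk x w"
  obtains v a z where "w = v @ a # z" "(walk_end x v, a) \<notin> arcs T"
proof -
  have "\<exists>v a z. w = v @ a # z \<and> (walk_end x v, a) \<notin> arcs T"
    using assms
  proof (induction w arbitrary: x)
    case (Cons b w)
    show ?case
    proof (cases "(x, b) \<in> arcs T")
      case True
      then have "\<not> twalk (x #>\<^bsub>free_group\<^esub> [b]) w" using Cons.prems by simp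
      then obtain v a z where "w = v @ a # z" "(walk_end (x #>\<^bsub>free_group\<^esub> [b]) v, a) \<notin> arcs T"
        using Cons.IH by blast
      then show ?thesis by (intro exI[of _ "b # v"] exI[of _ a] exI[of _ z]) simp
    next
      case False
      then show ?thesis by (intro exI[of _ "[]"] exI[of _ b] exI[of _ w]) simp
    qed
  qed simp
  then show ?thesis using that by blast
qed

definition ends_off :: "'a fword \<Rightarrow> bool" where
  "ends_off u \<longleftrightarrow> reduced u \<and> u \<noteq> [] \<and> (walk_end H (butlast u), last u) \<notin> arcs T"

text \<open>After the crossing, return through T to the tail of the arc and cross it again in the
  same direction, which is not a backtracking. For a loop the tree segment is empty.\<close>

lemma ends_off_extend:
  assumes "ends_off u"
  obtains z where "z \<noteq> []" "ends_off (u @ z)"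
proof -
  obtain v a where u: "u = v @ [a]" using assms by (metis append_butlast_last_id ends_off_def)
  let ?x = "walk_end H v"
  have x: "?x \<in> V" by (rule walk_end_verts) simp
  then have off: "(?x, a) \<in> off" using assms u by (simp add: ends_off_def in_off_iff)
  let ?y = "hd_arc (?x, a)"
  have y: "?y \<in> V" using off_verts(2)[OF off] .
  let ?s = "seg ?y ?x"
  have "reduced (a # ?s @ [a])"
  proof (cases "?s = []")
    case False
    then show ?thesis
      using reduced_overlap[of "[a]" ?s "[a]"] reduced_off_seg[OF off x] reduced_seg_off[OF y off] by simp
  qed simp
  then have "reduced (v @ a # ?s @ [a])"
    using assms u by - (rule reduced_glue, simp_all add: ends_off_def)
  moreover have "walk_end H (u @ ?s) = ?x" using seg(3)[OF y x] u by simp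
  ultimately have "ends_off (u @ ?s @ [a])"
    using off u by (simp add: ends_off_def in_off_iff butlast_append)
  then show ?thesis using that by blast
qed

text \<open>The extension is repeated for ever by dependent choice. Every word of the chain ends
  with a crossing, so the limit leaves T arbitrarily late.\<close>

lemma ends_off_ray:
  assumes "ends_off u"
  obtains \<omega> where "\<omega> \<in> schreier_limit_set H T" "ray_prefix \<omega> (length u) = u"
proof -
  have "\<exists>f. \<forall>n. (ends_off (f n) \<and> n \<le> length (f n) \<and> (\<exists>z. f n = u @ z)) \<and> (\<exists>z. f (Suc n) = f n @ z)"
  proof (rule dependent_nat_choice)
    show "\<exists>w. ends_off w \<and> 0 \<le> length w \<and> (\<exists>z. w = u @ z)" using assms by auto
    fix w n assume w: "ends_off w \<and> n \<le> length w \<and> (\<exists>z. w = u @ z)"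
    then obtain z where "z \<noteq> []" "ends_off (w @ z)" using ends_off_extend by blast
    then show "\<exists>y. (ends_off y \<and> Suc n \<le> length y \<and> (\<exists>z. y = u @ z)) \<and> (\<exists>z. y = w @ z)"
      using w by (intro exI[of _ "w @ z"]) (cases z; auto)
  qed
  then obtain f where "\<forall>n. (ends_off (f n) \<and> n \<le> length (f n) \<and> (\<exists>z. f n = u @ z)) \<and> (\<exists>z. f (Suc n) = f n @ z)" ..
  then have f: "\<And>n. ends_off (f n)" "\<And>n. n \<le> length (f n)" "\<And>n. \<exists>z. f n = u @ z"
    "\<And>n. \<exists>z. f (Suc n) = f n @ z" by simp_all
  obtain \<omega> where \<omega>: "\<And>n. ray_prefix \<omega> (length (f n)) = f n" using chain_limit[of f] f(2,4) by blast
  have "reduced (ray_prefix \<omega> n)" for n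
  proof -
    have "ray_prefix \<omega> n = take n (ray_prefix \<omega> (length (f n)))" using f(2)[of n] by (simp add: min_absorb1)
    then show ?thesis using f(1)[of n] by (simp add: \<omega> ends_off_def reduced_take)
  qed
  then have b: "\<omega> \<in> boundary" by (simp add: boundary_iff)
  moreover have "\<exists>n\<ge>N. path \<omega> n \<notin> arcs T" for N
  proof -
    obtain v a where va: "f (Suc N) = v @ [a]"
      using f(1)[of "Suc N"] by (metis append_butlast_last_id ends_off_def)
    have "ray_prefix \<omega> (Suc (length v)) = v @ [a]" using \<omega>[of "Suc N"] va by simp
    then have "path \<omega> (length v) = (walk_end H v, a)" by (simp add: ray_prefix_Suc path_eq[OF b])
    moreover have "N \<le> length v" using f(2)[of "Suc N"] va by simp
    ultimately show ?thesis using f(1)[of "Suc N"] va by (intro exI[of _ "length v"]) (simp add: ends_off_def)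
  qed
  ultimately have "\<omega> \<in> schreier_limit_set H T" using in_schreier_limit_set_iff by blast
  moreover have "ray_prefix \<omega> (length u) = u"
  proof -
    obtain z where z: "f 0 = u @ z" using f(3) by blast
    have "take (length u) (f 0) = ray_prefix \<omega> (length u)"
      by (rule take_ray_prefix_eq[of "length (f 0)"]) (simp add: \<omega>, simp add: z)
    then show ?thesis by (simp add: z)
  qed
  ultimately show ?thesis using that by blast
qed

text \<open>An element h of H that follows \<omega> for a long time has to come home. If it stayed
  in T after n letters, its rest would be the tree geodesic to o, which is too short. So it crosses
  an arc outside T after position n, and its prefix up to this crossing extends to a ray of
  \<Omega>.\<close>

lemma limit_set_closure: "limit_set H = boundary_topology closure_of (schreier_limit_set H T)"
proof (intro equalityI subsetI)
  fix \<omega> assume L: "\<omega> \<in> limit_set H"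
  then have \<omega>: "\<omega> \<in> boundary" by (simp add: limit_set_iff)
  have "\<exists>\<omega>'\<in>schreier_limit_set H T \<inter> boundary. ray_prefix \<omega>' n = ray_prefix \<omega> n" for n
  proof -
    let ?x = "walk_end H (ray_prefix \<omega> n)"
    \<comment> \<open>One letter longer than the prefix followed by the way home through T.\<close>
    let ?N = "n + Suc (length (seg ?x H))"
    obtain h where h: "h \<in> H" "?N \<le> length h" "take ?N h = ray_prefix \<omega> ?N"
      using L by (auto simp: limit_set_iff)
    have tn: "take n h = ray_prefix \<omega> n"
      using h(3) by (rule take_ray_prefix_eq) simp
    have hn: "h = ray_prefix \<omega> n @ drop n h" using tn by (metis append_take_drop_id)
    have "\<not> twalk ?x (drop n h)"
    proof
      assume tw: "twalk ?x (drop n h)"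
      have "walk_end H h = H" using h(1) by (simp flip: in_H_iff)
      then have "walk_end ?x (drop n h) = H" by (metis hn walk_end_simps(3))
      then have "drop n h = seg ?x H"
        using reduced_twalk_seg[OF path_vert[OF \<omega>] tw] H_reduced[OF h(1)] by (simp add: reduced_drop)
      then have "length (seg ?x H) = length h - n" by (metis length_drop)
      then show False using h(2) by simp
    qed
    then obtain v a z where vaz: "drop n h = v @ a # z" "(walk_end ?x v, a) \<notin> arcs T"
      by (rule not_twalkE)
    let ?u = "ray_prefix \<omega> n @ v @ [a]"
    have "h = ?u @ z" using hn vaz(1) by simp
    then have "reduced ?u" using H_reduced[OF h(1)] by (metis reduced_append_iff)
    then have "ends_off ?u" using vaz(2) by (simp add: ends_off_def butlast_append)
    then obtain \<omega>' where \<omega>': "\<omega>' \<in> schreier_limit_set H T" "ray_prefix \<omega>' (length ?u) = ?u"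
      by (rule ends_off_ray)
    have "take n (ray_prefix \<omega>' (length ?u)) = ray_prefix \<omega>' n" by simp
    then have "ray_prefix \<omega>' n = ray_prefix \<omega> n" unfolding \<omega>'(2) by simp
    then show ?thesis using \<omega>'(1) by (auto simp: in_schreier_limit_set_iff)
  qed
  then show "\<omega> \<in> boundary_topology closure_of (schreier_limit_set H T)"
    using \<omega> by (simp add: in_closure_of_boundary)
next
  fix \<omega> assume "\<omega> \<in> boundary_topology closure_of (schreier_limit_set H T)"
  then have \<omega>: "\<omega> \<in> boundary" and
    near: "\<And>n. \<exists>\<omega>'\<in>schreier_limit_set H T \<inter> boundary. ray_prefix \<omega>' n = ray_prefix \<omega> n"
    by (simp_all add: in_closure_of_boundary)
  have "\<exists>h\<in>H. n \<le> length h \<and> take n h = ray_prefix \<omega> n" for n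
  proof -
    obtain \<omega>' where "\<omega>' \<in> schreier_limit_set H T" "ray_prefix \<omega>' n = ray_prefix \<omega> n" using near by blast
    moreover from this(1) have "\<omega>' \<in> limit_set H" using schreier_limit_set_subset by blast
    ultimately show ?thesis by (metis limit_set_iff)
  qed
  then show "\<omega> \<in> limit_set H" using \<omega> by (simp add: limit_set_iff)
qed

end

section \<open>Finitely generated subgroups\<close>

context schreier_tree
begin

text \<open>Geodesicity of T enters here: v labels some path in X from o to its end vertex, and no
  such path is shorter than the one in T.\<close>

lemma length_seg_le: "length (seg H (walk_end H v)) \<le> length v"
proof -
  let ?X = "schreier_graph H" and ?y = "walk_end H v"
  have y: "?y \<in> V" by (rule walk_end_verts) simp
  have "set (walk x v) \<subseteq> V \<times> UNIV" if "x \<in> V" for x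
    using that by (induction v arbitrary: x) (auto simp: step_vert)
  then have "pre_digraph.awalk ?X H (walk H v) ?y"
    unfolding pre_digraph.awalk_def cas_iff_walk[OF schreier_graph_simps(3,4)] by simp
  then have "\<exists>p. pre_digraph.awalk ?X H p ?y \<and> length p = length v"
    by (intro exI[of _ "walk H v"]) simp
  then have "graph_dist ?X H ?y \<le> length v" unfolding graph_dist_def by (rule Least_le)
  moreover have "graph_dist T H ?y = graph_dist ?X H ?y"
    using tree y by (simp add: geodesic_spanning_tree_def)
  ultimately show ?thesis using seg(4)[OF H_vert y] by simp
qed

text \<open>A prefix of h1 h2 is a prefix of h1 or the product of h1 with a prefix of h2, and in the
  second case the factor h1 in H does not change the end vertex. So each prefix ends where a prefix
  of a generator, or of the inverse of one, ends.\<close>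

lemma generate_prefix:
  assumes H: "H = generate free_group S" and S: "S \<subseteq> carrier free_group" "\<And>s. s \<in> S \<Longrightarrow> length s \<le> M"
    and "h \<in> H"
  shows "\<exists>v. reduced v \<and> length v \<le> M \<and> vx (take n h) = vx v"
proof -
  have "h \<in> generate free_group S" using assms(4) H by simp
  then show ?thesis
  proof (induction h arbitrary: n rule: generate.induct)
    case one
    show ?case by (intro exI[of _ "[]"]) simp
  next
    case (incl h)
    then have "reduced h" "length h \<le> M" using S by auto
    then show ?case by (intro exI[of _ "take n h"]) (simp add: reduced_take)
  next
    case (inv h)
    then have "reduced h" "length h \<le> M" using S by auto
    then show ?case by (intro exI[of _ "take n (iv h)"]) (simp add: reduced_take)
  next
    case (eng h1 h2)
    have h: "h1 \<in> H" "h2 \<in> H" using eng.hyps H by auto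
    obtain p c q where pcq: "h1 = p @ c" "h2 = iv c @ q" "h1 \<cdot> h2 = p @ q" "reduced (p @ q)" "reduced c"
      using mul_decomp[of h1 h2] h H_reduced by metis
    show ?case
    proof (cases "n \<le> length p")
      case True
      then have "take n (h1 \<cdot> h2) = take n h1" using pcq(1,3) by simp
      then show ?thesis using eng.IH(1)[of n] by simp
    next
      case False
      let ?q = "take (n - length p) q"
      \<comment> \<open>The cancelled part of h2 together with those letters of q that the prefix
        contains.\<close>
      let ?t = "take (length c + (n - length p)) h2"
      have t: "?t = iv c @ ?q" using pcq(2,5) by simp
      have tr: "reduced ?t" "reduced ?q" "reduced p"
        using H_reduced[OF h(2)] pcq(4) by (auto simp: reduced_append_iff intro: reduced_take)
      have n: "take n (h1 \<cdot> h2) = p @ ?q" using pcq(3) False by simp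
      have "?t = iv c \<cdot> ?q" using t tr(1) mul_append by metis
      moreover have "h1 = p \<cdot> c" using H_reduced[OF h(1)] pcq(1) mul_append by metis
      ultimately have "h1 \<cdot> ?t = p \<cdot> ?q" using tr pcq(5) by (simp add: mul_assoc)
      also have "\<dots> = p @ ?q"
        using n reduced_take[OF reduced_mul, of n h1 h2] by (intro mul_append) simp
      finally have "vx (take n (h1 \<cdot> h2)) = vx (h1 \<cdot> ?t)" using n by simp
      also have "\<dots> = vx ?t" using h tr(1) by (simp add: vx_eq_iff mul_assoc)
      finally show ?thesis using eng.IH(2)[of "length c + (n - length p)"] by simp
    qed
  qed
qed

text \<open>With M bounding the lengths of the generators, prefixes of elements of H end within
  distance M of o, whereas the prefix of length M + 1 of a ray in \<Delta> is a tree geodesic and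
  ends at distance M + 1.\<close>

lemma finitely_generated_domain:
  assumes "finitely_generated free_group H"
  shows "schreier_domain H T \<inter> limit_set H = {}"
proof (rule ccontr)
  assume "schreier_domain H T \<inter> limit_set H \<noteq> {}"
  then obtain \<omega> where \<omega>: "\<omega> \<in> schreier_domain H T" "\<omega> \<in> limit_set H" by blast
  then have b: "\<omega> \<in> boundary" by (simp add: limit_set_iff)
  obtain S where S: "finite S" "S \<subseteq> carrier free_group" "H = generate free_group S"
    using assms by (auto simp: finitely_generated_def)
  obtain M where M: "\<And>s. s \<in> S \<Longrightarrow> length s \<le> M"
    using finite_maxlen[OF S(1)] less_imp_le by blast
  let ?w = "ray_prefix \<omega> (Suc M)"
  obtain h where "h \<in> H" "take (Suc M) h = ?w" using \<omega>(2) by (auto simp: limit_set_iff)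
  then obtain v where v: "reduced v" "length v \<le> M" "vx ?w = vx v"
    using generate_prefix[OF S(3,2) M] by metis
  have "twalk H ?w" using twalk_path[OF b, of 0 "Suc M"] \<omega>(1) by (simp add: in_schreier_domain_iff)
  then have "?w = seg H (walk_end H ?w)" using reduced_twalk_seg[OF H_vert] b by simp
  moreover have "walk_end H ?w = walk_end H v"
    using v b by (simp add: walk_end_ray_prefix walk_end_H free_reduce_id)
  ultimately have "Suc M = length (seg H (walk_end H v))" by (metis length_ray_prefix)
  then show False using length_seg_le[of v] v(2) by simp
qed

section \<open>Generation by the Schreier generators\<close>

lemma gen_in_H: "e \<in> off \<Longrightarrow> gen e \<in> H"
  using reduced_gen[of e] by (simp add: in_H_iff) (simp add: gen_def seg)

text \<open>Schreier rewriting: complete each prefix of a word by the way home through T. A letter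
  along T changes nothing, a letter outside T multiplies by its generator, and for a word in H the
  way home is empty at the end.\<close>

lemma H_generated: "H = generate free_group (gen ` off)"
proof
  show "generate free_group (gen ` off) \<subseteq> H"
    using F.generate_subgroup_incl[OF _ subgroup_H, of "gen ` off"] gen_in_H by blast
  have *: "free_reduce (w @ seg (walk_end H w) H) \<in> generate free_group (gen ` off)" for w
  proof (induction w rule: rev_induct)
    case Nil
    show ?case using generate.one[of free_group "gen ` off"] by simp
  next
    case (snoc a w)
    let ?x = "walk_end H w"
    let ?y = "?x #>\<^bsub>free_group\<^esub> [a]"
    have x: "?x \<in> V" by (rule walk_end_verts) simp
    then have y: "?y \<in> V" by (rule step_vert)
    show ?case
    proof (cases "(?x, a) \<in> arcs T")
      case True
      then have "free_reduce (a # seg ?y H) = seg ?x H"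
        using twalk_seg[OF x, of "a # seg ?y H"] seg[OF y H_vert] by simp
      then have "free_reduce (w @ free_reduce (a # seg ?y H)) = free_reduce (w @ seg ?x H)" by simp
      then show ?thesis using snoc by simp
    next
      case False
      then have e: "(?x, a) \<in> off" using x by (simp add: in_off_iff)
      have "free_reduce (w @ seg ?x H) \<cdot> gen (?x, a) =
          free_reduce (w @ (seg ?x H @ seg H ?x) @ a # seg ?y H)"
        by (simp add: mul_def gen_def)
      also have "\<dots> = free_reduce (w @ free_reduce (seg ?x H @ seg H ?x) @ a # seg ?y H)"
        by (simp only: free_reduce_middle)
      also have "\<dots> = free_reduce ((w @ [a]) @ seg (walk_end H (w @ [a])) H)"
        using x by (simp add: seg_trans)
      finally show ?thesis
        using generate.eng[OF snoc generate.incl[of "gen (?x, a)" "gen ` off" free_group]] e by simp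
    qed
  qed
  show "H \<subseteq> generate free_group (gen ` off)"
  proof
    fix h assume "h \<in> H"
    then show "h \<in> generate free_group (gen ` off)"
      using *[of h] in_H_iff[of h] by (simp add: free_reduce_id)
  qed
qed

lemma finite_off_finitely_generated:
  assumes "finite off" shows "finitely_generated free_group H"
  unfolding finitely_generated_def
  using assms H_generated gen_in_H H_subset by (intro exI[of _ "gen ` off"]) auto

text \<open>Each word determines its arc, so there are infinitely many. All prefixes of the limit
  ray lie within the tree parts \<open>sigma_minus\<close> of such words, which keeps the ray in T,
  and the generators of these arcs are elements of H with the same prefixes.\<close>

lemma infinite_off_ray:
  assumes "infinite off"
  obtains \<omega> where "\<omega> \<in> schreier_domain H T" "\<omega> \<in> limit_set H"
proof -
  let ?W = "(\<lambda>e. seg H (fst e) @ [snd e]) ` off"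
  let ?C = "\<lambda>w. {u \<in> ?W. \<exists>z. u = w @ z}"
  have "inj_on (\<lambda>e. seg H (fst e) @ [snd e]) off"
  proof (rule inj_onI)
    fix e e' assume e: "e \<in> off" "e' \<in> off" and "seg H (fst e) @ [snd e] = seg H (fst e') @ [snd e']"
    then have "seg H (fst e) = seg H (fst e')" "snd e = snd e'" by simp_all
    moreover from this(1) have "fst e = fst e'"
      using seg(3)[OF H_vert off_verts(1)] e by metis
    ultimately show "e = e'" by (simp add: prod_eq_iff)
  qed
  then have W: "infinite ?W" using assms finite_imageD by blast
  have ext: "\<exists>a. infinite (?C (w @ [a]))" if "infinite (?C w)" for w
  proof (rule ccontr)
    assume "\<nexists>a. infinite (?C (w @ [a]))"
    \<comment> \<open>A word with prefix w is w itself or continues with one of finitely many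
      letters.\<close>
    then have "finite ({w} \<union> (\<Union>a. ?C (w @ [a])))" by simp
    moreover have "?C w \<subseteq> {w} \<union> (\<Union>a. ?C (w @ [a]))"
    proof
      fix u assume u: "u \<in> ?C w"
      then obtain z where z: "u = w @ z" by blast
      show "u \<in> {w} \<union> (\<Union>a. ?C (w @ [a]))"
        using u z by (cases z) auto
    qed
    ultimately show False using that finite_subset by blast
  qed
  have "\<exists>f. \<forall>n. (infinite (?C (f n)) \<and> length (f n) = n) \<and> (\<exists>z. f (Suc n) = f n @ z)"
  proof (rule dependent_nat_choice)
    show "\<exists>w. infinite (?C w) \<and> length w = 0" using W by simp
    fix w n assume w: "infinite (?C w) \<and> length w = n"
    then obtain a where "infinite (?C (w @ [a]))" using ext by blast
    then show "\<exists>y. (infinite (?C y) \<and> length y = Suc n) \<and> (\<exists>z. y = w @ z)"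
      using w by (intro exI[of _ "w @ [a]"] conjI exI[of _ "[a]"]) simp_all
  qed
  then obtain f where "\<forall>n. (infinite (?C (f n)) \<and> length (f n) = n) \<and> (\<exists>z. f (Suc n) = f n @ z)" ..
  then have f: "\<And>n. infinite (?C (f n))" "\<And>n. length (f n) = n" "\<And>n. \<exists>z. f (Suc n) = f n @ z"
    by simp_all
  obtain \<omega> where "\<And>n. ray_prefix \<omega> (length (f n)) = f n" using chain_limit[of f] f(2,3) by (metis le_refl)
  then have \<omega>: "\<And>n. ray_prefix \<omega> n = f n" by (simp add: f(2))
  have long: "\<exists>e\<in>off. \<exists>z. seg H (fst e) = ray_prefix \<omega> n @ z" for n
  proof -
    \<comment> \<open>A word other than \<open>f n\<close> is strictly longer, so without its
      crossing letter it is a tree word that still begins with \<open>f n\<close>.\<close>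
    have "\<not> ?C (f n) \<subseteq> {f n}" using f(1)[of n] finite_subset by blast
    then obtain u where "u \<in> ?C (f n)" "u \<noteq> f n" by blast
    then obtain e z where e: "e \<in> off" "u = seg H (fst e) @ [snd e]" "u = f n @ z" by blast
    then have "seg H (fst e) @ [snd e] = f n @ z" "z \<noteq> []" using \<open>u \<noteq> f n\<close> by auto
    then have "seg H (fst e) = f n @ butlast z"
      by (metis butlast_append butlast_snoc)
    then show ?thesis using e(1) by (auto simp: \<omega>)
  qed
  have red: "reduced (ray_prefix \<omega> n)" for n
  proof -
    obtain e z where "e \<in> off" "seg H (fst e) = ray_prefix \<omega> n @ z" using long by blast
    then show ?thesis using seg(1)[of H "fst e"] by (metis H_vert off_verts(1) reduced_append_iff)
  qed
  then have b: "\<omega> \<in> boundary" by (simp add: boundary_iff)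
  have "path \<omega> n \<in> arcs T" for n
  proof -
    obtain e z where e: "e \<in> off" "seg H (fst e) = ray_prefix \<omega> (Suc n) @ z" using long by blast
    then have "twalk H (ray_prefix \<omega> (0 + Suc n))"
      using seg(2)[of H "fst e"] by simp
    then show ?thesis using twalk_path[OF b, of 0 "Suc n"] by simp
  qed
  then have "\<omega> \<in> schreier_domain H T" using b by (simp add: in_schreier_domain_iff)
  moreover have "\<exists>h\<in>H. n \<le> length h \<and> take n h = ray_prefix \<omega> n" for n
  proof -
    obtain e z where e: "e \<in> off" "seg H (fst e) = ray_prefix \<omega> n @ z" using long by blast
    then show ?thesis using gen_in_H[OF e(1)] by (intro bexI[of _ "gen e"]) (simp_all add: gen_def)
  qed
  then have "\<omega> \<in> limit_set H" using b by (simp add: limit_set_iff)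
  ultimately show ?thesis using that by blast
qed

section \<open>Criteria for finite generation\<close>

lemma domain_limit_set_iff:
  "schreier_domain H T \<inter> limit_set H = {} \<longleftrightarrow> finitely_generated free_group H"
  using finitely_generated_domain infinite_off_ray finite_off_finitely_generated by blast

lemma domain_eq_Theta_iff: "schreier_domain H T = Theta H T \<longleftrightarrow> finitely_generated free_group H"
  unfolding domain_limit_set_iff[symmetric] Theta_def using in_schreier_domain_iff by blast

text \<open>\<Delta> and \<Omega> are disjoint, so \<Lambda> = \<Omega> leaves no point of \<Lambda>
  in \<Delta>. Conversely, H would move a point of \<Lambda> outside \<Omega> into \<Delta> without
  leaving \<Lambda>.\<close>

lemma limit_set_eq_iff: "limit_set H = schreier_limit_set H T \<longleftrightarrow> finitely_generated free_group H"
proof -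
  have disj: "schreier_domain H T \<inter> schreier_limit_set H T = {}"
    using in_schreier_domain_iff in_schreier_limit_set_iff by blast
  have "limit_set H \<subseteq> schreier_limit_set H T" if "schreier_domain H T \<inter> limit_set H = {}"
  proof (rule ccontr)
    assume "\<not> ?thesis"
    then obtain \<omega> where \<omega>: "\<omega> \<in> limit_set H" "\<omega> \<notin> schreier_limit_set H T" by blast
    then have b: "\<omega> \<in> boundary" by (simp add: limit_set_iff)
    obtain h where "h \<in> H" "boundary_act h \<omega> \<in> schreier_domain H T"
      using translate_into_domain[OF b \<omega>(2)] by blast
    then show False using limit_set_act[OF _ b] \<omega>(1) that by blast
  qed
  then show ?thesis
    unfolding domain_limit_set_iff[symmetric] using disj schreier_limit_set_subset by blast
qed

end

theorem theorem3p8: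
  fixes H :: "'a::finite fword set"
    and T :: "('a fword set, 'a fword set \<times> 'a letter) pre_digraph"
  assumes "CARD('a) \<ge> 2"
    and "subgroup H free_group"
    and "H \<noteq> {\<one>\<^bsub>free_group\<^esub>}"
    and "geodesic_spanning_tree T (schreier_graph H) H"
  shows
    "limit_set H =
       read_ray ` {p \<in> nb_rays (schreier_graph H) H.
                     \<forall>\<^sub>F n in sequentially. p n \<in> arcs (core H)}
     \<and>
     limit_set H = boundary_topology closure_of (schreier_limit_set H T)
     \<and>
     (boundary - limit_set H = (\<Union>h\<in>H. boundary_act h ` Theta H T) \<and>
      disjoint_family_on (\<lambda>h. boundary_act h ` Theta H T) H \<and>
      openin boundary_topology (Theta H T) \<and>
      Theta H T =
        read_ray ` {p \<in> nb_rays (schreier_graph H) H.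
                      (\<forall>n. p n \<in> arcs T) \<and>
                      (\<exists>Y. hanging_branch H Y \<and> (\<forall>\<^sub>F n in sequentially. p n \<in> arcs Y))})
     \<and>
     ((limit_set H = schreier_limit_set H T \<longleftrightarrow> finitely_generated free_group H) \<and>
      (schreier_domain H T = Theta H T \<longleftrightarrow> finitely_generated free_group H))"
proof -
  interpret schreier_tree H T
    by (intro schreier_tree.intro free_subgroup.intro schreier_tree_axioms.intro assms(2,4))
  have nontriv: "H \<noteq> {[]}" using assms(3) by simp
  have "limit_set H = {\<omega> \<in> boundary. \<forall>\<^sub>F n in sequentially. path \<omega> n \<in> arcs (core H)}"
    using limit_set_core[OF _ nontriv] limit_set_iff by blast
  then show ?thesis
    unfolding read_ray_image
    using limit_set_closure complement_limit_set disjoint_translates open_Theta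
      Theta_paths[OF nontriv, unfolded read_ray_image] limit_set_eq_iff domain_eq_Theta_iff
    by (intro conjI)
qed

end
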